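(* Let $n\ge3$ and consider the stationary McKean–Vlasov equation $\gamma^{-1}\Delta\rho+\mathrm{div}(\rho\nabla_xW_\beta(x,\cdot)*\rho)=0$ on $\mathbb S^{n-1}$ with the exponential interaction kernel $W_\beta(x,y)=-\frac1\beta e^{\beta\langle x,y\rangle}$. Then for every $\beta>0$ and every $k\in\mathbb N$, $k\ge1$, there exists a bifurcation branch around $(\bar\rho,\gamma_k)$, where $$\gamma_k=\frac{\sqrt{\beta^n}}{2^{\frac{n-2}2}\,\Gamma(\frac n2)\,I_{k+\frac{n-2}2}(\beta)}$$ and $I_\alpha$ is the modified Bessel function of the first kind.
   Context: $\sigma$ is the surface measure on $\mathbb S^{n-1}\subset\mathbb R^n$, $\omega_n=\sigma(\mathbb S^{n-1})$, $\bar\rho=1/\omega_n$, $(W*\rho)(x)=\int W(x,y)\rho(y)d\sigma(y)$. Solutions of the stationary equation are identified with zeros of the Gibbs map $F(\rho,\gamma)=\rho-\frac1{Z(\gamma,\rho)}e^{-\gamma W*\rho}$, $Z(\gamma,\rho)=\int e^{-\gamma W*\rho}d\sigma$, on $L_2(\mathbb S^{n-1})\times\mathbb R_+$. $Y_{k,0}(x)=A_kC_k^{\frac{n-2}2}(x_n)$, where $C_k^\lambda$ are the Gegenbauer polynomials and $A_k>0$ is such that $\omega_n^{-1}\int Y_{k,0}^2d\sigma=1$. A bifurcation branch around $(\bar\rho,\gamma_k)$ (at the $k$-th level) is a continuous curve of zeros of $F$, $t\mapsto(\bar\rho+tY_{k,0}+tz(t),\gamma_k+\mu(t))$, $t\in(-\delta,\delta)$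 for some $\delta>0$, with $z:(-\delta,\delta)\to L_2(\mathbb S^{n-1})$ and $\mu$ continuous, $z(0)=0$, $\mu(0)=0$. *)

theory Defs
  imports "HOL-Analysis.Analysis"
begin

text \<open>
  Surface measure on the unit sphere via polar coordinates: the measure of \<open>A\<close> is \<open>n\<close> times the
  Lebesgue measure of the cone \<open>{r x | 0 < r < 1, x \<in> A}\<close>. The space of the measure is the sphere.
\<close>

definition surface_measure :: "(real ^ 'n::finite) measure" where
  "surface_measure = scale_measure (of_nat CARD('n::finite))
     (distr (restrict_space lborel (ball 0 1 - {0})) (restrict_space borel (sphere 0 1))
       (\<lambda>x. x /\<^sub>R norm x))"

definition sphere_area :: "('n::finite) itself \<Rightarrow> real" where
  "sphere_area _ = measure (surface_measure :: (real ^ 'n::finite) measure) (sphere 0 1)"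

definition uniform_density :: "real ^ 'n::finite \<Rightarrow> real" where
  "uniform_density x = 1 / sphere_area TYPE('n::finite)"

definition interaction ::
    "(real ^ 'n::finite \<Rightarrow> real ^ 'n::finite \<Rightarrow> real) \<Rightarrow>
     (real ^ 'n::finite \<Rightarrow> real) \<Rightarrow> real ^ 'n::finite \<Rightarrow> real" where
  "interaction W \<rho> x = (\<integral>y. W x y * \<rho> y \<partial>surface_measure)"

definition partition_function ::
    "(real ^ 'n::finite \<Rightarrow> real ^ 'n::finite \<Rightarrow> real) \<Rightarrow> real \<Rightarrow> (real ^ 'n::finite \<Rightarrow> real) \<Rightarrow> real" where
  "partition_function W \<gamma> \<rho> = (\<integral>x. exp (- \<gamma> * interaction W \<rho> x) \<partial>surface_measure)"

definition gibbs_map ::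
    "(real ^ 'n::finite \<Rightarrow> real ^ 'n::finite \<Rightarrow> real) \<Rightarrow> (real ^ 'n::finite \<Rightarrow> real) \<Rightarrow> real \<Rightarrow> real ^ 'n::finite \<Rightarrow> real" where
  "gibbs_map W \<rho> \<gamma> x =
     \<rho> x - 1 / partition_function W \<gamma> \<rho> * exp (- \<gamma> * interaction W \<rho> x)"

text \<open>
  Elements of \<open>L\<^sub>2\<close> are represented by functions; equality in \<open>L\<^sub>2\<close> is equality almost everywhere.
\<close>

definition square_integrable :: "'a measure \<Rightarrow> ('a \<Rightarrow> real) \<Rightarrow> bool" where
  "square_integrable M f \<longleftrightarrow> f \<in> borel_measurable M \<and> integrable M (\<lambda>x. (f x)\<^sup>2)"

definition L2_dist :: "'a measure \<Rightarrow> ('a \<Rightarrow> real) \<Rightarrow> ('a \<Rightarrow> real) \<Rightarrow> real" where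
  "L2_dist M f g = sqrt (\<integral>x. (f x - g x)\<^sup>2 \<partial>M)"

definition L2_continuous_on :: "real set \<Rightarrow> 'a measure \<Rightarrow> (real \<Rightarrow> 'a \<Rightarrow> real) \<Rightarrow> bool" where
  "L2_continuous_on S M z \<longleftrightarrow>
     (\<forall>t\<in>S. square_integrable M (z t)) \<and>
     (\<forall>t\<in>S. ((\<lambda>s. L2_dist M (z s) (z t)) \<longlongrightarrow> 0) (at t within S))"

text \<open>The Gegenbauer polynomial \<open>C\<^sub>k\<close> with parameter \<open>l\<close>, by its three-term recurrence.\<close>

fun gegenbauer :: "nat \<Rightarrow> real \<Rightarrow> real \<Rightarrow> real" where
  "gegenbauer 0 l x = 1"
| "gegenbauer (Suc 0) l x = 2 * l * x"
| "gegenbauer (Suc (Suc k)) l x =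
     (2 * (real k + 1 + l) * x * gegenbauer (Suc k) l x - (real k + 2 * l) * gegenbauer k l x)
       / (real k + 2)"

text \<open>
  A finite index type has no distinguished last element, so the coordinate \<open>x\<^sub>n\<close> that defines
  the axis of the zonal harmonic is a parameter \<open>i\<close>.
\<close>

definition zonal_gegenbauer :: "'n::finite \<Rightarrow> nat \<Rightarrow> real ^ 'n::finite \<Rightarrow> real" where
  "zonal_gegenbauer i k x = gegenbauer k ((real CARD('n::finite) - 2) / 2) (x $ i)"

definition zonal_const :: "'n::finite \<Rightarrow> nat \<Rightarrow> real" where
  "zonal_const i k = (THE A. A > 0 \<and>
     1 / sphere_area TYPE('n::finite) *
       (\<integral>x. (A * zonal_gegenbauer i k x)\<^sup>2 \<partial>(surface_measure :: (real ^ 'n::finite) measure)) = 1)"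

definition zonal_harmonic :: "'n::finite \<Rightarrow> nat \<Rightarrow> real ^ 'n::finite \<Rightarrow> real" where
  "zonal_harmonic i k x = zonal_const i k * zonal_gegenbauer i k x"

text \<open>
  The domain of the Gibbs map is \<open>L\<^sub>2\<close> times the positive half-line, hence the condition
  \<open>\<gamma> + \<mu> t > 0\<close> along the curve.
\<close>

definition bifurcation_branch ::
    "(real ^ 'n::finite \<Rightarrow> real ^ 'n::finite \<Rightarrow> real) \<Rightarrow> 'n::finite \<Rightarrow> nat \<Rightarrow> real \<Rightarrow>
     real \<Rightarrow> (real \<Rightarrow> real ^ 'n::finite \<Rightarrow> real) \<Rightarrow> (real \<Rightarrow> real) \<Rightarrow> bool" where
  "bifurcation_branch W i k \<gamma> \<delta> z \<mu> \<longleftrightarrow>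
     \<delta> > 0 \<and>
     L2_continuous_on {-\<delta><..<\<delta>} surface_measure z \<and>
     continuous_on {-\<delta><..<\<delta>} \<mu> \<and>
     (AE x in surface_measure. z 0 x = 0) \<and> \<mu> 0 = 0 \<and>
     (\<forall>t\<in>{-\<delta><..<\<delta>}. \<gamma> + \<mu> t > 0 \<and>
        (AE x in surface_measure.
           gibbs_map W (\<lambda>y. uniform_density y + t * zonal_harmonic i k y + t * z t y) (\<gamma> + \<mu> t) x
             = 0))"

definition exp_kernel :: "real \<Rightarrow> real ^ 'n::finite \<Rightarrow> real ^ 'n::finite \<Rightarrow> real" where
  "exp_kernel \<beta> x y = - (1 / \<beta>) * exp (\<beta> * (x \<bullet> y))"

text \<open>
  The modified Bessel function of the first kind on the positive half-line, by its power series;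
  \<open>rGamma\<close> is the reciprocal Gamma function.
\<close>

definition bessel_I :: "real \<Rightarrow> real \<Rightarrow> real" where
  "bessel_I \<alpha> x =
     (\<Sum>m. rGamma (real m + \<alpha> + 1) / fact m * (x / 2) powr (2 * real m + \<alpha>))"

end

theory Submission
  imports Defs
begin

text \<open>
  Write the density as \<open>\<rho> = (1 + \<eta>) / \<omega>\<^sub>n\<close> and let \<open>A\<close> be convolution with \<open>exp (\<beta> (x \<bullet> y))\<close> with respect to
  the normalized measure on the sphere. For \<open>\<eta>\<close> of mean zero and \<open>\<kappa> = \<gamma> / \<beta>\<close> the Gibbs map vanishes if
  and only if \<open>1 + \<eta>\<close> is proportional to \<open>exp (\<kappa> A \<eta>)\<close>, and the linearization at \<open>\<eta> = 0\<close> is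
  \<open>\<eta> - \<kappa> A \<eta>\<close>. The operator \<open>A\<close> commutes with rotations. On functions of the coordinate \<open>x\<^sub>i\<close> its
  eigenfunctions are the Gegenbauer polynomials \<open>C\<^sub>k\<close>, with eigenvalues \<open>\<alpha>\<^sub>k\<close> that are, up to a common
  factor, the Bessel functions \<open>I\<^sub>k\<^sub>+\<^sub>(\<^sub>n\<^sub>-\<^sub>2\<^sub>)\<^sub>/\<^sub>2(\<beta>)\<close>. These decrease strictly in \<open>k\<close>, so among zonal functions each
  eigenvalue is simple, and a branch leaves the uniform state in the direction of \<open>C\<^sub>k\<close> at the value
  \<open>\<kappa> = 1 / \<alpha>\<^sub>k\<close>, as in the theorem of Crandall and Rabinowitz.

  The spectral part is \<open>sphere_mean_exp_gegenbauer\<close>, a Funk--Hecke formula obtained by induction on the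
  degree: the three-term recurrence of the Gegenbauer polynomials turns, by differentiation in the
  axial variable, into the recurrence of the Bessel functions. The induction starts from the
  moments of a coordinate, which follow from rotation invariance. Orthogonality of the \<open>C\<^sub>k\<close> is then a
  consequence of the self-adjointness of \<open>A\<close> and of the strict monotonicity of the eigenvalues
  (\<open>bessel_series_decreasing\<close>). In place of completeness, \<open>zonal_conv_small\<close> shows that \<open>A\<close> is as small as
  required in the supremum norm on the functions orthogonal to \<open>C\<^sub>0, \<dots>, C\<^sub>N\<^sub>-\<^sub>1\<close>.

  For the nonlinear part (lemma \<open>branch\<close>) one inserts \<open>\<eta> = t (C\<^sub>k + z)\<close> and \<open>\<kappa> = 1 / \<alpha>\<^sub>k + m\<close>, divides by
  \<open>t\<close> and separates modes. The constants drop out because both sides have mean zero. The finitely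
  many other low modes apart from \<open>k\<close> are inverted because their eigenvalues differ from \<open>\<alpha>\<^sub>k\<close>; the
  mode \<open>k\<close> determines \<open>m\<close>; the high modes are handled by smallness of \<open>A\<close>. The result is a fixed point
  equation for a contraction, uniformly in \<open>t\<close>, in the space of bounded
  continuous profiles. Continuity of the profiles in the supremum norm gives continuity of the
  branch in \<open>L\<^sub>2\<close>.
\<close>

section \<open>The surface measure\<close>

lemma nn_integral_lborel_translate:
  fixes h :: "'a::euclidean_space \<Rightarrow> ennreal"
  assumes "h \<in> borel_measurable borel"
  shows "(\<integral>\<^sup>+x. h (x + c) \<partial>lborel) = (\<integral>\<^sup>+x. h x \<partial>lborel)"
proof -
  have "(\<integral>\<^sup>+x. h x \<partial>distr lborel borel ((+) c)) = (\<integral>\<^sup>+x. h (c + x) \<partial>lborel)"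
    using assms by (intro nn_integral_distr) auto
  then show ?thesis by (simp add: lborel_distr_plus add.commute)
qed

lemma orthogonal_transformation_measurable:
  fixes Q :: "'a::euclidean_space \<Rightarrow> 'a"
  assumes "orthogonal_transformation Q"
  shows "Q \<in> borel_measurable borel"
  using assms by (intro borel_measurable_continuous_onI linear_continuous_on)
    (auto simp: orthogonal_transformation_linear linear_conv_bounded_linear[symmetric])

text \<open>
  The image of Lebesgue measure under an orthogonal map is again translation invariant. By
  Fubini's theorem a translation invariant measure is a multiple of Lebesgue measure, and the
  factor is one because the unit ball is preserved. The argument produces a reflection
  \<open>y \<mapsto> - y\<close>, which is removed by applying it to the identity as well.
\<close>

lemma nn_integral_lborel_orthogonal:
  fixes Q :: "'a::euclidean_space \<Rightarrow> 'a"
  assumes Q: "orthogonal_transformation Q" and f [measurable]: "f \<in> borel_measurable borel"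
  shows "(\<integral>\<^sup>+x. f (Q x) \<partial>lborel) = (\<integral>\<^sup>+x. f x \<partial>lborel)"
proof -
  define g :: "'a \<Rightarrow> ennreal" where "g = indicator (ball 0 1)"
  have [measurable]: "g \<in> borel_measurable borel" unfolding g_def by (intro borel_measurable_indicator) simp
  have neg: "(\<integral>\<^sup>+x. f (Q x) \<partial>lborel) = (\<integral>\<^sup>+y. f (- y) \<partial>lborel)"
    if Q: "orthogonal_transformation Q" for Q :: "'a \<Rightarrow> 'a"
  proof -
    note [measurable] = orthogonal_transformation_measurable[OF Q]
    have lin: "Q (a + b) = Q a + Q b" "Q (a - b) = Q a - Q b" for a b
      using Q by (simp_all add: linear_add linear_diff orthogonal_transformation_linear)
    have inv: "Q (inv Q y) = y" for y
      using Q by (simp add: orthogonal_transformation_surj surj_f_inv_f)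
    have gQ: "g (Q x) = g x" for x using Q by (simp add: g_def orthogonal_transformation indicator_def)
    have "(\<integral>\<^sup>+x. f (Q x) \<partial>lborel) * (\<integral>\<^sup>+y. g y \<partial>lborel)
        = (\<integral>\<^sup>+x. f (Q x) * (\<integral>\<^sup>+y. g (y + Q x) \<partial>lborel) \<partial>lborel)"
      by (simp add: nn_integral_lborel_translate nn_integral_multc)
    also have "\<dots> = (\<integral>\<^sup>+x. \<integral>\<^sup>+y. f (Q x) * g (y + Q x) \<partial>lborel \<partial>lborel)"
      by (simp add: nn_integral_cmult)
    also have "\<dots> = (\<integral>\<^sup>+y. \<integral>\<^sup>+x. f (Q x) * g (y + Q x) \<partial>lborel \<partial>lborel)"
      by (rule lborel_pair.Fubini'[symmetric]) measurable
    also have "\<dots> = (\<integral>\<^sup>+y. \<integral>\<^sup>+x. f (Q x - y) * g (Q x) \<partial>lborel \<partial>lborel)"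
    proof (rule nn_integral_cong)
      fix y :: 'a
      have "(\<integral>\<^sup>+x. f (Q x) * g (y + Q x) \<partial>lborel)
          = (\<integral>\<^sup>+x. f (Q (x + (- inv Q y))) * g (y + Q (x + (- inv Q y))) \<partial>lborel)"
        by (rule nn_integral_lborel_translate[symmetric]) measurable
      then show "(\<integral>\<^sup>+x. f (Q x) * g (y + Q x) \<partial>lborel) = (\<integral>\<^sup>+x. f (Q x - y) * g (Q x) \<partial>lborel)"
        by (simp add: lin inv)
    qed
    also have "\<dots> = (\<integral>\<^sup>+x. \<integral>\<^sup>+y. f (Q x - y) * g (Q x) \<partial>lborel \<partial>lborel)"
      by (rule lborel_pair.Fubini') measurable
    also have "\<dots> = (\<integral>\<^sup>+x. (\<integral>\<^sup>+y. f (- y) \<partial>lborel) * g x \<partial>lborel)"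
    proof (rule nn_integral_cong)
      fix x :: 'a
      have "(\<integral>\<^sup>+y. f (Q x - y) \<partial>lborel) = (\<integral>\<^sup>+y. f (Q x - (y + Q x)) \<partial>lborel)"
        by (rule nn_integral_lborel_translate[symmetric]) measurable
      then show "(\<integral>\<^sup>+y. f (Q x - y) * g (Q x) \<partial>lborel) = (\<integral>\<^sup>+y. f (- y) \<partial>lborel) * g x"
        by (simp add: nn_integral_multc gQ)
    qed
    also have "\<dots> = (\<integral>\<^sup>+y. f (- y) \<partial>lborel) * (\<integral>\<^sup>+y. g y \<partial>lborel)"
      by (simp add: nn_integral_cmult)
    finally have eq: "(\<integral>\<^sup>+x. f (Q x) \<partial>lborel) * (\<integral>\<^sup>+y. g y \<partial>lborel)
        = (\<integral>\<^sup>+y. f (- y) \<partial>lborel) * (\<integral>\<^sup>+y. g y \<partial>lborel)" .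
    have "(\<integral>\<^sup>+y. g y \<partial>lborel) = emeasure lborel (ball 0 (1::real) :: 'a set)"
      unfolding g_def by simp
    moreover have "emeasure lborel (ball 0 (1::real) :: 'a set) \<noteq> 0"
      using open_not_negligible[of "ball 0 1 :: 'a set"]
      by (auto simp: negligible_iff_null_sets null_sets_def)
    moreover have "emeasure lborel (ball 0 (1::real) :: 'a set) \<noteq> \<infinity>"
      using emeasure_lborel_ball_finite[of 0 1] by (metis less_irrefl)
    ultimately show ?thesis
      using eq by (metis ennreal_mult_cancel_left infinity_ennreal_def mult.commute)
  qed
  have "orthogonal_transformation (\<lambda>x::'a. x)" by simp
  from neg[OF this] neg[OF Q] show ?thesis by simp
qed

lemma lborel_orthogonal_vimage:
  fixes Q :: "'a::euclidean_space \<Rightarrow> 'a"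
  assumes Q: "orthogonal_transformation Q" and A: "A \<in> sets borel"
  shows "emeasure lborel (Q -` A) = emeasure lborel A"
proof -
  have "Q -` A \<in> sets borel"
    using measurable_sets_borel[OF orthogonal_transformation_measurable[OF Q] A] .
  moreover have "(\<integral>\<^sup>+x. indicator A (Q x) \<partial>lborel) = (\<integral>\<^sup>+x. indicator (Q -` A) x \<partial>lborel)"
    by (rule nn_integral_cong) (simp add: indicator_def)
  ultimately show ?thesis
    using nn_integral_lborel_orthogonal[OF Q, of "indicator A"] A by simp
qed

lemma space_surface_measure [simp]: "space (surface_measure :: (real^'n::finite) measure) = sphere 0 1"
  by (simp add: surface_measure_def space_scale_measure space_restrict_space)

lemma sets_surface_measure [measurable_cong]:
  "sets (surface_measure :: (real^'n::finite) measure) = sets (restrict_space borel (sphere 0 1))"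
  by (simp add: surface_measure_def)

lemma radial_projection_measurable:
  "(\<lambda>x::real^'n::finite. x /\<^sub>R norm x)
     \<in> restrict_space lborel (ball 0 1 - {0}) \<rightarrow>\<^sub>M restrict_space borel (sphere 0 1)"
proof (rule measurable_restrict_space2)
  have eq: "sets (restrict_space lborel (ball 0 1 - {0::real^'n})) = sets (restrict_space borel (ball 0 1 - {0}))"
    by (rule sets_restrict_space_cong) simp
  have "(\<lambda>x::real^'n. x /\<^sub>R norm x) \<in> restrict_space borel (ball 0 1 - {0}) \<rightarrow>\<^sub>M borel"
    by (intro borel_measurable_continuous_on_restrict continuous_intros) auto
  then show "(\<lambda>x::real^'n. x /\<^sub>R norm x) \<in> restrict_space lborel (ball 0 1 - {0}) \<rightarrow>\<^sub>M borel"
    using measurable_cong_sets[OF eq refl] by blast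
qed (auto simp: space_restrict_space)

lemma sets_open_Int_sphere:
  fixes U :: "(real^'n::finite) set"
  assumes "open U"
  shows "U \<inter> sphere 0 1 \<in> sets (restrict_space borel (sphere 0 1))"
  unfolding sets_restrict_space by (rule image_eqI[of _ _ U]) (use assms in auto)

lemma emeasure_surface_measure:
  fixes A :: "(real^'n::finite) set"
  assumes "A \<in> sets (restrict_space borel (sphere 0 1))"
  shows "emeasure surface_measure A =
    of_nat CARD('n) * emeasure lborel ((\<lambda>x. x /\<^sub>R norm x) -` A \<inter> (ball 0 1 - {0}))"
proof -
  have "emeasure surface_measure A = of_nat CARD('n) *
     emeasure (restrict_space lborel (ball 0 1 - {0::real^'n})) ((\<lambda>x. x /\<^sub>R norm x) -` A \<inter> (ball 0 1 - {0}))"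
    unfolding surface_measure_def emeasure_scale_measure
    by (subst emeasure_distr[OF radial_projection_measurable assms]) (simp add: space_restrict_space)
  also have "emeasure (restrict_space lborel (ball 0 1 - {0::real^'n})) ((\<lambda>x. x /\<^sub>R norm x) -` A \<inter> (ball 0 1 - {0}))
     = emeasure lborel ((\<lambda>x. x /\<^sub>R norm x) -` A \<inter> (ball 0 1 - {0}))"
    by (rule emeasure_restrict_space) auto
  finally show ?thesis .
qed

lemma sets_radial_preimage:
  fixes A :: "(real^'n::finite) set"
  assumes "A \<in> sets (restrict_space borel (sphere 0 1))"
  shows "(\<lambda>x. x /\<^sub>R norm x) -` A \<inter> (ball 0 1 - {0}) \<in> sets borel"
proof -
  have "(\<lambda>x. x /\<^sub>R norm x) -` A \<inter> (ball 0 1 - {0})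
      \<in> sets (restrict_space lborel (ball 0 1 - {0::real^'n}))"
    using measurable_sets[OF radial_projection_measurable assms] by (simp add: space_restrict_space)
  then show ?thesis by (auto simp: sets_restrict_space)
qed

lemma finite_surface_measure: "finite_measure (surface_measure :: (real^'n::finite) measure)"
proof
  have "emeasure (surface_measure :: (real^'n) measure) (sphere 0 1) \<noteq> \<infinity>"
  proof (subst emeasure_surface_measure)
    show "sphere 0 1 \<in> sets (restrict_space borel (sphere (0::real^'n) 1))"
      using sets_open_Int_sphere[OF open_UNIV] by simp
    have "emeasure lborel ((\<lambda>x. x /\<^sub>R norm x) -` sphere 0 1 \<inter> (ball 0 1 - {0::real^'n}))
        \<le> emeasure lborel (ball (0::real^'n) 1)"
      by (rule emeasure_mono) auto
    also have "\<dots> < \<infinity>" using emeasure_lborel_ball_finite by simp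
    finally show "of_nat CARD('n) *
        emeasure lborel ((\<lambda>x. x /\<^sub>R norm x) -` sphere 0 1 \<inter> (ball 0 1 - {0::real^'n})) \<noteq> \<infinity>"
      by (auto simp: ennreal_mult_eq_top_iff)
  qed
  then show "emeasure (surface_measure :: (real^'n) measure) (space surface_measure) \<noteq> \<infinity>"
    by simp
qed

interpretation surface: finite_measure "surface_measure :: (real^'n::finite) measure"
  by (rule finite_surface_measure)

text \<open>
  The cone over an open subset of the sphere is open, hence of positive Lebesgue measure. Thus a
  continuous function that vanishes almost everywhere on the sphere vanishes on the sphere.
\<close>

lemma surface_measure_open_pos:
  fixes U :: "(real^'n::finite) set"
  assumes U: "open U" "x \<in> U" "norm x = 1"
  shows "measure surface_measure (U \<inter> sphere 0 1) > 0"
proof -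
  let ?C = "(\<lambda>x. x /\<^sub>R norm x) -` (U \<inter> sphere 0 1) \<inter> (ball 0 1 - {0::real^'n})"
  have sU: "U \<inter> sphere 0 1 \<in> sets (restrict_space borel (sphere (0::real^'n) 1))"
    using U(1) by (rule sets_open_Int_sphere)
  have "?C = (ball 0 1 - {0}) \<inter> (\<lambda>x. x /\<^sub>R norm x) -` U"
    by auto
  also have "open \<dots>"
    by (rule continuous_open_preimage) (auto intro!: continuous_intros U(1))
  finally have oC: "open ?C" .
  have "x \<noteq> 0" using U(3) by auto
  then have "(1/2) *\<^sub>R x \<in> ?C" using U(2,3) by simp
  then have "?C \<noteq> {}" by blast
  with oC have "\<not> negligible ?C" by (rule open_not_negligible)
  then have "emeasure lborel ?C \<noteq> 0"
    using oC by (simp add: negligible_iff_null_sets null_sets_def)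
  then have "emeasure surface_measure (U \<inter> sphere 0 1) \<noteq> 0"
    by (simp add: emeasure_surface_measure[OF sU])
  then show ?thesis
    by (metis surface.emeasure_eq_measure ennreal_0 less_eq_real_def measure_nonneg)
qed

lemma sphere_area_pos: "sphere_area TYPE('n::finite) > 0"
proof -
  obtain x :: "real^'n" where "norm x = 1"
    using norm_axis_1 by blast
  then show ?thesis
    using surface_measure_open_pos[of UNIV x] by (simp add: sphere_area_def)
qed

lemma orthogonal_transformation_measurable_surface:
  fixes Q :: "real^'n::finite \<Rightarrow> real^'n"
  assumes "orthogonal_transformation Q"
  shows "Q \<in> surface_measure \<rightarrow>\<^sub>M surface_measure"
  unfolding measurable_cong_sets[OF sets_surface_measure sets_surface_measure]
  by (rule measurable_restrict_space3)
     (use assms orthogonal_transformation_measurable[OF assms] in \<open>auto simp: orthogonal_transformation\<close>)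

lemma distr_surface_measure_orthogonal:
  fixes Q :: "real^'n::finite \<Rightarrow> real^'n"
  assumes Q: "orthogonal_transformation Q"
  shows "distr surface_measure surface_measure Q = surface_measure"
proof -
  have nQ: "norm (Q x) = norm x" for x using Q by (simp add: orthogonal_transformation)
  have mQ: "Q \<in> surface_measure \<rightarrow>\<^sub>M surface_measure"
    by (rule orthogonal_transformation_measurable_surface[OF Q])
  show ?thesis
  proof (rule measure_eqI)
    fix A assume "A \<in> sets (distr (surface_measure :: (real^'n) measure) surface_measure Q)"
    then have A: "A \<in> sets (restrict_space borel (sphere (0::real^'n) 1))"
      by (simp add: sets_surface_measure)
    then have AS: "A \<subseteq> sphere 0 1" by (auto simp: sets_restrict_space)
    let ?cone = "\<lambda>A. (\<lambda>x. x /\<^sub>R norm x) -` A \<inter> (ball 0 1 - {0::real^'n})"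
    have A': "Q -` A \<inter> sphere 0 1 \<in> sets (restrict_space borel (sphere (0::real^'n) 1))"
      using measurable_sets[OF mQ, of A] A by (simp add: sets_surface_measure)
    have "Q (x /\<^sub>R norm x) = Q x /\<^sub>R norm (Q x)" for x
      using Q by (simp add: nQ linear_cmul orthogonal_transformation_linear)
    moreover have "Q x = 0 \<longleftrightarrow> x = 0" for x using nQ[of x] by (metis norm_eq_zero)
    ultimately have cone: "?cone (Q -` A \<inter> sphere 0 1) = Q -` (?cone A)"
      using AS by (auto simp: nQ)
    have "emeasure (distr surface_measure surface_measure Q) A
        = emeasure surface_measure (Q -` A \<inter> sphere 0 1)"
      using A by (subst emeasure_distr[OF mQ]) (simp_all add: sets_surface_measure)
    also have "\<dots> = of_nat CARD('n) * emeasure lborel (Q -` (?cone A))"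
      by (simp only: emeasure_surface_measure[OF A'] cone)
    also have "emeasure lborel (Q -` (?cone A)) = emeasure lborel (?cone A)"
      by (rule lborel_orthogonal_vimage[OF Q sets_radial_preimage[OF A]])
    finally show "emeasure (distr surface_measure surface_measure Q) A = emeasure surface_measure A"
      by (simp add: emeasure_surface_measure[OF A])
  qed simp
qed

section \<open>Means over the sphere\<close>

definition sphere_mean :: "(real^'n::finite \<Rightarrow> real) \<Rightarrow> real" where
  "sphere_mean f = (\<integral>x. f x \<partial>surface_measure) / sphere_area TYPE('n)"

lemma borel_measurable_surface:
  fixes f :: "real^'n::finite \<Rightarrow> real"
  assumes "continuous_on (sphere 0 1) f"
  shows "f \<in> borel_measurable surface_measure"
  unfolding measurable_cong_sets[OF sets_surface_measure refl]
  by (rule borel_measurable_continuous_on_restrict[OF assms])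

lemma integrable_surface:
  fixes f :: "real^'n::finite \<Rightarrow> real"
  assumes "continuous_on (sphere 0 1) f"
  shows "integrable surface_measure f"
proof -
  have "bounded (f ` sphere 0 1)"
    by (rule compact_imp_bounded[OF compact_continuous_image[OF assms compact_sphere]])
  then obtain B where "\<And>x. x \<in> sphere 0 1 \<Longrightarrow> norm (f x) \<le> B"
    unfolding bounded_iff by blast
  then show ?thesis
    using borel_measurable_surface[OF assms] by (intro surface.integrable_const_bound[of _ B]) auto
qed

lemma sphere_mean_cong:
  "(\<And>x. norm x = 1 \<Longrightarrow> f x = g x) \<Longrightarrow> sphere_mean f = sphere_mean g"
  unfolding sphere_mean_def
  by (intro arg_cong2[where f = "(/)"] Bochner_Integration.integral_cong) auto

lemma sphere_mean_const [simp]: "sphere_mean (\<lambda>x. c) = c"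
  using sphere_area_pos[where 'n='a] by (simp add: sphere_mean_def sphere_area_def)

lemma sphere_mean_cmult [simp]: "sphere_mean (\<lambda>x. c * f x) = c * sphere_mean f"
  by (simp add: sphere_mean_def)

lemma sphere_mean_add:
  fixes f g :: "real^'n::finite \<Rightarrow> real"
  assumes "continuous_on (sphere 0 1) f" "continuous_on (sphere 0 1) g"
  shows "sphere_mean (\<lambda>x. f x + g x) = sphere_mean f + sphere_mean g"
  using assms by (simp add: sphere_mean_def integrable_surface add_divide_distrib)

lemma sphere_mean_diff:
  fixes f g :: "real^'n::finite \<Rightarrow> real"
  assumes "continuous_on (sphere 0 1) f" "continuous_on (sphere 0 1) g"
  shows "sphere_mean (\<lambda>x. f x - g x) = sphere_mean f - sphere_mean g"
  using assms by (simp add: sphere_mean_def integrable_surface diff_divide_distrib)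

lemma sphere_mean_sum:
  fixes f :: "'a \<Rightarrow> real^'n::finite \<Rightarrow> real"
  assumes "\<And>i. i \<in> I \<Longrightarrow> continuous_on (sphere 0 1) (f i)"
  shows "sphere_mean (\<lambda>x. \<Sum>i\<in>I. f i x) = (\<Sum>i\<in>I. sphere_mean (f i))"
  using assms by (simp add: sphere_mean_def integrable_surface sum_divide_distrib)

lemma sphere_mean_mono:
  fixes f g :: "real^'n::finite \<Rightarrow> real"
  assumes "continuous_on (sphere 0 1) f" "continuous_on (sphere 0 1) g"
    and "\<And>x. norm x = 1 \<Longrightarrow> f x \<le> g x"
  shows "sphere_mean f \<le> sphere_mean g"
  unfolding sphere_mean_def using assms sphere_area_pos[where 'n='n]
  by (intro divide_right_mono integral_mono integrable_surface) auto

lemma sphere_mean_abs_le: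
  fixes f :: "real^'n::finite \<Rightarrow> real"
  assumes f: "continuous_on (sphere 0 1) f" and B: "\<And>x. norm x = 1 \<Longrightarrow> \<bar>f x\<bar> \<le> B"
  shows "\<bar>sphere_mean f\<bar> \<le> B"
proof -
  have *: "f x \<le> B" "- B \<le> f x" if "norm x = 1" for x using B[OF that] by auto
  have "sphere_mean f \<le> sphere_mean (\<lambda>x::real^'n. B)" "sphere_mean (\<lambda>x::real^'n. - B) \<le> sphere_mean f"
    by (rule sphere_mean_mono; use f * in simp)+
  then show ?thesis by simp
qed

lemma sphere_mean_orthogonal:
  fixes Q :: "real^'n::finite \<Rightarrow> real^'n"
  assumes Q: "orthogonal_transformation Q" and f: "continuous_on (sphere 0 1) f"
  shows "sphere_mean (\<lambda>x. f (Q x)) = sphere_mean f"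
proof -
  have mQ: "Q \<in> surface_measure \<rightarrow>\<^sub>M surface_measure"
    by (rule orthogonal_transformation_measurable_surface[OF Q])
  have "(\<integral>x. f x \<partial>distr surface_measure surface_measure Q) = (\<integral>x. f (Q x) \<partial>surface_measure)"
    by (rule integral_distr[OF mQ borel_measurable_surface[OF f]])
  then show ?thesis
    by (simp add: distr_surface_measure_orthogonal[OF Q] sphere_mean_def)
qed

lemma sphere_mean_eq_0_imp:
  fixes f :: "real^'n::finite \<Rightarrow> real"
  assumes f: "continuous_on UNIV f" and nn: "\<And>x. norm x = 1 \<Longrightarrow> f x \<ge> 0"
    and 0: "sphere_mean f = 0" and x: "norm x = 1"
  shows "f x = 0"
proof (rule ccontr)
  assume "f x \<noteq> 0"
  define c where "c = f x / 2"
  with nn[OF x] \<open>f x \<noteq> 0\<close> have c: "c > 0" "f x > c" by auto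
  let ?U = "{y. c < f y}"
  have "open ?U" using f by (intro open_Collect_less) (auto intro: continuous_intros)
  then have pos: "measure surface_measure (?U \<inter> sphere 0 1) > 0"
    using surface_measure_open_pos[of ?U x] c x by auto
  have fs: "continuous_on (sphere 0 1) f" using f continuous_on_subset by blast
  have sU: "?U \<inter> sphere 0 1 \<in> sets surface_measure"
    unfolding sets_surface_measure using \<open>open ?U\<close> by (rule sets_open_Int_sphere)
  have "c * measure surface_measure (?U \<inter> sphere 0 1)
      = (\<integral>y. c * indicator (?U \<inter> sphere 0 1) y \<partial>surface_measure)"
    using sU by simp
  also have "\<dots> \<le> (\<integral>y. f y \<partial>surface_measure)"
  proof (rule integral_mono)
    show "integrable surface_measure (\<lambda>y. c * indicator (?U \<inter> sphere 0 1) y)"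
      using sU by (intro integrable_mult_right) (simp add: integrable_indicator_iff surface.emeasure_finite less_top[symmetric])
    show "c * indicator (?U \<inter> sphere 0 1) y \<le> f y" if "y \<in> space surface_measure" for y
      using that nn[of y] by (auto simp: indicator_def)
  qed (rule integrable_surface[OF fs])
  also have "\<dots> = 0" using 0 sphere_area_pos[where 'n='n] by (simp add: sphere_mean_def)
  finally show False using c pos by (simp add: mult_le_0_iff)
qed

section \<open>Reflections and zonal functions\<close>

definition reflect :: "'a::real_inner \<Rightarrow> 'a \<Rightarrow> 'a" where
  "reflect v x = x - (2 * (x \<bullet> v) / (v \<bullet> v)) *\<^sub>R v"

lemma orthogonal_reflect: "orthogonal_transformation (reflect v)"
proof -
  have "linear (reflect v)"
    unfolding reflect_def
    by (rule linearI) (auto simp: inner_add_left algebra_simps add_divide_distrib)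
  moreover have "reflect v x \<bullet> reflect v y = x \<bullet> y" for x y
    by (cases "v = 0") (auto simp: reflect_def inner_diff_left inner_diff_right inner_commute field_simps)
  ultimately show ?thesis by (simp add: orthogonal_transformation_def)
qed

lemma reflect_swap:
  assumes "norm x = norm y"
  shows "reflect (x - y) x = y"
proof (cases "x = y")
  case False
  have "x \<bullet> x = y \<bullet> y" using assms by (simp add: norm_eq)
  then have "2 * (x \<bullet> (x - y)) = (x - y) \<bullet> (x - y)"
    by (simp add: inner_diff_left inner_diff_right inner_commute)
  then show ?thesis using False by (simp add: reflect_def)
qed (simp add: reflect_def)

lemma inner_orthogonal_transformation_shift:
  assumes "orthogonal_transformation Q" "Q x = y"
  shows "y \<bullet> Q z = x \<bullet> z"
  using assms by (auto simp: orthogonal_transformation_def)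

lemma reflect_nth:
  fixes v x :: "real^'n::finite"
  assumes "v $ i = 0" shows "reflect v x $ i = x $ i"
  using assms by (simp add: reflect_def)

text \<open>
  The reflection that swaps two points of a parallel fixes the axis, so it changes neither
  \<open>y $ i\<close> nor the measure. Hence the convolution of a zonal function is zonal.
\<close>

lemma sphere_mean_zonal_transport:
  fixes x x' :: "real^'n::finite"
  assumes "norm x = norm x'" "x $ i = x' $ i"
    and \<phi>: "continuous_on UNIV \<phi>" and g: "continuous_on UNIV g"
  shows "sphere_mean (\<lambda>y. \<phi> (x \<bullet> y) * g (y $ i)) = sphere_mean (\<lambda>y. \<phi> (x' \<bullet> y) * g (y $ i))"
proof -
  let ?Q = "reflect (x - x')"
  have Q: "orthogonal_transformation ?Q" by (rule orthogonal_reflect)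
  have "sphere_mean (\<lambda>y. \<phi> (x' \<bullet> ?Q y) * g (?Q y $ i)) = sphere_mean (\<lambda>y. \<phi> (x' \<bullet> y) * g (y $ i))"
    by (rule sphere_mean_orthogonal[OF Q])
       (intro continuous_intros continuous_on_compose2[OF \<phi>] continuous_on_compose2[OF g]; simp)
  moreover have "x' \<bullet> ?Q y = x \<bullet> y" for y
    using inner_orthogonal_transformation_shift[OF Q reflect_swap[OF assms(1)]] .
  moreover have "?Q y $ i = y $ i" for y using assms(2) by (intro reflect_nth) simp
  ultimately show ?thesis by simp
qed

section \<open>Moments of a coordinate\<close>

lemma axis_nth: "axis j (c::real) $ i = (if i = j then c else 0)"
  by (simp add: axis_def)

lemma continuous_on_coord:
  assumes "continuous_on UNIV g"
  shows "continuous_on S (\<lambda>y::real^'n::finite. g (y $ i) :: real)"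
  by (rule continuous_on_compose2[OF assms]) (auto intro!: continuous_intros)

lemma abs_coord_le_1: "norm (y::real^'n::finite) = 1 \<Longrightarrow> \<bar>y $ i\<bar> \<le> 1"
  using component_le_norm_cart[of y i] by simp

lemma sphere_mean_inner:
  fixes x :: "real^'n::finite" and i :: 'n
  assumes \<phi>: "continuous_on UNIV \<phi>"
  shows "sphere_mean (\<lambda>y. \<phi> (x \<bullet> y)) = sphere_mean (\<lambda>y. \<phi> (norm x * y $ i))"
proof -
  let ?a = "norm x *\<^sub>R axis i 1 :: real^'n"
  let ?Q = "reflect (x - ?a)"
  have Q: "orthogonal_transformation ?Q" by (rule orthogonal_reflect)
  have "sphere_mean (\<lambda>y. \<phi> (?a \<bullet> ?Q y)) = sphere_mean (\<lambda>y. \<phi> (?a \<bullet> y))"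
    by (rule sphere_mean_orthogonal[OF Q]) (intro continuous_intros continuous_on_compose2[OF \<phi>]; simp)
  moreover have "?a \<bullet> ?Q y = x \<bullet> y" for y
    by (rule inner_orthogonal_transformation_shift[OF Q reflect_swap]) (simp add: norm_axis_1)
  ultimately show ?thesis by (simp add: inner_axis')
qed

lemma sphere_mean_divide [simp]: "sphere_mean (\<lambda>x. f x / c) = sphere_mean f / c"
  using sphere_mean_cmult[of "1 / c" f] by simp

lemma sphere_mean_flip:
  fixes f :: "real^'n::finite \<Rightarrow> real"
  assumes f: "continuous_on UNIV f" and flip: "\<And>y. f (reflect (axis j 1) y) = - f y"
  shows "sphere_mean f = 0"
proof -
  have "sphere_mean (\<lambda>y. f (reflect (axis j 1) y)) = sphere_mean f"
    using f continuous_on_subset by (blast intro: sphere_mean_orthogonal orthogonal_reflect)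
  moreover have "sphere_mean (\<lambda>y. f (reflect (axis j 1) y)) = sphere_mean (\<lambda>y. (-1) * f y)"
    by (simp add: flip)
  ultimately show ?thesis unfolding sphere_mean_cmult by simp
qed

lemma reflect_axis_nth:
  "reflect (axis j 1) (y::real^'n::finite) $ i = (if i = j then - y $ i else y $ i)"
  by (auto simp: reflect_def inner_axis axis_nth)

lemma coeff_one_plus_square_power:
  "coeff ([:1, 0, 1:] ^ p :: real poly) 0 = 1 \<and> coeff ([:1, 0, 1:] ^ p :: real poly) 2 = real p"
proof (induction p)
  case (Suc p)
  have "[:1, 0, 1:] * q = q + pCons 0 (pCons 0 q)" for q :: "real poly"
    by simp
  then show ?case using Suc by (simp add: numeral_2_eq_2)
qed (simp add: numeral_2_eq_2)

text \<open>
  By rotation invariance the mean of \<open>(x \<bullet> y)\<^sup>2\<^sup>p\<^sup>+\<^sup>2\<close> over \<open>y\<close> is a multiple of \<open>(norm x)\<^sup>2\<^sup>p\<^sup>+\<^sup>2\<close>. For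
  \<open>x = e\<^sub>i + v e\<^sub>j\<close> both sides are polynomials in \<open>v\<close>, and the coefficients of \<open>v\<^sup>2\<close> express the mixed moment of
  \<open>y\<^sub>i\<^sup>2\<^sup>p y\<^sub>j\<^sup>2\<close> by the pure one. Summation over \<open>j \<noteq> i\<close> and \<open>\<Sum>\<^sub>j y\<^sub>j\<^sup>2 = 1\<close> give the recurrence.
\<close>

lemma moment_recurrence:
  fixes i :: "'n::finite"
  shows "(2 * real p + CARD('n)) * sphere_mean (\<lambda>y::real^'n. (y $ i) ^ (2 * p + 2))
       = (2 * real p + 1) * sphere_mean (\<lambda>y. (y $ i) ^ (2 * p))"
proof -
  let ?M = "\<lambda>m. sphere_mean (\<lambda>y::real^'n. (y $ i) ^ m)"
  have mixed: "(2 * real p + 1) * sphere_mean (\<lambda>y::real^'n. (y $ i) ^ (2 * p) * (y $ j) ^ 2) = ?M (2 * p + 2)"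
    if "j \<noteq> i" for j
  proof -
    define m where "m = 2 * p + 2"
    define c where "c q = sphere_mean (\<lambda>y::real^'n. (y $ i) ^ (m - q) * (y $ j) ^ q)" for q
    define P where "P = (\<Sum>q\<le>m. monom (real (m choose q) * c q) q)"
    have "poly P v = poly (smult (?M m) ([:1, 0, 1:] ^ (p + 1))) v" for v
    proof -
      let ?x = "axis i 1 + v *\<^sub>R axis j 1 :: real^'n"
      have x: "?x \<bullet> y = y $ i + v * y $ j" for y
        by (simp add: inner_add_left inner_axis')
      have "?x \<bullet> ?x = 1 + v\<^sup>2"
        using that by (simp add: x axis_nth power2_eq_square)
      moreover have "norm ?x ^ m = (?x \<bullet> ?x) ^ (p + 1)"
        unfolding m_def power2_norm_eq_inner[symmetric] power_mult[symmetric] by simp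
      ultimately have nx: "norm ?x ^ m = (1 + v\<^sup>2) ^ (p + 1)" by simp
      have "sphere_mean (\<lambda>y. (?x \<bullet> y) ^ m) = sphere_mean (\<lambda>y::real^'n. (norm ?x * y $ i) ^ m)"
        by (rule sphere_mean_inner) (intro continuous_intros)
      also have "\<dots> = (1 + v\<^sup>2) ^ (p + 1) * ?M m"
        by (simp add: power_mult_distrib nx)
      also have "sphere_mean (\<lambda>y. (?x \<bullet> y) ^ m)
          = sphere_mean (\<lambda>y::real^'n. \<Sum>q\<le>m. real (m choose q) * v ^ q * ((y $ i) ^ (m - q) * (y $ j) ^ q))"
        unfolding x
        by (subst add.commute) (simp add: binomial_ring power_mult_distrib mult_ac)
      also have "\<dots> = (\<Sum>q\<le>m. real (m choose q) * v ^ q * c q)"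
        unfolding c_def by (subst sphere_mean_sum) (auto intro!: continuous_intros)
      also have "\<dots> = poly P v"
        by (simp add: P_def poly_sum poly_monom mult_ac)
      finally show ?thesis by (simp add: power2_eq_square algebra_simps)
    qed
    then have "P = smult (?M m) ([:1, 0, 1:] ^ (p + 1))"
      by (simp add: poly_eq_poly_eq_iff[symmetric] fun_eq_iff)
    then have "coeff P 2 = ?M m * (real p + 1)"
      using coeff_one_plus_square_power[of "p + 1"] by simp
    moreover have "coeff P 2 = real (m choose 2) * c 2"
      unfolding P_def coeff_sum coeff_monom by (subst sum.delta) (auto simp: m_def)
    moreover have "real (m choose 2) = (real p + 1) * (2 * real p + 1)"
    proof -
      have "m choose 2 = (p + 1) * (2 * p + 1)"
        by (simp add: choose_two m_def)
      then have "real (m choose 2) = real ((p + 1) * (2 * p + 1))" by (simp only:)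
      then show ?thesis by (simp add: algebra_simps)
    qed
    ultimately have "(real p + 1) * ((2 * real p + 1) * c 2) = (real p + 1) * ?M m"
      by simp
    then have "(2 * real p + 1) * c 2 = ?M m" by (subst (asm) mult_left_cancel) auto
    then show ?thesis by (simp add: c_def m_def)
  qed
  have split: "(\<Sum>j\<in>UNIV - {i}. (y $ i) ^ (2 * p) * (y $ j) ^ 2) = (y $ i) ^ (2 * p) - (y $ i) ^ (2 * p + 2)"
    if "norm y = 1" for y :: "real^'n"
  proof -
    have "(\<Sum>j\<in>UNIV. (y $ j)\<^sup>2) = 1"
      using that by (simp add: norm_vec_def L2_set_def)
    then have "(\<Sum>j\<in>UNIV - {i}. (y $ j)\<^sup>2) = 1 - (y $ i)\<^sup>2"
      by (simp add: sum.remove[of UNIV i])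
    then show ?thesis
      unfolding sum_distrib_left[symmetric] by (simp only: right_diff_distrib power_add mult_1_right)
  qed
  have "(2 * real p + 1) * (?M (2 * p) - ?M (2 * p + 2))
      = (2 * real p + 1) * sphere_mean (\<lambda>y::real^'n. \<Sum>j\<in>UNIV - {i}. (y $ i) ^ (2 * p) * (y $ j) ^ 2)"
    by (subst sphere_mean_diff[symmetric]) (auto intro!: continuous_intros sphere_mean_cong simp: split)
  also have "\<dots> = (\<Sum>j\<in>UNIV - {i}. (2 * real p + 1) * sphere_mean (\<lambda>y::real^'n. (y $ i) ^ (2 * p) * (y $ j) ^ 2))"
    by (subst sphere_mean_sum) (auto intro!: continuous_intros simp: sum_distrib_left)
  also have "\<dots> = (\<Sum>j\<in>UNIV - {i}. ?M (2 * p + 2))"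
    by (rule sum.cong[OF refl], rule mixed) simp
  also have "\<dots> = (real CARD('n) - 1) * ?M (2 * p + 2)"
    by (simp add: card_Diff_singleton of_nat_diff Suc_leI)
  finally show ?thesis by (simp add: algebra_simps)
qed

lemma moment_even:
  fixes i :: "'n::finite"
  shows "sphere_mean (\<lambda>y::real^'n. (y $ i) ^ (2 * p)) / fact (2 * p)
      = Gamma (real CARD('n) / 2) * (rGamma (real p + real CARD('n) / 2) / (fact p * 4 ^ p))"
proof (induction p)
  case 0
  have "Gamma (real CARD('n) / 2) > 0"
    by (rule Gamma_real_pos) simp
  then have "Gamma (real CARD('n) / 2) \<noteq> 0" by linarith
  then show ?case by (simp add: rGamma_inverse_Gamma)
next
  case (Suc p)
  let ?n = "real CARD('n)"
  have n: "?n > 0" by simp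
  have rec: "sphere_mean (\<lambda>y::real^'n. (y $ i) ^ (2 * p + 2))
      = (2 * real p + 1) / (2 * real p + ?n) * sphere_mean (\<lambda>y::real^'n. (y $ i) ^ (2 * p))"
  proof -
    have "2 * real p + ?n \<noteq> 0" using n by linarith
    from eq_divide_imp[OF this] moment_recurrence[of p i] show ?thesis
      by (simp only: mult.commute times_divide_eq_right)
  qed
  have rG: "rGamma (real p + ?n / 2) = (real p + ?n / 2) * rGamma (real (Suc p) + ?n / 2)"
    using rGamma_plus1[of "real p + ?n / 2"] by (simp add: add_ac)
  have f: "fact (2 * Suc p) = (2 * real p + 2) * (2 * real p + 1) * (fact (2 * p) :: real)"
    by (simp add: algebra_simps)
  have "sphere_mean (\<lambda>y::real^'n. (y $ i) ^ (2 * Suc p)) / fact (2 * Suc p)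
      = (2 * real p + 1) / ((2 * real p + ?n) * ((2 * real p + 2) * (2 * real p + 1)))
          * (sphere_mean (\<lambda>y::real^'n. (y $ i) ^ (2 * p)) / fact (2 * p))"
    using rec unfolding f by simp
  also have "(2 * real p + 1) / ((2 * real p + ?n) * ((2 * real p + 2) * (2 * real p + 1)))
      = 1 / ((real p + ?n / 2) * ((real p + 1) * 4))"
    using n by (simp add: divide_simps) (simp add: algebra_simps)
  also have "\<dots> * (sphere_mean (\<lambda>y::real^'n. (y $ i) ^ (2 * p)) / fact (2 * p))
      = Gamma (?n / 2) * (rGamma (real (Suc p) + ?n / 2) / (fact (Suc p) * 4 ^ Suc p))"
  proof -
    have "1 / (d * (e * 4)) * (G * (d * R / (F * P))) = G * (R / (e * F * (4 * P)))"
      if "d \<noteq> 0" for d e G R F P :: real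
      using that by simp
    moreover have "real p + ?n / 2 \<noteq> 0" using n by linarith
    ultimately show ?thesis
      unfolding Suc.IH rG by (simp add: add_ac)
  qed
  finally show ?case .
qed

lemma moment_odd:
  fixes i :: "'n::finite"
  assumes "odd m"
  shows "sphere_mean (\<lambda>y::real^'n. (y $ i) ^ m) = 0"
  by (rule sphere_mean_flip[where j = i]) (auto intro!: continuous_intros simp: reflect_axis_nth assms)

section \<open>The series of the modified Bessel functions\<close>

text \<open>
  The entire function with \<open>I\<^sub>\<alpha>(x) = (x / 2)\<^sup>\<alpha> bessel_series \<alpha> (x\<^sup>2 / 4)\<close>. In this normalization
  differentiation raises the order by one.
\<close>

definition bessel_series :: "real \<Rightarrow> real \<Rightarrow> real" where
  "bessel_series \<alpha> q = (\<Sum>m. rGamma (real m + \<alpha> + 1) / fact m * q ^ m)"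

lemma rGamma_pos: "0 < x \<Longrightarrow> 0 < rGamma (x::real)"
  by (simp add: rGamma_inverse_Gamma Gamma_real_pos)

lemma rGamma_shift_le:
  assumes "\<alpha> \<ge> 0"
  shows "rGamma (real m + \<alpha> + 1) \<le> rGamma (\<alpha> + 1)"
proof (induction m)
  case (Suc m)
  have pos: "0 \<le> rGamma (real m + \<alpha> + 1 + 1)"
    using assms by (intro less_imp_le rGamma_pos) simp
  have "rGamma (real m + \<alpha> + 1 + 1) \<le> (real m + \<alpha> + 1) * rGamma (real m + \<alpha> + 1 + 1)"
    using mult_right_mono[OF _ pos, of 1 "real m + \<alpha> + 1"] assms by simp
  also have "\<dots> = rGamma (real m + \<alpha> + 1)" by (rule rGamma_plus1)
  finally show ?case using Suc by (simp add: add_ac)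
qed simp

lemma summable_bessel_series:
  assumes "\<alpha> \<ge> 0"
  shows "summable (\<lambda>m. rGamma (real m + \<alpha> + 1) / fact m * q ^ m)"
proof (rule summable_comparison_test)
  show "summable (\<lambda>m. rGamma (\<alpha> + 1) * (\<bar>q\<bar> ^ m /\<^sub>R fact m))"
    by (intro summable_mult summable_exp_generic)
  have "rGamma (real m + \<alpha> + 1) \<ge> 0" for m
    using assms by (intro less_imp_le rGamma_pos) simp
  then show "\<exists>N. \<forall>n\<ge>N. norm (rGamma (real n + \<alpha> + 1) / fact n * q ^ n)
      \<le> rGamma (\<alpha> + 1) * (\<bar>q\<bar> ^ n /\<^sub>R fact n)"
    using rGamma_shift_le[OF assms]
    by (intro exI[of _ 0]) (auto simp: abs_mult power_abs divide_simps intro!: mult_right_mono)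
qed

lemma bessel_series_deriv:
  assumes "\<alpha> \<ge> 0"
  shows "(bessel_series \<alpha> has_real_derivative bessel_series (\<alpha> + 1) q) (at q)"
proof -
  let ?c = "\<lambda>m. rGamma (real m + \<alpha> + 1) / fact m"
  have "((\<lambda>x. \<Sum>n. ?c n * x ^ n) has_real_derivative (\<Sum>n. diffs ?c n * q ^ n)) (at q)"
    by (rule termdiffs_strong_converges_everywhere) (rule summable_bessel_series[OF assms])
  moreover have "diffs ?c n = rGamma (real n + (\<alpha> + 1) + 1) / fact n" for n
    by (simp add: diffs_def add_ac)
  ultimately show ?thesis
    unfolding bessel_series_def by simp
qed

text \<open>
  This is \<open>I\<^sub>\<alpha> - I\<^sub>\<alpha>\<^sub>+\<^sub>2 = (2 (\<alpha> + 1) / x) I\<^sub>\<alpha>\<^sub>+\<^sub>1\<close>; for each power of \<open>q\<close> it reduces to the functional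
  equation of the Gamma function.
\<close>

lemma bessel_series_recurrence:
  assumes "\<alpha> \<ge> 0"
  shows "bessel_series \<alpha> q = (\<alpha> + 1) * bessel_series (\<alpha> + 1) q + q * bessel_series (\<alpha> + 2) q"
proof -
  let ?a = "\<lambda>\<alpha> m. rGamma (real m + \<alpha> + 1) / fact m * q ^ m"
  have S: "?a \<alpha> sums bessel_series \<alpha> q" if "\<alpha> \<ge> 0" for \<alpha>
    unfolding bessel_series_def using summable_bessel_series[OF that] by (rule summable_sums)
  have "(\<lambda>m. q * ?a (\<alpha> + 2) m) sums (q * bessel_series (\<alpha> + 2) q)"
    using assms by (intro sums_mult S) simp
  moreover have "q * ?a (\<alpha> + 2) m = real (Suc m) * ?a (\<alpha> + 1) (Suc m)" for m
    by (simp add: add_ac field_simps del: of_nat_Suc) (simp add: field_simps)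
  ultimately have "(\<lambda>m. real (Suc m) * ?a (\<alpha> + 1) (Suc m)) sums (q * bessel_series (\<alpha> + 2) q)"
    by (simp only:)
  then have "(\<lambda>m. real m * ?a (\<alpha> + 1) m) sums (q * bessel_series (\<alpha> + 2) q)"
    using sums_Suc_iff[of "\<lambda>m. real m * ?a (\<alpha> + 1) m"] by simp
  moreover have "(\<lambda>m. (\<alpha> + 1) * ?a (\<alpha> + 1) m) sums ((\<alpha> + 1) * bessel_series (\<alpha> + 1) q)"
    using assms by (intro sums_mult S) simp
  ultimately have "(\<lambda>m. (\<alpha> + 1) * ?a (\<alpha> + 1) m + real m * ?a (\<alpha> + 1) m)
      sums ((\<alpha> + 1) * bessel_series (\<alpha> + 1) q + q * bessel_series (\<alpha> + 2) q)"
    by (intro sums_add)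
  moreover have "(\<alpha> + 1) * ?a (\<alpha> + 1) m + real m * ?a (\<alpha> + 1) m = ?a \<alpha> m" for m
  proof -
    have "rGamma (real m + \<alpha> + 1) = (real m + \<alpha> + 1) * rGamma (real m + (\<alpha> + 1) + 1)"
      using rGamma_plus1[of "real m + \<alpha> + 1"] by (simp add: add_ac)
    then show ?thesis by (simp only:) (simp add: algebra_simps add_divide_distrib)
  qed
  ultimately show ?thesis using S[OF assms] sums_unique2 by force
qed

lemma bessel_series_pos:
  assumes "\<alpha> \<ge> 0" "q > 0"
  shows "bessel_series \<alpha> q > 0"
  unfolding bessel_series_def
  by (rule suminf_pos[OF summable_bessel_series[OF assms(1)]])
     (use assms in \<open>auto intro!: mult_pos_pos divide_pos_pos rGamma_pos\<close>)

text \<open>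
  Let \<open>a\<^sub>m\<close> be the terms of the series on the right. The terms on the left are at most the
  geometric means of \<open>a\<^sub>m\<close> and \<open>a\<^sub>m\<^sub>+\<^sub>1\<close>, hence at most their arithmetic means, whose sum misses half
  of \<open>a\<^sub>0\<close>. In terms of Bessel functions this is \<open>I\<^sub>\<alpha>\<^sub>+\<^sub>1(2 x) < I\<^sub>\<alpha>(2 x)\<close>, which makes every eigenvalue
  of the zonal problem simple.
\<close>

lemma bessel_series_decreasing:
  assumes "\<alpha> \<ge> 0" "x > 0"
  shows "x * bessel_series (\<alpha> + 1) (x\<^sup>2) < bessel_series \<alpha> (x\<^sup>2)"
proof -
  define a where "a m = rGamma (real m + \<alpha> + 1) / fact m * (x\<^sup>2) ^ m" for m
  define b where "b m = x * (rGamma (real m + (\<alpha> + 1) + 1) / fact m * (x\<^sup>2) ^ m)" for m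
  have a: "a sums bessel_series \<alpha> (x\<^sup>2)"
    unfolding bessel_series_def a_def using summable_bessel_series[OF assms(1)] by (rule summable_sums)
  have b: "b sums (x * bessel_series (\<alpha> + 1) (x\<^sup>2))"
    unfolding bessel_series_def b_def
    using summable_bessel_series[of "\<alpha> + 1"] assms(1) by (intro sums_mult summable_sums) simp
  have a1: "(\<lambda>m. a (Suc m)) sums (bessel_series \<alpha> (x\<^sup>2) - a 0)"
    using a by (simp add: sums_Suc_iff)
  have le: "b m \<le> (a m + a (Suc m)) / 2" for m
  proof -
    define r where "r = rGamma (real m + \<alpha> + 2) / fact m * (x\<^sup>2) ^ m"
    define p where "p = real m + 1"
    have p: "p > 0" "p + \<alpha> \<ge> p" using assms by (auto simp: p_def)
    have r: "r > 0" unfolding r_def using assms by (auto intro!: mult_pos_pos divide_pos_pos rGamma_pos)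
    have "rGamma (real m + \<alpha> + 1) = (p + \<alpha>) * rGamma (real m + \<alpha> + 2)"
      using rGamma_plus1[of "real m + \<alpha> + 1"] by (simp add: p_def add_ac)
    then have am: "a m = r * (p + \<alpha>)" by (simp add: a_def r_def)
    have am1: "a (Suc m) = r * (x\<^sup>2 / p)"
      by (simp add: a_def r_def p_def add_ac mult_ac)
    have bm: "b m = r * x" by (simp add: b_def r_def add_ac)
    have "x \<le> (p + x\<^sup>2 / p) / 2"
    proof -
      have "0 \<le> (p - x)\<^sup>2" by simp
      then have "2 * x * p \<le> p\<^sup>2 + x\<^sup>2" by (simp add: power2_diff mult_ac)
      then show ?thesis using p by (simp add: field_simps power2_eq_square)
    qed
    also have "\<dots> \<le> (p + \<alpha> + x\<^sup>2 / p) / 2" using p by simp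
    finally have "r * x \<le> r * ((p + \<alpha> + x\<^sup>2 / p) / 2)" using r by simp
    then show ?thesis unfolding am am1 bm by (simp add: algebra_simps)
  qed
  have "(\<lambda>m. (a m + a (Suc m)) / 2) sums ((bessel_series \<alpha> (x\<^sup>2) + (bessel_series \<alpha> (x\<^sup>2) - a 0)) / 2)"
    by (intro sums_divide sums_add a a1)
  from sums_le[OF le b this] have "x * bessel_series (\<alpha> + 1) (x\<^sup>2) \<le> bessel_series \<alpha> (x\<^sup>2) - a 0 / 2"
    by simp
  moreover have "a 0 > 0" using assms by (simp add: a_def rGamma_pos)
  ultimately show ?thesis by simp
qed

lemma bessel_I_eq:
  assumes "x > 0" "\<alpha> \<ge> 0"
  shows "bessel_I \<alpha> x = (x / 2) powr \<alpha> * bessel_series \<alpha> (x\<^sup>2 / 4)"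
proof -
  have "rGamma (real m + \<alpha> + 1) / fact m * (x / 2) powr (2 * real m + \<alpha>)
      = (x / 2) powr \<alpha> * (rGamma (real m + \<alpha> + 1) / fact m * (x\<^sup>2 / 4) ^ m)" for m
  proof -
    have "(x / 2) powr (2 * real m) = ((x / 2)\<^sup>2) ^ m"
      using assms by (metis divide_pos_pos of_nat_mult of_nat_numeral power_mult powr_realpow zero_less_numeral)
    then show ?thesis using assms by (simp add: powr_add power_divide)
  qed
  then show ?thesis
    unfolding bessel_I_def bessel_series_def
    by (simp only:) (rule suminf_mult[OF summable_bessel_series[OF assms(2)]])
qed

section \<open>The Funk--Hecke formula for the exponential kernel\<close>

lemma exp_taylor_bound:
  assumes "\<bar>x\<bar> \<le> (r::real)"
  shows "\<bar>exp x - (\<Sum>m<N. x ^ m / fact m)\<bar> \<le> exp r * r ^ N / fact N"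
proof -
  obtain t where t: "\<bar>t\<bar> \<le> \<bar>x\<bar>" "exp x = (\<Sum>m<N. x ^ m / fact m) + exp t / fact N * x ^ N"
    using Maclaurin_exp_le by blast
  have "\<bar>exp t / fact N * x ^ N\<bar> = exp t / fact N * \<bar>x\<bar> ^ N"
    by (simp add: abs_mult power_abs)
  also have "\<dots> \<le> exp r / fact N * r ^ N"
    using t(1) assms by (intro mult_mono divide_right_mono power_mono) auto
  finally show ?thesis using t(2) by simp
qed

lemma exp_taylor_bound_tendsto_0: "(\<lambda>N. exp r * r ^ N / fact N) \<longlonglongrightarrow> (0::real)"
proof -
  have "(\<lambda>N. r ^ N /\<^sub>R fact N) \<longlonglongrightarrow> 0"
    by (rule summable_LIMSEQ_zero[OF summable_exp_generic])
  from tendsto_mult_left[OF this, of "exp r"] show ?thesis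
    by (simp add: field_simps)
qed

lemma sphere_mean_exp_inner:
  fixes x :: "real^'n::finite"
  assumes "CARD('n) \<ge> 2"
  shows "sphere_mean (\<lambda>y. exp (x \<bullet> y)) =
    Gamma (real CARD('n) / 2) * bessel_series (real CARD('n) / 2 - 1) ((norm x)\<^sup>2 / 4)"
proof -
  obtain i :: 'n where True by blast
  define r where "r = norm x"
  let ?M = "\<lambda>m. sphere_mean (\<lambda>y::real^'n. (y $ i) ^ m)"
  let ?E = "sphere_mean (\<lambda>y::real^'n. exp (r * y $ i))"
  let ?n = "real CARD('n)"
  have bound: "\<bar>?E - (\<Sum>m<N. r ^ m / fact m * ?M m)\<bar> \<le> exp r * r ^ N / fact N" for N
  proof -
    have "(\<Sum>m<N. r ^ m / fact m * ?M m)
        = sphere_mean (\<lambda>y::real^'n. \<Sum>m<N. r ^ m / fact m * (y $ i) ^ m)"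
      by (subst sphere_mean_sum) (auto intro!: continuous_intros)
    then have "?E - (\<Sum>m<N. r ^ m / fact m * ?M m)
        = sphere_mean (\<lambda>y::real^'n. exp (r * y $ i) - (\<Sum>m<N. r ^ m / fact m * (y $ i) ^ m))"
      by (subst sphere_mean_diff) (auto intro!: continuous_intros)
    also have "\<bar>\<dots>\<bar> \<le> exp r * r ^ N / fact N"
    proof (rule sphere_mean_abs_le)
      fix y :: "real^'n" assume y: "norm y = 1"
      have "\<bar>r * y $ i\<bar> \<le> r" using abs_coord_le_1[OF y] by (simp add: r_def abs_mult mult_left_le)
      from exp_taylor_bound[OF this, of N]
      show "\<bar>exp (r * y $ i) - (\<Sum>m<N. r ^ m / fact m * (y $ i) ^ m)\<bar> \<le> exp r * r ^ N / fact N"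
        by (simp add: power_mult_distrib)
    qed (auto intro!: continuous_intros)
    finally show ?thesis .
  qed
  have "(\<lambda>N. ?E - (\<Sum>m<N. r ^ m / fact m * ?M m)) \<longlonglongrightarrow> 0"
    by (rule Lim_null_comparison[OF _ exp_taylor_bound_tendsto_0[of r]])
       (intro always_eventually allI, use bound in \<open>simp only: real_norm_def\<close>)
  then have "(\<lambda>m. r ^ m / fact m * ?M m) sums ?E"
    unfolding sums_def using tendsto_diff[OF tendsto_const[of ?E]] by fastforce
  moreover have "odd m" if "m \<notin> range (\<lambda>p. 2 * p)" for m :: nat
    using that by (auto elim!: evenE)
  ultimately have "(\<lambda>p. r ^ (2 * p) / fact (2 * p) * ?M (2 * p)) sums ?E"
    by (subst sums_mono_reindex[of "\<lambda>p. 2 * p"]) (auto simp: strict_mono_def moment_odd)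
  moreover have "r ^ (2 * p) / fact (2 * p) * ?M (2 * p)
      = Gamma (?n / 2) * (rGamma (real p + (?n / 2 - 1) + 1) / fact p * (r\<^sup>2 / 4) ^ p)" for p
  proof -
    have "r ^ (2 * p) / fact (2 * p) * ?M (2 * p) = r ^ (2 * p) * (?M (2 * p) / fact (2 * p))" by simp
    then show ?thesis unfolding moment_even by (simp add: power_mult power_divide)
  qed
  moreover have "(\<lambda>p. Gamma (?n / 2) * (rGamma (real p + (?n / 2 - 1) + 1) / fact p * (r\<^sup>2 / 4) ^ p))
      sums (Gamma (?n / 2) * bessel_series (?n / 2 - 1) (r\<^sup>2 / 4))"
    unfolding bessel_series_def
    by (intro sums_mult summable_sums summable_bessel_series) (use assms in simp)
  ultimately have "?E = Gamma (?n / 2) * bessel_series (?n / 2 - 1) (r\<^sup>2 / 4)"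
    using sums_unique2 by simp
  moreover have "sphere_mean (\<lambda>y. exp (x \<bullet> y)) = ?E"
    unfolding r_def by (rule sphere_mean_inner) (intro continuous_intros)
  ultimately show ?thesis by (simp add: r_def)
qed

text \<open>
  The Taylor remainder of second order of the exponential is uniform on the sphere, so the
  derivative may be taken under the integral.
\<close>

lemma sphere_mean_exp_deriv:
  fixes a b H :: "real^'n::finite \<Rightarrow> real"
  assumes a: "continuous_on UNIV a" and b: "continuous_on UNIV b" and H: "continuous_on UNIV H"
    and a1: "\<And>y. norm y = 1 \<Longrightarrow> \<bar>a y\<bar> \<le> 1"
  shows "((\<lambda>s. sphere_mean (\<lambda>y. exp (s * a y + b y) * H y)) has_real_derivative
     sphere_mean (\<lambda>y. a y * (exp (s * a y + b y) * H y))) (at s)"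
proof -
  define w where "w y = exp (s * a y + b y) * H y" for y
  have w: "continuous_on UNIV w" unfolding w_def by (intro continuous_intros a b H)
  have "bounded (w ` sphere 0 1)"
    by (rule compact_imp_bounded[OF compact_continuous_image[OF _ compact_sphere]])
       (use w continuous_on_subset in blast)
  then obtain B where B: "\<And>y. norm y = 1 \<Longrightarrow> \<bar>w y\<bar> \<le> B"
    unfolding bounded_iff by (metis imageI mem_sphere_0 real_norm_def)
  have cs: "continuous_on (sphere 0 1) f" if "continuous_on UNIV f" for f :: "real^'n \<Rightarrow> real"
    using that continuous_on_subset by blast
  let ?D = "sphere_mean (\<lambda>y. a y * w y)"
  let ?F = "\<lambda>s. sphere_mean (\<lambda>y. exp (s * a y + b y) * H y)"
  have bound: "\<bar>(?F (s + h) - ?F s) / h - ?D\<bar> \<le> exp 1 * B * \<bar>h\<bar>" if h: "h \<noteq> 0" "\<bar>h\<bar> \<le> 1" for h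
  proof -
    have "?F (s + h) - ?F s - h * ?D = sphere_mean (\<lambda>y. (exp (h * a y) - 1 - h * a y) * w y)"
    proof -
      have "exp ((s + h) * a y + b y) * H y - exp (s * a y + b y) * H y - h * (a y * w y)
          = (exp (h * a y) - 1 - h * a y) * w y" for y
      proof -
        have "(s + h) * a y + b y = h * a y + (s * a y + b y)" by (simp add: algebra_simps)
        then have "exp ((s + h) * a y + b y) = exp (h * a y) * exp (s * a y + b y)"
          by (simp only: exp_add)
        then show ?thesis by (simp add: w_def algebra_simps)
      qed
      then have "sphere_mean (\<lambda>y. (exp (h * a y) - 1 - h * a y) * w y)
          = sphere_mean (\<lambda>y. exp ((s + h) * a y + b y) * H y - exp (s * a y + b y) * H y - h * (a y * w y))"
        by simp
      also have "\<dots> = ?F (s + h) - ?F s - sphere_mean (\<lambda>y. h * (a y * w y))"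
      proof -
        have c1: "continuous_on (sphere 0 1) (\<lambda>y. exp (s * a y + b y) * H y)" for s
          by (intro cs continuous_intros a b H)
        have c2: "continuous_on (sphere 0 1) (\<lambda>y. h * (a y * w y))"
          by (intro cs continuous_intros a w)
        show ?thesis
          using sphere_mean_diff[OF continuous_on_diff[OF c1[of "s + h"] c1[of s]] c2]
            sphere_mean_diff[OF c1[of "s + h"] c1[of s]] by simp
      qed
      finally show ?thesis by simp
    qed
    moreover have "\<bar>sphere_mean (\<lambda>y. (exp (h * a y) - 1 - h * a y) * w y)\<bar> \<le> exp 1 * h\<^sup>2 * B"
    proof (rule sphere_mean_abs_le)
      show "continuous_on (sphere 0 1) (\<lambda>y. (exp (h * a y) - 1 - h * a y) * w y)"
        by (intro cs continuous_intros a w)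
      fix y :: "real^'n" assume y: "norm y = 1"
      have hy: "\<bar>h * a y\<bar> \<le> \<bar>h\<bar>" using a1[OF y] by (simp add: abs_mult mult_left_le)
      have "\<bar>exp (h * a y) - 1 - h * a y\<bar> \<le> exp \<bar>h\<bar> * \<bar>h\<bar>\<^sup>2 / 2"
        using exp_taylor_bound[OF hy, of 2] by (simp add: numeral_2_eq_2 diff_diff_eq)
      also have "\<dots> \<le> exp 1 * h\<^sup>2"
      proof -
        have "exp \<bar>h\<bar> * h\<^sup>2 \<le> exp 1 * h\<^sup>2" using h(2) by (intro mult_right_mono) auto
        moreover have "0 \<le> exp 1 * h\<^sup>2" by simp
        ultimately show ?thesis unfolding power2_abs by linarith
      qed
      finally show "\<bar>(exp (h * a y) - 1 - h * a y) * w y\<bar> \<le> exp 1 * h\<^sup>2 * B"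
        unfolding abs_mult using B[OF y] by (intro mult_mono) auto
    qed
    ultimately have *: "\<bar>?F (s + h) - ?F s - h * ?D\<bar> \<le> exp 1 * h\<^sup>2 * B" by simp
    have "(?F (s + h) - ?F s) / h - ?D = (?F (s + h) - ?F s - h * ?D) / h"
      using h by (simp add: field_simps)
    then have "\<bar>(?F (s + h) - ?F s) / h - ?D\<bar> = \<bar>?F (s + h) - ?F s - h * ?D\<bar> / \<bar>h\<bar>" by simp
    also have "\<dots> \<le> exp 1 * h\<^sup>2 * B / \<bar>h\<bar>" by (rule divide_right_mono[OF *]) simp
    also have "\<dots> = exp 1 * B * \<bar>h\<bar>"
      using h by (simp add: field_simps power2_eq_square abs_mult_self_eq flip: power2_eq_square)
    finally show ?thesis .
  qed
  have "((\<lambda>h. (?F (s + h) - ?F s) / h - ?D) \<longlongrightarrow> 0) (at 0)"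
  proof (rule Lim_null_comparison)
    show "((\<lambda>h. exp 1 * B * \<bar>h\<bar>) \<longlongrightarrow> 0) (at 0)"
      by (rule tendsto_eq_intros refl)+ simp
    have "\<forall>\<^sub>F h in at (0::real). h \<noteq> 0 \<and> \<bar>h\<bar> \<le> 1"
      unfolding eventually_at by (rule exI[of _ 1]) (auto simp: dist_real_def)
    then show "\<forall>\<^sub>F h in at 0. norm ((?F (s + h) - ?F s) / h - ?D) \<le> exp 1 * B * \<bar>h\<bar>"
      by eventually_elim (use bound in auto)
  qed
  then show ?thesis unfolding DERIV_def w_def by (simp add: LIM_zero_iff)
qed

text \<open>
  The solid zonal harmonic \<open>\<bar>x\<bar>\<^sup>m C\<^sub>m(s / \<bar>x\<bar>)\<close> as a polynomial in the axial coordinate \<open>s\<close> and the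
  square \<open>w\<close> of the distance from the axis, so that \<open>\<bar>x\<bar>\<^sup>2 = s\<^sup>2 + w\<close>.
\<close>

fun solid_gegenbauer :: "nat \<Rightarrow> real \<Rightarrow> real \<Rightarrow> real \<Rightarrow> real" where
  "solid_gegenbauer 0 l s w = 1"
| "solid_gegenbauer (Suc 0) l s w = 2 * l * s"
| "solid_gegenbauer (Suc (Suc m)) l s w =
     (2 * (real m + 1 + l) * s * solid_gegenbauer (Suc m) l s w
       - (real m + 2 * l) * (s\<^sup>2 + w) * solid_gegenbauer m l s w) / (real m + 2)"

lemma solid_gegenbauer_scale:
  "solid_gegenbauer m l (r * s) (r\<^sup>2 * w) = r ^ m * solid_gegenbauer m l s w"
proof (induction m l s w rule: solid_gegenbauer.induct)
  case (3 m l s w)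
  have "(r * s)\<^sup>2 + r\<^sup>2 * w = r\<^sup>2 * (s\<^sup>2 + w)" by (simp add: power_mult_distrib algebra_simps)
  then show ?case using 3 by (simp add: field_simps power2_eq_square)
qed auto

lemma solid_gegenbauer_sphere: "solid_gegenbauer m l c (1 - c\<^sup>2) = gegenbauer m l c"
  by (induction m l c rule: gegenbauer.induct) auto

text \<open>
  Lowering of the degree by the axial derivative. The factor \<open>m + 2 l\<close> is the one in front of the
  last term of the three-term recurrence, which is what closes the induction in
  \<open>sphere_mean_exp_gegenbauer\<close>.
\<close>

lemma solid_gegenbauer_deriv:
  "((\<lambda>s. solid_gegenbauer (Suc m) l s w) has_real_derivative
     (real m + 2 * l) * solid_gegenbauer m l s w) (at s)"
proof (induction m rule: less_induct)
  case (less m)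
  let ?h = "\<lambda>m s. solid_gegenbauer m l s w"
  consider "m = 0" | "m = 1" | k where "m = Suc (Suc k)" by (metis One_nat_def not0_implies_Suc)
  then show ?case
  proof cases
    case 1
    then show ?thesis by (auto intro!: derivative_eq_intros)
  next
    case 2
    then show ?thesis
      by (auto intro!: derivative_eq_intros simp: numeral_2_eq_2) (simp add: field_simps)
  next
    case (3 k)
    have d2: "(?h (Suc (Suc k)) has_real_derivative (real (Suc k) + 2 * l) * ?h (Suc k) s) (at s)"
      using less[of "Suc k"] 3 by simp
    have d1: "(?h (Suc k) has_real_derivative (real k + 2 * l) * ?h k s) (at s)"
      using less[of k] 3 by simp
    define X where "X = (s\<^sup>2 + w) * ?h k s"
    have rec: "(real k + 2 * l) * X = 2 * (real k + 1 + l) * s * ?h (Suc k) s - (real k + 2) * ?h (Suc (Suc k)) s"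
      by (simp add: X_def)
    have "((\<lambda>s. A * s * ?h (Suc (Suc k)) s - B * (s\<^sup>2 + w) * ?h (Suc k) s) has_real_derivative
        A * (?h (Suc (Suc k)) s + s * ((real (Suc k) + 2 * l) * ?h (Suc k) s))
         - B * (2 * s * ?h (Suc k) s + (real k + 2 * l) * X)) (at s)" for A B
    proof -
      have "((\<lambda>s. A * s) has_real_derivative A) (at s)"
        "((\<lambda>s. B * (s\<^sup>2 + w)) has_real_derivative B * (2 * s)) (at s)"
        by (auto intro!: derivative_eq_intros)
      from DERIV_diff[OF DERIV_mult[OF this(1) d2] DERIV_mult[OF this(2) d1]]
      show ?thesis by (rule DERIV_cong) (simp add: X_def algebra_simps del: solid_gegenbauer.simps)
    qed
    from DERIV_cdivide[OF this]
    have "((\<lambda>s. (2 * (real (Suc k) + 1 + l) * s * ?h (Suc (Suc k)) s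
       - (real (Suc k) + 2 * l) * (s\<^sup>2 + w) * ?h (Suc k) s) / (real (Suc k) + 2)) has_real_derivative
       (2 * (real (Suc k) + 1 + l) * (?h (Suc (Suc k)) s + s * ((real (Suc k) + 2 * l) * ?h (Suc k) s))
         - (real (Suc k) + 2 * l) * (2 * s * ?h (Suc k) s + (real k + 2 * l) * X))
        / (real (Suc k) + 2)) (at s)" .
    moreover have "(2 * (real (Suc k) + 1 + l) * (?h (Suc (Suc k)) s + s * ((real (Suc k) + 2 * l) * ?h (Suc k) s))
         - (real (Suc k) + 2 * l) * (2 * s * ?h (Suc k) s + (real k + 2 * l) * X))
        / (real (Suc k) + 2) = (real m + 2 * l) * ?h m s"
      unfolding rec 3 by (simp add: field_simps del: solid_gegenbauer.simps)
    ultimately show ?thesis unfolding 3 by (subst solid_gegenbauer.simps(3)) simp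
  qed
qed

lemma continuous_on_gegenbauer [continuous_intros]: "continuous_on S (gegenbauer m l)"
  by (induction m l "0::real" rule: gegenbauer.induct) (auto intro!: continuous_intros)

text \<open>
  On the sphere, multiplication of the integrand by \<open>y\<^sub>i\<close> is differentiation of the integral with
  respect to \<open>s\<close>, and the square of the norm is \<open>1\<close>. The three-term recurrence for \<open>C\<^sub>m\<close> therefore
  determines the integrals recursively from the radial one for \<open>m = 0\<close>. The right-hand sides
  satisfy the same recursion: this uses the derivatives of the solid harmonics and of the Bessel
  series, the recurrence of the Bessel series, and the recurrence of the solid harmonics, in which
  \<open>4 q = s\<^sup>2 + v\<^sup>2\<close> appears as coefficient.
\<close>

lemma sphere_mean_exp_gegenbauer:
  fixes i j :: "'n::finite"
  assumes ij: "i \<noteq> j" and n: "CARD('n) \<ge> 2"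
  defines "l \<equiv> (real CARD('n) - 2) / 2"
  shows "sphere_mean (\<lambda>y::real^'n. exp (s * y $ i + v * y $ j) * gegenbauer m l (y $ i)) =
    Gamma (real CARD('n) / 2) / 2 ^ m * solid_gegenbauer m l s (v\<^sup>2)
      * bessel_series (real m + l) ((s\<^sup>2 + v\<^sup>2) / 4)"
proof (induction m arbitrary: s rule: less_induct)
  case (less m)
  define E where "E s = (\<lambda>y::real^'n. exp (s * y $ i + v * y $ j))" for s
  define G where "G m s = sphere_mean (\<lambda>y::real^'n. E s y * gegenbauer m l (y $ i))" for m s
  define \<Gamma> where "\<Gamma> = Gamma (real CARD('n) / 2)"
  define q where "q s = (s\<^sup>2 + v\<^sup>2) / 4" for s
  define R where "R m s = \<Gamma> / 2 ^ m * solid_gegenbauer m l s (v\<^sup>2) * bessel_series (real m + l) (q s)" for m s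
  have l: "l \<ge> 0" using n by (simp add: l_def)
  have contE [continuous_intros]: "continuous_on S (E s)" for S s
    unfolding E_def by (intro continuous_intros)
  have contg [continuous_intros]: "continuous_on S (\<lambda>y::real^'n. gegenbauer m l (y $ i))" for S m
    by (rule continuous_on_coord) (rule continuous_on_gegenbauer)
  have dG: "(G m has_real_derivative sphere_mean (\<lambda>y. y $ i * (E s y * gegenbauer m l (y $ i)))) (at s)" for m s
    unfolding G_def E_def
    by (rule sphere_mean_exp_deriv[where a = "\<lambda>y. y $ i" and b = "\<lambda>y. v * y $ j"])
       (auto intro!: continuous_intros abs_coord_le_1)
  have dpsi: "((\<lambda>s. bessel_series \<alpha> (q s)) has_real_derivative bessel_series (\<alpha> + 1) (q s) * (s / 2)) (at s)"
    if "\<alpha> \<ge> 0" for \<alpha> s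
    by (rule DERIV_chain2[OF bessel_series_deriv[OF that]])
       (auto simp: q_def intro!: derivative_eq_intros)
  have G0: "G 0 s = R 0 s" for s
  proof -
    let ?x = "s *\<^sub>R axis i 1 + v *\<^sub>R axis j 1 :: real^'n"
    have x: "?x \<bullet> y = s * y $ i + v * y $ j" for y
      by (simp add: inner_add_left inner_axis')
    have nx: "(norm ?x)\<^sup>2 = s\<^sup>2 + v\<^sup>2"
      using ij by (simp add: power2_norm_eq_inner x axis_nth) (simp add: power2_eq_square)
    have "G 0 s = sphere_mean (\<lambda>y. exp (?x \<bullet> y))" by (simp add: G_def E_def x)
    also have "\<dots> = R 0 s"
      unfolding sphere_mean_exp_inner[OF n] nx R_def \<Gamma>_def q_def l_def
      by (simp add: diff_divide_distrib)
    finally show ?thesis .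
  qed
  consider "m = 0" | "m = 1" | k where "m = Suc (Suc k)" by (metis One_nat_def not0_implies_Suc)
  then have "G m s = R m s"
  proof cases
    case 1
    then show ?thesis using G0 by simp
  next
    case 2
    have "(G 0 has_real_derivative \<Gamma> * (bessel_series (l + 1) (q s) * (s / 2))) (at s)"
      using DERIV_cmult[OF dpsi[OF l], of \<Gamma>] by (simp add: G0[abs_def] R_def)
    from DERIV_unique[OF dG[of 0] this]
    have "sphere_mean (\<lambda>y. y $ i * E s y) = \<Gamma> * (bessel_series (l + 1) (q s) * (s / 2))"
      by simp
    moreover have "G 1 s = sphere_mean (\<lambda>y. 2 * l * (y $ i * E s y))"
      unfolding G_def by (simp add: mult_ac)
    ultimately show ?thesis unfolding 2 R_def by (simp add: add.commute mult.commute)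
  next
    case (3 k)
    have IH: "G j s = R j s" if "j < m" for j s
      using less[OF that, of s] by (simp add: G_def E_def R_def \<Gamma>_def q_def)
    define h where "h j = solid_gegenbauer j l s (v\<^sup>2)" for j
    define f where "f \<alpha> = bessel_series \<alpha> (q s)" for \<alpha>
    define c where "c = \<Gamma> / 2 ^ k"
    have "(R (Suc k) has_real_derivative
        c / 2 * ((real k + 2 * l) * h k * f (real k + 1 + l) + h (Suc k) * (f (real k + 2 + l) * (s / 2)))) (at s)"
    proof -
      have "((\<lambda>s. solid_gegenbauer (Suc k) l s (v\<^sup>2) * bessel_series (real k + 1 + l) (q s)) has_real_derivative
        (real k + 2 * l) * h k * f (real k + 1 + l)
          + (f (real k + 1 + l + 1) * (s / 2)) * h (Suc k)) (at s)"
        unfolding h_def f_def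
        by (rule DERIV_mult[OF solid_gegenbauer_deriv dpsi]) (use l in simp)
      from DERIV_cmult[OF this, of "c / 2"] show ?thesis
        unfolding R_def c_def by (simp add: mult_ac add_ac)
    qed
    moreover have "G (Suc k) = R (Suc k)" using IH 3 by auto
    ultimately have D: "sphere_mean (\<lambda>y. y $ i * (E s y * gegenbauer (Suc k) l (y $ i)))
        = c / 2 * ((real k + 2 * l) * h k * f (real k + 1 + l) + h (Suc k) * (f (real k + 2 + l) * (s / 2)))"
      using dG[of "Suc k" s] DERIV_unique by metis
    have "(real k + 2) * G m s = sphere_mean (\<lambda>y. 2 * (real k + 1 + l) * (y $ i * (E s y * gegenbauer (Suc k) l (y $ i)))
        - (real k + 2 * l) * (E s y * gegenbauer k l (y $ i)))"
      unfolding G_def 3 sphere_mean_cmult[symmetric]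
      by (rule sphere_mean_cong) (simp add: field_simps)
    also have "\<dots> = 2 * (real k + 1 + l) * sphere_mean (\<lambda>y. y $ i * (E s y * gegenbauer (Suc k) l (y $ i)))
        - (real k + 2 * l) * G k s"
      unfolding G_def by (subst sphere_mean_diff) (auto intro!: continuous_intros simp del: gegenbauer.simps)
    also have "G k s = c * h k * f (real k + l)"
      using IH[of k s] 3 by (simp add: R_def c_def h_def f_def)
    finally have main: "(real k + 2) * G m s = 2 * (real k + 1 + l) *
        (c / 2 * ((real k + 2 * l) * h k * f (real k + 1 + l) + h (Suc k) * (f (real k + 2 + l) * (s / 2))))
        - (real k + 2 * l) * (c * h k * f (real k + l))"
      unfolding D .
    have rec: "f (real k + l) = (real k + l + 1) * f (real k + 1 + l) + q s * f (real k + 2 + l)"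
      unfolding f_def using bessel_series_recurrence[of "real k + l" "q s"] l by (simp add: add_ac)
    have "(real k + 2) * G m s = c / 4 * (2 * (real k + 1 + l) * s * h (Suc k)
        - (real k + 2 * l) * (4 * q s) * h k) * f (real k + 2 + l)"
      unfolding main rec by (simp add: field_simps)
    also have "4 * q s = s\<^sup>2 + v\<^sup>2" by (simp add: q_def)
    also have "2 * (real k + 1 + l) * s * h (Suc k) - (real k + 2 * l) * (s\<^sup>2 + v\<^sup>2) * h k
        = (real k + 2) * h m"
      unfolding h_def 3 by simp
    finally have "(real k + 2) * G m s = (real k + 2) * (c / 4 * h m * f (real k + 2 + l))"
      by simp
    then have "G m s = c / 4 * h m * f (real k + 2 + l)"
      by (subst (asm) mult_left_cancel) auto
    then show ?thesis by (simp add: R_def c_def h_def f_def 3 add_ac)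
  qed
  then show ?case by (simp add: G_def E_def R_def \<Gamma>_def q_def)
qed

section \<open>Zonal convolution\<close>

text \<open>
  For a zonal function \<open>y \<mapsto> g (y $ i)\<close> the convolution with a kernel \<open>\<phi> (x \<bullet> y)\<close> is again zonal. It is
  evaluated here at one point of the parallel of height \<open>c\<close>, the point in the plane of the
  directions \<open>i\<close> and \<open>j\<close>.
\<close>

definition zonal_conv :: "'n::finite \<Rightarrow> 'n \<Rightarrow> (real \<Rightarrow> real) \<Rightarrow> (real \<Rightarrow> real) \<Rightarrow> real \<Rightarrow> real" where
  "zonal_conv i j \<phi> g c =
     sphere_mean (\<lambda>y::real^'n. \<phi> (c * y $ i + sqrt (1 - c\<^sup>2) * y $ j) * g (y $ i))"

definition parallel_point :: "'n::finite \<Rightarrow> 'n \<Rightarrow> real \<Rightarrow> real^'n" where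
  "parallel_point i j c = c *\<^sub>R axis i 1 + sqrt (1 - c\<^sup>2) *\<^sub>R axis j 1"

lemma inner_parallel_point: "parallel_point i j c \<bullet> y = c * y $ i + sqrt (1 - c\<^sup>2) * y $ j"
  by (simp add: parallel_point_def inner_add_left inner_axis')

lemma parallel_point_nth: "i \<noteq> j \<Longrightarrow> parallel_point i j c $ i = c"
  by (simp add: parallel_point_def axis_nth)

lemma square_le_1: "\<bar>c\<bar> \<le> 1 \<Longrightarrow> (c::real)\<^sup>2 \<le> 1"
  using abs_square_le_1 by blast

lemma norm_parallel_point:
  assumes "i \<noteq> j" "\<bar>c\<bar> \<le> 1"
  shows "norm (parallel_point i j c) = 1"
proof -
  have "parallel_point i j c \<bullet> parallel_point i j c = c * c + sqrt (1 - c\<^sup>2) * sqrt (1 - c\<^sup>2)"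
    using assms(1) by (simp only: inner_parallel_point) (simp add: parallel_point_def axis_nth)
  also have "\<dots> = 1" using square_le_1[OF assms(2)] by (simp add: power2_eq_square)
  finally show ?thesis by (simp add: norm_eq_1)
qed

lemma zonal_conv_eq:
  fixes x :: "real^'n::finite"
  assumes ij: "i \<noteq> j" and x: "norm x = 1"
    and "continuous_on UNIV \<phi>" "continuous_on UNIV g"
  shows "sphere_mean (\<lambda>y. \<phi> (x \<bullet> y) * g (y $ i)) = zonal_conv i j \<phi> g (x $ i)"
proof -
  have "sphere_mean (\<lambda>y. \<phi> (x \<bullet> y) * g (y $ i))
      = sphere_mean (\<lambda>y. \<phi> (parallel_point i j (x $ i) \<bullet> y) * g (y $ i))"
    by (rule sphere_mean_zonal_transport[OF _ _ assms(3,4)])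
       (use ij x abs_coord_le_1[OF x] in \<open>simp_all add: norm_parallel_point parallel_point_nth\<close>)
  then show ?thesis by (simp add: zonal_conv_def inner_parallel_point)
qed

lemma sphere_mean_continuous:
  fixes F :: "real \<Rightarrow> real^'n::finite \<Rightarrow> real"
  assumes F: "continuous_on UNIV (\<lambda>p. F (fst p) (snd p))"
  shows "continuous_on UNIV (\<lambda>c. sphere_mean (F c))"
proof -
  have Fc: "continuous_on S (F c)" for c S
  proof -
    have "continuous_on S (\<lambda>y. (\<lambda>p. F (fst p) (snd p)) (c, y))"
      by (rule continuous_on_compose2[OF F]) (auto intro!: continuous_intros)
    then show ?thesis by simp
  qed
  have "isCont (\<lambda>c. sphere_mean (F c)) c" for c
    unfolding continuous_at_eps_delta
  proof (intro allI impI)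
    fix e :: real assume e: "e > 0"
    let ?K = "{c - 1..c + 1} \<times> sphere (0::real^'n) 1"
    have "uniformly_continuous_on ?K (\<lambda>p. F (fst p) (snd p))"
      by (intro compact_uniformly_continuous continuous_on_subset[OF F] compact_Times) auto
    then obtain d where d: "d > 0" "\<And>p p'. p \<in> ?K \<Longrightarrow> p' \<in> ?K \<Longrightarrow> dist p' p < d \<Longrightarrow>
        dist (F (fst p') (snd p')) (F (fst p) (snd p)) < e / 2"
      unfolding uniformly_continuous_on_def using e by (meson half_gt_zero)
    show "\<exists>d>0. \<forall>c'. dist c' c < d \<longrightarrow> dist (sphere_mean (F c')) (sphere_mean (F c)) < e"
    proof (intro exI[of _ "min d 1"] conjI allI impI)
      fix c' assume c': "dist c' c < min d 1"
      have "\<bar>sphere_mean (\<lambda>y. F c' y - F c y)\<bar> \<le> e / 2"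
      proof (rule sphere_mean_abs_le)
        fix y :: "real^'n" assume y: "norm y = 1"
        have "dist (F (fst (c', y)) (snd (c', y))) (F (fst (c, y)) (snd (c, y))) < e / 2"
          by (rule d(2)) (use c' y in \<open>auto simp: dist_Pair_Pair dist_real_def abs_if split: if_splits\<close>)
        then show "\<bar>F c' y - F c y\<bar> \<le> e / 2" by (simp add: dist_real_def)
      qed (intro continuous_intros Fc)
      then have "\<bar>sphere_mean (F c') - sphere_mean (F c)\<bar> \<le> e / 2"
        by (subst (asm) sphere_mean_diff) (intro Fc)+
      then show "dist (sphere_mean (F c')) (sphere_mean (F c)) < e"
        using e by (simp add: dist_real_def)
    qed (use d in auto)
  qed
  then show ?thesis by (simp add: continuous_on_eq_continuous_at)
qed

lemma zonal_conv_continuous: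
  assumes \<phi>: "continuous_on UNIV \<phi>" and g: "continuous_on UNIV g"
  shows "continuous_on UNIV (zonal_conv i j \<phi> g)"
  unfolding zonal_conv_def[abs_def]
  by (rule sphere_mean_continuous)
     (intro continuous_intros continuous_on_compose2[OF \<phi>] continuous_on_compose2[OF g]; simp)

lemma abs_inner_parallel_le_1:
  assumes "i \<noteq> j" "\<bar>c\<bar> \<le> 1" "norm (y::real^'n::finite) = 1"
  shows "\<bar>c * y $ i + sqrt (1 - c\<^sup>2) * y $ j\<bar> \<le> 1"
  using Cauchy_Schwarz_ineq2[of "parallel_point i j c" y] assms
  by (simp add: norm_parallel_point inner_parallel_point)

lemma bounded_on_interval:
  fixes f :: "real \<Rightarrow> real"
  assumes "continuous_on UNIV f"
  obtains B where "B \<ge> 0" "\<And>x. \<bar>x\<bar> \<le> 1 \<Longrightarrow> \<bar>f x\<bar> \<le> B"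
proof -
  have "bounded (f ` {-1..1})"
    by (rule compact_imp_bounded[OF compact_continuous_image])
       (use assms continuous_on_subset in blast)+
  then obtain B where "\<forall>x\<in>{-1..1}. \<bar>f x\<bar> \<le> B"
    unfolding bounded_iff by auto
  then show ?thesis by (intro that[of "max B 0"]) (auto simp: abs_le_iff le_max_iff_disj)
qed

text \<open>
  The kernel \<open>\<phi> (x \<bullet> y)\<close> is symmetric, so this is Fubini's theorem on the product of two spheres.
\<close>

lemma zonal_conv_selfadjoint:
  fixes i j :: "'n::finite"
  assumes ij: "i \<noteq> j" and \<phi>: "continuous_on UNIV \<phi>"
    and f: "continuous_on UNIV f" and g: "continuous_on UNIV g"
  shows "sphere_mean (\<lambda>x::real^'n. zonal_conv i j \<phi> f (x $ i) * g (x $ i))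
       = sphere_mean (\<lambda>x::real^'n. f (x $ i) * zonal_conv i j \<phi> g (x $ i))"
proof -
  let ?S = "surface_measure :: (real^'n) measure"
  define w where "w = sphere_area TYPE('n)"
  define k where "k x y = f (x $ i) * \<phi> (x \<bullet> y) * g (y $ i)" for x y :: "real^'n"
  interpret pair_sigma_finite ?S ?S ..
  interpret P: finite_measure "?S \<Otimes>\<^sub>M ?S"
    by (rule finite_measure_pair_measure) (rule finite_surface_measure)+
  have id: "(\<lambda>x. x) \<in> ?S \<rightarrow>\<^sub>M borel"
    unfolding measurable_cong_sets[OF sets_surface_measure refl]
    by (rule measurable_restrict_space1) simp
  have fst: "fst \<in> ?S \<Otimes>\<^sub>M ?S \<rightarrow>\<^sub>M borel" and snd: "snd \<in> ?S \<Otimes>\<^sub>M ?S \<rightarrow>\<^sub>M borel"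
    using measurable_compose[OF measurable_fst id] measurable_compose[OF measurable_snd id] by auto
  have bm: "\<phi> \<in> borel_measurable borel" "f \<in> borel_measurable borel" "g \<in> borel_measurable borel"
    by (rule borel_measurable_continuous_onI[OF \<phi>] borel_measurable_continuous_onI[OF f]
        borel_measurable_continuous_onI[OF g])+
  have coord: "(\<lambda>x::real^'n. x $ i) \<in> borel_measurable borel"
    by (intro borel_measurable_continuous_onI continuous_intros)
  have meas: "(\<lambda>(x, y). k x y) \<in> borel_measurable (?S \<Otimes>\<^sub>M ?S)"
  proof -
    have "(\<lambda>p. f (fst p $ i) * \<phi> (fst p \<bullet> snd p) * g (snd p $ i)) \<in> borel_measurable (?S \<Otimes>\<^sub>M ?S)"
      by (intro borel_measurable_times measurable_compose[OF _ bm(1)]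
          measurable_compose[OF measurable_compose[OF _ coord] bm(2)]
          measurable_compose[OF measurable_compose[OF _ coord] bm(3)] borel_measurable_inner fst snd)
    then show ?thesis by (simp add: k_def case_prod_beta)
  qed
  obtain Bf where Bf: "Bf \<ge> 0" "\<And>x. \<bar>x\<bar> \<le> 1 \<Longrightarrow> \<bar>f x\<bar> \<le> Bf" using bounded_on_interval[OF f] by blast
  obtain Bg where Bg: "Bg \<ge> 0" "\<And>x. \<bar>x\<bar> \<le> 1 \<Longrightarrow> \<bar>g x\<bar> \<le> Bg" using bounded_on_interval[OF g] by blast
  obtain Bp where Bp: "Bp \<ge> 0" "\<And>x. \<bar>x\<bar> \<le> 1 \<Longrightarrow> \<bar>\<phi> x\<bar> \<le> Bp" using bounded_on_interval[OF \<phi>] by blast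
  have bound: "\<bar>k x y\<bar> \<le> Bf * Bp * Bg" if "norm x = 1" "norm y = 1" for x y
    unfolding k_def abs_mult using that Cauchy_Schwarz_ineq2[of x y] Bf(1) Bp(1)
    by (intro mult_mono mult_nonneg_nonneg Bf(2) Bp(2) Bg(2) abs_coord_le_1) auto
  have "integrable (?S \<Otimes>\<^sub>M ?S) (\<lambda>(x, y). k x y)"
    by (rule P.integrable_const_bound[OF _ meas, of "Bf * Bp * Bg"])
       (auto simp: space_pair_measure intro!: bound)
  then have Fub: "(\<integral>y. (\<integral>x. k x y \<partial>?S) \<partial>?S) = (\<integral>x. (\<integral>y. k x y \<partial>?S) \<partial>?S)"
    by (rule Fubini_integral)
  have inner: "(\<integral>y. k x y \<partial>?S) / w = f (x $ i) * zonal_conv i j \<phi> g (x $ i)" if "norm x = 1" for x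
    using zonal_conv_eq[OF ij that \<phi> g]
    by (simp add: k_def w_def sphere_mean_def mult.assoc flip: times_divide_eq_right)
  have inner': "(\<integral>x. k x y \<partial>?S) / w = zonal_conv i j \<phi> f (y $ i) * g (y $ i)" if "norm y = 1" for y
  proof -
    have "k x y = g (y $ i) * (\<phi> (y \<bullet> x) * f (x $ i))" for x by (simp add: k_def inner_commute mult_ac)
    then show ?thesis
      using zonal_conv_eq[OF ij that \<phi> f] by (simp add: w_def sphere_mean_def mult.commute flip: times_divide_eq_right)
  qed
  have "sphere_mean (\<lambda>x::real^'n. zonal_conv i j \<phi> f (x $ i) * g (x $ i))
      = sphere_mean (\<lambda>y. (\<integral>x. k x y \<partial>?S) / w)"
    by (rule sphere_mean_cong) (simp add: inner')
  also have "\<dots> = sphere_mean (\<lambda>x. (\<integral>y. k x y \<partial>?S) / w)"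
    unfolding sphere_mean_divide by (simp add: sphere_mean_def Fub)
  also have "\<dots> = sphere_mean (\<lambda>x::real^'n. f (x $ i) * zonal_conv i j \<phi> g (x $ i))"
    by (rule sphere_mean_cong) (simp add: inner)
  finally show ?thesis .
qed

section \<open>Zonal eigenfunctions\<close>

text \<open>
  The eigenvalue of convolution with \<open>exp (\<beta> (x \<bullet> y))\<close>, with respect to the normalized measure on
  the sphere in \<open>n\<close> dimensions, on the harmonics of degree \<open>m\<close>. Up to a factor that does not depend on
  \<open>m\<close> it is \<open>I\<^sub>m\<^sub>+\<^sub>(\<^sub>n\<^sub>-\<^sub>2\<^sub>)\<^sub>/\<^sub>2(\<beta>)\<close>.
\<close>

definition funk_hecke :: "nat \<Rightarrow> real \<Rightarrow> nat \<Rightarrow> real" where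
  "funk_hecke n \<beta> m = Gamma (real n / 2) * (\<beta> / 2) ^ m * bessel_series (real m + (real n - 2) / 2) ((\<beta> / 2)\<^sup>2)"

lemma zonal_conv_gegenbauer:
  fixes i j :: "'n::finite"
  assumes "i \<noteq> j" and n: "CARD('n) \<ge> 2" and c: "\<bar>c\<bar> \<le> 1"
  shows "zonal_conv i j (\<lambda>x. exp (\<beta> * x)) (gegenbauer m ((real CARD('n) - 2) / 2)) c
    = funk_hecke CARD('n) \<beta> m * gegenbauer m ((real CARD('n) - 2) / 2) c"
proof -
  let ?l = "(real CARD('n) - 2) / 2"
  have v: "(\<beta> * sqrt (1 - c\<^sup>2))\<^sup>2 = \<beta>\<^sup>2 * (1 - c\<^sup>2)"
    using square_le_1[OF c] by (simp add: power_mult_distrib)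
  have q: "((\<beta> * c)\<^sup>2 + \<beta>\<^sup>2 * (1 - c\<^sup>2)) / 4 = (\<beta> / 2)\<^sup>2"
    by (simp add: power_mult_distrib power_divide algebra_simps)
  have "zonal_conv i j (\<lambda>x. exp (\<beta> * x)) (gegenbauer m ?l) c
      = sphere_mean (\<lambda>y::real^'n. exp ((\<beta> * c) * y $ i + (\<beta> * sqrt (1 - c\<^sup>2)) * y $ j) * gegenbauer m ?l (y $ i))"
    by (simp add: zonal_conv_def algebra_simps)
  also have "\<dots> = Gamma (real CARD('n) / 2) / 2 ^ m * (\<beta> ^ m * gegenbauer m ?l c)
      * bessel_series (real m + ?l) ((\<beta> / 2)\<^sup>2)"
    unfolding sphere_mean_exp_gegenbauer[OF assms(1,2)] v q
      solid_gegenbauer_scale solid_gegenbauer_sphere ..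
  finally show ?thesis by (simp add: funk_hecke_def power_divide)
qed

lemma funk_hecke_pos:
  assumes "n \<ge> 2" "\<beta> > 0"
  shows "funk_hecke n \<beta> m > 0"
  unfolding funk_hecke_def using assms
  by (intro mult_pos_pos bessel_series_pos Gamma_real_pos) auto

lemma funk_hecke_strict_antimono:
  assumes "n \<ge> 2" "\<beta> > 0" "m < m'"
  shows "funk_hecke n \<beta> m' < funk_hecke n \<beta> m"
  using assms(3)
proof (induction m' rule: less_Suc_induct)
  case (1 m)
  have "\<beta> / 2 * bessel_series (real m + (real n - 2) / 2 + 1) ((\<beta> / 2)\<^sup>2)
      < bessel_series (real m + (real n - 2) / 2) ((\<beta> / 2)\<^sup>2)"
    by (rule bessel_series_decreasing) (use assms in auto)
  moreover have "Gamma (real n / 2) * (\<beta> / 2) ^ m > 0"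
    using assms by (intro mult_pos_pos Gamma_real_pos) auto
  ultimately have "Gamma (real n / 2) * (\<beta> / 2) ^ m * (\<beta> / 2 * bessel_series (real m + (real n - 2) / 2 + 1) ((\<beta> / 2)\<^sup>2))
      < Gamma (real n / 2) * (\<beta> / 2) ^ m * bessel_series (real m + (real n - 2) / 2) ((\<beta> / 2)\<^sup>2)"
    by (rule mult_strict_left_mono)
  then show ?case by (simp add: funk_hecke_def add_ac mult_ac)
qed auto

lemma funk_hecke_inj:
  assumes "n \<ge> 2" "\<beta> > 0" "m \<noteq> m'"
  shows "funk_hecke n \<beta> m \<noteq> funk_hecke n \<beta> m'"
  using funk_hecke_strict_antimono[OF assms(1,2), of m m']
    funk_hecke_strict_antimono[OF assms(1,2), of m' m] assms(3) by linarith

text \<open>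
  Eigenfunctions of a self-adjoint operator for distinct eigenvalues are orthogonal. Any positive
  parameter of the exponential kernel would do for this; \<open>1\<close> is chosen.
\<close>

lemma gegenbauer_orthogonal:
  fixes i :: "'n::finite"
  assumes n: "CARD('n) \<ge> 2" and "m \<noteq> m'"
  defines "l \<equiv> (real CARD('n) - 2) / 2"
  shows "sphere_mean (\<lambda>x::real^'n. gegenbauer m l (x $ i) * gegenbauer m' l (x $ i)) = 0"
proof -
  obtain j where ij: "i \<noteq> j"
    using n by (metis UNIV_I card_2_iff' card_le_Suc0_iff_eq finite not_less_eq_eq numeral_2_eq_2)
  let ?I = "sphere_mean (\<lambda>x::real^'n. gegenbauer m l (x $ i) * gegenbauer m' l (x $ i))"
  let ?\<phi> = "\<lambda>x::real. exp (1 * x)"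
  have eig: "zonal_conv i j ?\<phi> (gegenbauer m l) (x $ i) = funk_hecke CARD('n) 1 m * gegenbauer m l (x $ i)"
    if "norm x = 1" for m and x :: "real^'n"
    unfolding l_def by (rule zonal_conv_gegenbauer[OF ij n abs_coord_le_1[OF that]])
  have "sphere_mean (\<lambda>x::real^'n. zonal_conv i j ?\<phi> (gegenbauer m l) (x $ i) * gegenbauer m' l (x $ i))
      = sphere_mean (\<lambda>x::real^'n. gegenbauer m l (x $ i) * zonal_conv i j ?\<phi> (gegenbauer m' l) (x $ i))"
    by (rule zonal_conv_selfadjoint[OF ij]) (intro continuous_intros)+
  moreover have "sphere_mean (\<lambda>x::real^'n. zonal_conv i j ?\<phi> (gegenbauer m l) (x $ i) * gegenbauer m' l (x $ i))
      = funk_hecke CARD('n) 1 m * ?I"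
    unfolding sphere_mean_cmult[symmetric] by (rule sphere_mean_cong, subst eig, assumption) simp
  moreover have "sphere_mean (\<lambda>x::real^'n. gegenbauer m l (x $ i) * zonal_conv i j ?\<phi> (gegenbauer m' l) (x $ i))
      = funk_hecke CARD('n) 1 m' * ?I"
    unfolding sphere_mean_cmult[symmetric] by (rule sphere_mean_cong, subst eig, assumption) simp
  ultimately have "funk_hecke CARD('n) 1 m * ?I = funk_hecke CARD('n) 1 m' * ?I" by simp
  then show ?thesis using funk_hecke_inj[OF n _ \<open>m \<noteq> m'\<close>, of 1] by simp
qed

lemma gegenbauer_at_1_Suc:
  "(real m + 1) * gegenbauer (Suc m) l 1 = (real m + 2 * l) * gegenbauer m l 1"
proof (induction m)
  case (Suc m)
  have "(real m + 2) * gegenbauer (Suc (Suc m)) l 1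
      = 2 * (real m + 1 + l) * gegenbauer (Suc m) l 1 - (real m + 2 * l) * gegenbauer m l 1"
    by simp
  then show ?case using Suc by (simp add: algebra_simps del: gegenbauer.simps)
qed simp

lemma gegenbauer_at_1_pos:
  assumes "l > 0" shows "gegenbauer m l 1 > 0"
proof (induction m)
  case (Suc m)
  have "gegenbauer (Suc m) l 1 = (real m + 2 * l) * gegenbauer m l 1 / (real m + 1)"
    using gegenbauer_at_1_Suc[of m l] by (simp only: nonzero_eq_divide_eq) (simp add: mult.commute)
  then show ?case using Suc assms by (simp only:) (intro divide_pos_pos mult_pos_pos; simp)
qed simp

lemma gegenbauer_norm_pos:
  fixes i :: "'n::finite"
  assumes "l > 0"
  shows "sphere_mean (\<lambda>x::real^'n. (gegenbauer m l (x $ i))\<^sup>2) > 0"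
proof (rule ccontr)
  let ?f = "\<lambda>x::real^'n. (gegenbauer m l (x $ i))\<^sup>2"
  have cont: "continuous_on S ?f" for S
    by (intro continuous_intros continuous_on_coord)
  assume "\<not> sphere_mean ?f > 0"
  moreover have "sphere_mean (\<lambda>x::real^'n. 0) \<le> sphere_mean ?f"
    by (rule sphere_mean_mono) (auto intro: cont)
  ultimately have "sphere_mean ?f = 0" by simp
  from sphere_mean_eq_0_imp[OF cont _ this, of "axis i 1"] show False
    using gegenbauer_at_1_pos[OF assms, of m] by (simp add: norm_axis_1 axis_nth)
qed

lemma gegenbauer_recurrence:
  assumes "l > 0"
  shows "x * gegenbauer (Suc m) l x = ((real m + 2) * gegenbauer (Suc (Suc m)) l x
      + (real m + 2 * l) * gegenbauer m l x) / (2 * (real m + 1 + l))"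
proof -
  have "(real m + 2) * gegenbauer (Suc (Suc m)) l x
      = 2 * (real m + 1 + l) * x * gegenbauer (Suc m) l x - (real m + 2 * l) * gegenbauer m l x"
    by simp
  moreover have "2 * (real m + 1 + l) \<noteq> 0" using assms of_nat_0_le_iff[of m] by simp
  ultimately show ?thesis
    by (intro eq_divide_imp) (simp_all add: algebra_simps del: gegenbauer.simps)
qed

text \<open>
  The recurrence writes \<open>x C\<^sub>m\<close> as a combination of \<open>C\<^sub>m\<^sub>+\<^sub>1\<close> and \<open>C\<^sub>m\<^sub>-\<^sub>1\<close>. By induction on \<open>p\<close>, therefore, \<open>h\<close> is
  orthogonal to \<open>x\<^sup>p C\<^sub>m\<close> as long as \<open>p + m < N\<close>.
\<close>

lemma orthogonal_to_powers:
  fixes i :: "'n::finite"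
  assumes l: "l > 0" and h: "continuous_on UNIV h"
    and orth: "\<And>m. m < N \<Longrightarrow> sphere_mean (\<lambda>x::real^'n. h (x $ i) * gegenbauer m l (x $ i)) = 0"
  shows "m < N \<Longrightarrow> sphere_mean (\<lambda>x::real^'n. h (x $ i) * (x $ i) ^ m) = 0"
proof -
  have c: "continuous_on S (\<lambda>x::real^'n. h (x $ i) * (x $ i) ^ p * gegenbauer m l (x $ i))" for S p m
    by (intro continuous_intros continuous_on_coord h)
  have main: "p + m < N \<Longrightarrow> sphere_mean (\<lambda>x::real^'n. h (x $ i) * (x $ i) ^ p * gegenbauer m l (x $ i)) = 0" for p m
  proof (induction p arbitrary: m)
    case 0
    then show ?case using orth by simp
  next
    case (Suc p)
    show ?case
    proof (cases m)
      case 0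
      have "sphere_mean (\<lambda>x::real^'n. h (x $ i) * (x $ i) ^ p * gegenbauer 1 l (x $ i)) = 0"
        using Suc.prems 0 by (intro Suc.IH) simp
      moreover have "(\<lambda>x::real^'n. h (x $ i) * (x $ i) ^ p * gegenbauer 1 l (x $ i))
          = (\<lambda>x. (2 * l) * (h (x $ i) * (x $ i) ^ Suc p * gegenbauer m l (x $ i)))"
        using 0 by (auto simp: algebra_simps)
      ultimately show ?thesis using l by (simp only: sphere_mean_cmult) simp
    next
      case (Suc m')
      let ?a = "(real m' + 2) / (2 * (real m' + 1 + l))" and ?b = "(real m' + 2 * l) / (2 * (real m' + 1 + l))"
      have eq: "h (x $ i) * (x $ i) ^ Suc p * gegenbauer m l (x $ i)
          = ?a * (h (x $ i) * (x $ i) ^ p * gegenbauer (Suc (Suc m')) l (x $ i))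
            + ?b * (h (x $ i) * (x $ i) ^ p * gegenbauer m' l (x $ i))" for x :: "real^'n"
      proof -
        have "h (x $ i) * (x $ i) ^ Suc p * gegenbauer m l (x $ i)
            = h (x $ i) * (x $ i) ^ p * (x $ i * gegenbauer (Suc m') l (x $ i))" by (simp add: Suc mult_ac)
        then show ?thesis unfolding gegenbauer_recurrence[OF l]
          by (simp add: algebra_simps add_divide_distrib del: gegenbauer.simps)
      qed
      have "sphere_mean (\<lambda>x::real^'n. h (x $ i) * (x $ i) ^ Suc p * gegenbauer m l (x $ i))
          = sphere_mean (\<lambda>x::real^'n. ?a * (h (x $ i) * (x $ i) ^ p * gegenbauer (Suc (Suc m')) l (x $ i))
            + ?b * (h (x $ i) * (x $ i) ^ p * gegenbauer m' l (x $ i)))"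
        by (rule sphere_mean_cong) (rule eq)
      also have "\<dots> = ?a * sphere_mean (\<lambda>x::real^'n. h (x $ i) * (x $ i) ^ p * gegenbauer (Suc (Suc m')) l (x $ i))
            + ?b * sphere_mean (\<lambda>x::real^'n. h (x $ i) * (x $ i) ^ p * gegenbauer m' l (x $ i))"
        unfolding sphere_mean_cmult[symmetric]
        by (rule sphere_mean_add; rule continuous_on_mult_left; rule c)
      finally show ?thesis
        using Suc.IH[of "Suc (Suc m')"] Suc.IH[of m'] Suc.prems Suc by (simp del: gegenbauer.simps)
    qed
  qed
  show "m < N \<Longrightarrow> sphere_mean (\<lambda>x::real^'n. h (x $ i) * (x $ i) ^ m) = 0"
    using main[of m 0] by simp
qed

lemma orthogonal_to_poly:
  fixes i :: "'n::finite"
  assumes l: "l > 0" and h: "continuous_on UNIV h"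
    and orth: "\<And>m. m < N \<Longrightarrow> sphere_mean (\<lambda>x::real^'n. h (x $ i) * gegenbauer m l (x $ i)) = 0"
    and p: "degree p < N" and b: "\<And>c. \<bar>c\<bar> \<le> 1 \<Longrightarrow> b c = poly p c"
  shows "sphere_mean (\<lambda>x::real^'n. h (x $ i) * b (x $ i)) = 0"
proof -
  have "sphere_mean (\<lambda>x::real^'n. h (x $ i) * b (x $ i))
      = sphere_mean (\<lambda>x::real^'n. \<Sum>m\<le>degree p. coeff p m * (h (x $ i) * (x $ i) ^ m))"
    by (rule sphere_mean_cong)
       (simp add: b abs_coord_le_1 poly_altdef sum_distrib_left mult_ac)
  also have "\<dots> = (\<Sum>m\<le>degree p. coeff p m * sphere_mean (\<lambda>x::real^'n. h (x $ i) * (x $ i) ^ m))"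
    by (subst sphere_mean_sum) (auto intro!: continuous_intros continuous_on_coord h)
  also have "\<dots> = 0"
    using orthogonal_to_powers[OF l h orth] p by (intro sum.neutral) auto
  finally show ?thesis .
qed

text \<open>
  At height \<open>c\<close> the binomial expansion of \<open>(c y\<^sub>i + sqrt (1 - c\<^sup>2) y\<^sub>j)\<^sup>m\<close> has half-integer powers of
  \<open>1 - c\<^sup>2\<close> only in front of odd powers of \<open>y\<^sub>j\<close>, and these have mean zero by reflection.
\<close>

lemma zonal_conv_power_poly:
  fixes i j :: "'n::finite"
  assumes ij: "i \<noteq> j" and g: "continuous_on UNIV g"
  shows "\<exists>p. degree p \<le> m \<and> (\<forall>c. \<bar>c\<bar> \<le> 1 \<longrightarrow> zonal_conv i j (\<lambda>x. x ^ m) g c = poly p c)"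
proof -
  define a where "a q = sphere_mean (\<lambda>y::real^'n. (y $ i) ^ (m - q) * (y $ j) ^ q * g (y $ i))" for q
  have odd: "a q = 0" if "odd q" for q
    unfolding a_def
    by (rule sphere_mean_flip[where j = j])
       (use ij that in \<open>auto intro!: continuous_intros continuous_on_coord g simp: reflect_axis_nth\<close>)
  define p where "p = (\<Sum>q\<le>m. smult (real (m choose q) * a q) (monom 1 (m - q) * [:1, 0, -1:] ^ (q div 2)))"
  have "degree p \<le> m"
    unfolding p_def
  proof (rule degree_sum_le)
    fix q assume q: "q \<in> {..m}"
    have "degree (monom 1 (m - q) * [:1, 0, -1:] ^ (q div 2) :: real poly)
        \<le> degree (monom 1 (m - q) :: real poly) + degree ([:1, 0, -1:] ^ (q div 2) :: real poly)"
      by (rule degree_mult_le)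
    also have "\<dots> \<le> (m - q) + degree [:1, 0, -1 :: real:] * (q div 2)"
      by (intro add_mono degree_monom_le degree_power_le)
    also have "\<dots> \<le> m" using q by simp
    finally show "degree (smult (real (m choose q) * a q) (monom 1 (m - q) * [:1, 0, -1:] ^ (q div 2))) \<le> m"
      using degree_smult_le order_trans by blast
  qed simp
  moreover have "zonal_conv i j (\<lambda>x. x ^ m) g c = poly p c" if c: "\<bar>c\<bar> \<le> 1" for c
  proof -
    let ?r = "sqrt (1 - c\<^sup>2)"
    have "(c * y $ i + ?r * y $ j) ^ m * g (y $ i)
        = (\<Sum>q\<le>m. (real (m choose q) * c ^ (m - q) * ?r ^ q) * ((y $ i) ^ (m - q) * (y $ j) ^ q * g (y $ i)))"
      for y :: "real^'n"
      by (subst add.commute, subst binomial_ring) (simp add: sum_distrib_left power_mult_distrib mult_ac)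
    then have "zonal_conv i j (\<lambda>x. x ^ m) g c = (\<Sum>q\<le>m. (real (m choose q) * c ^ (m - q) * ?r ^ q) * a q)"
      unfolding zonal_conv_def a_def
      by (simp only:, subst sphere_mean_sum)
         (auto intro!: continuous_intros continuous_on_coord g)
    also have "\<dots> = poly p c"
      unfolding p_def poly_sum
    proof (rule sum.cong[OF refl])
      fix q
      show "(real (m choose q) * c ^ (m - q) * ?r ^ q) * a q
          = poly (smult (real (m choose q) * a q) (monom 1 (m - q) * [:1, 0, -1:] ^ (q div 2))) c"
      proof (cases "even q")
        case True
        then obtain q' where q': "q = 2 * q'" by blast
        have "?r ^ q = (1 - c\<^sup>2) ^ q'"
          unfolding q' power_mult using square_le_1[OF c] by simp
        then show ?thesis using q' by (simp add: poly_monom power2_eq_square)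
      qed (simp add: odd)
    qed
    finally show ?thesis .
  qed
  ultimately show ?thesis by blast
qed

lemma zonal_conv_taylor_poly:
  fixes i j :: "'n::finite"
  assumes ij: "i \<noteq> j" and g: "continuous_on UNIV g" and N: "N > 0"
  shows "\<exists>p. degree p < N \<and>
    (\<forall>c. \<bar>c\<bar> \<le> 1 \<longrightarrow> zonal_conv i j (\<lambda>x. \<Sum>m<N. (\<beta> * x) ^ m / fact m) g c = poly p c)"
proof -
  obtain P where P: "\<And>m. degree (P m) \<le> m"
    "\<And>m c. \<bar>c\<bar> \<le> 1 \<Longrightarrow> zonal_conv i j (\<lambda>x. x ^ m) g c = poly (P m) c"
    using zonal_conv_power_poly[OF ij g] by metis
  define p where "p = (\<Sum>m<N. smult (\<beta> ^ m / fact m) (P m))"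
  have "degree p \<le> N - 1"
    unfolding p_def
  proof (rule degree_sum_le)
    fix m assume "m \<in> {..<N}"
    then have "m \<le> N - 1" by auto
    then show "degree (smult (\<beta> ^ m / fact m) (P m)) \<le> N - 1"
      using degree_smult_le[of "\<beta> ^ m / fact m" "P m"] P(1)[of m] by linarith
  qed simp
  moreover have "zonal_conv i j (\<lambda>x. \<Sum>m<N. (\<beta> * x) ^ m / fact m) g c = poly p c" if "\<bar>c\<bar> \<le> 1" for c
  proof -
    have "zonal_conv i j (\<lambda>x. \<Sum>m<N. (\<beta> * x) ^ m / fact m) g c
        = sphere_mean (\<lambda>y::real^'n. \<Sum>m<N. (\<beta> ^ m / fact m) *
            ((c * y $ i + sqrt (1 - c\<^sup>2) * y $ j) ^ m * g (y $ i)))"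
      unfolding zonal_conv_def
      by (rule sphere_mean_cong) (simp add: sum_distrib_left power_mult_distrib mult_ac)
    also have "\<dots> = (\<Sum>m<N. (\<beta> ^ m / fact m) * zonal_conv i j (\<lambda>x. x ^ m) g c)"
      unfolding zonal_conv_def sphere_mean_cmult[symmetric]
      by (rule sphere_mean_sum) (intro continuous_intros continuous_on_coord g)
    also have "\<dots> = poly p c" by (simp add: p_def poly_sum P(2)[OF that])
    finally show ?thesis .
  qed
  ultimately show ?thesis using N by (intro exI[of _ p]) auto
qed

text \<open>
  Convolution with the Taylor polynomial \<open>T\<close> of the kernel takes values in the polynomials of
  degree less than \<open>N\<close>, so that \<open>\<langle>T * h, T * h\<rangle> = \<langle>h, T * (T * h)\<rangle> = 0\<close> for \<open>h\<close> orthogonal to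
  these polynomials. Only the Taylor remainder acts on \<open>h\<close>. This takes the place of the
  completeness of the Gegenbauer polynomials and of the compactness of the operator.
\<close>

lemma zonal_conv_small:
  fixes i j :: "'n::finite"
  assumes ij: "i \<noteq> j" and l: "l > 0" and h: "continuous_on UNIV h" and N: "N > 0"
    and orth: "\<And>m. m < N \<Longrightarrow> sphere_mean (\<lambda>x::real^'n. h (x $ i) * gegenbauer m l (x $ i)) = 0"
    and B: "\<And>c. \<bar>c\<bar> \<le> 1 \<Longrightarrow> \<bar>h c\<bar> \<le> B" and c: "\<bar>c\<bar> \<le> 1" and \<beta>: "\<beta> \<ge> 0"
  shows "\<bar>zonal_conv i j (\<lambda>x. exp (\<beta> * x)) h c\<bar> \<le> exp \<beta> * \<beta> ^ N / fact N * B"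
proof -
  define T where "T x = (\<Sum>m<N. (\<beta> * x) ^ m / fact m)" for x
  have T: "continuous_on UNIV T" unfolding T_def by (intro continuous_intros) auto
  define b where "b = zonal_conv i j T h"
  have b: "continuous_on UNIV b" unfolding b_def by (rule zonal_conv_continuous[OF T h])
  obtain p where p: "degree p < N" "\<And>c. \<bar>c\<bar> \<le> 1 \<Longrightarrow> zonal_conv i j T b c = poly p c"
    using zonal_conv_taylor_poly[OF ij b N, of \<beta>] unfolding T_def by blast
  have "sphere_mean (\<lambda>x::real^'n. b (x $ i) * b (x $ i)) = sphere_mean (\<lambda>x::real^'n. h (x $ i) * zonal_conv i j T b (x $ i))"
    using zonal_conv_selfadjoint[OF ij T h b] by (simp add: b_def)
  also have "\<dots> = 0" by (rule orthogonal_to_poly[OF l h orth p])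
  finally have "sphere_mean (\<lambda>x::real^'n. b (x $ i) * b (x $ i)) = 0" .
  moreover have "continuous_on UNIV (\<lambda>x::real^'n. b (x $ i) * b (x $ i))"
    by (intro continuous_intros continuous_on_coord b)
  ultimately have "b (parallel_point i j c $ i) * b (parallel_point i j c $ i) = 0"
    using norm_parallel_point[OF ij c]
    by (intro sphere_mean_eq_0_imp[where f = "\<lambda>x. b (x $ i) * b (x $ i)"]) auto
  then have "b c = 0" using ij by (simp add: parallel_point_nth)
  let ?\<theta> = "\<lambda>y::real^'n. c * y $ i + sqrt (1 - c\<^sup>2) * y $ j"
  have "zonal_conv i j (\<lambda>x. exp (\<beta> * x)) h c - b c
      = sphere_mean (\<lambda>y::real^'n. exp (\<beta> * ?\<theta> y) * h (y $ i) - T (?\<theta> y) * h (y $ i))"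
    unfolding zonal_conv_def b_def
    by (rule sphere_mean_diff[symmetric])
       (intro continuous_intros continuous_on_coord h continuous_on_compose2[OF T]; simp)+
  also have "\<bar>\<dots>\<bar> \<le> exp \<beta> * \<beta> ^ N / fact N * B"
  proof (rule sphere_mean_abs_le)
    fix y :: "real^'n" assume y: "norm y = 1"
    have "\<bar>\<beta> * ?\<theta> y\<bar> \<le> \<beta>"
      using abs_inner_parallel_le_1[OF ij c y] \<beta> by (simp add: abs_mult mult_left_le)
    from exp_taylor_bound[OF this, of N]
    have "\<bar>exp (\<beta> * ?\<theta> y) - T (?\<theta> y)\<bar> \<le> exp \<beta> * \<beta> ^ N / fact N" unfolding T_def .
    then have "\<bar>exp (\<beta> * ?\<theta> y) - T (?\<theta> y)\<bar> * \<bar>h (y $ i)\<bar> \<le> exp \<beta> * \<beta> ^ N / fact N * B"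
      using B[OF abs_coord_le_1[OF y, of i]] \<beta> by (intro mult_mono) auto
    then show "\<bar>exp (\<beta> * ?\<theta> y) * h (y $ i) - T (?\<theta> y) * h (y $ i)\<bar> \<le> exp \<beta> * \<beta> ^ N / fact N * B"
      by (simp add: abs_mult[symmetric] left_diff_distrib)
  qed (intro continuous_intros continuous_on_coord h continuous_on_compose2[OF T]; simp)
  finally show ?thesis using \<open>b c = 0\<close> by simp
qed

section \<open>Fixed points depending on a parameter\<close>

text \<open>
  Banach's fixed point theorem on a ball in a closed set \<open>U\<close>. Since \<open>q\<close> does not depend on \<open>t\<close>,
  \<open>norm (u s - u t) \<le> norm (\<Psi> s (u t) - \<Psi> t (u t)) / (1 - q)\<close>, so continuity in \<open>t\<close> for each
  fixed argument passes to the fixed points.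
\<close>

lemma uniform_contraction:
  fixes \<Psi> :: "real \<Rightarrow> 'b::{real_normed_vector, complete_space} \<Rightarrow> 'b"
  assumes U: "closed U" "0 \<in> U" and r: "r > 0" and d: "d > 0" and q: "0 \<le> q" "q < 1"
    and maps: "\<And>t u. \<bar>t\<bar> < d \<Longrightarrow> u \<in> U \<Longrightarrow> norm u \<le> r \<Longrightarrow> \<Psi> t u \<in> U"
    and lip: "\<And>t u u'. \<bar>t\<bar> < d \<Longrightarrow> u \<in> U \<Longrightarrow> norm u \<le> r \<Longrightarrow> u' \<in> U \<Longrightarrow> norm u' \<le> r
        \<Longrightarrow> norm (\<Psi> t u - \<Psi> t u') \<le> q * norm (u - u')"
    and small: "\<And>t. \<bar>t\<bar> < d \<Longrightarrow> norm (\<Psi> t 0) \<le> (1 - q) * r"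
    and cont: "\<And>u. u \<in> U \<Longrightarrow> norm u \<le> r \<Longrightarrow> continuous_on {-d<..<d} (\<lambda>t. \<Psi> t u)"
    and zero: "\<Psi> 0 0 = 0"
  obtains u where "continuous_on {-d<..<d} u" "u 0 = 0"
    "\<And>t. \<bar>t\<bar> < d \<Longrightarrow> u t \<in> U \<and> norm (u t) \<le> r \<and> \<Psi> t (u t) = u t"
proof -
  let ?S = "U \<inter> cball 0 r"
  have S: "complete ?S" "?S \<noteq> {}" using U r by (auto simp: complete_eq_closed)
  have ex: "\<exists>!u. u \<in> ?S \<and> \<Psi> t u = u" if t: "\<bar>t\<bar> < d" for t
  proof -
    have "norm (\<Psi> t u) \<le> r" if "u \<in> U" "norm u \<le> r" for u
    proof -
      have "norm (\<Psi> t u) \<le> norm (\<Psi> t u - \<Psi> t 0) + norm (\<Psi> t 0)"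
        using norm_triangle_ineq[of "\<Psi> t u - \<Psi> t 0" "\<Psi> t 0"] by simp
      also have "\<dots> \<le> q * r + (1 - q) * r"
        using lip[OF t that U(2)] r small[OF t] mult_left_mono[OF that(2) q(1)] by simp
      finally show ?thesis by (simp add: algebra_simps)
    qed
    then have "\<Psi> t ` ?S \<subseteq> ?S" using maps[OF t] by auto
    moreover have "dist (\<Psi> t u) (\<Psi> t u') \<le> q * dist u u'" if "u \<in> ?S" "u' \<in> ?S" for u u'
      using lip[OF t, of u u'] that by (simp add: dist_norm)
    ultimately have "\<exists>!u. u \<in> ?S \<and> \<Psi> t u = u"
      by (intro Banach_fix[OF S q]) auto
    then show ?thesis .
  qed
  define u where "u t = (THE u. u \<in> ?S \<and> \<Psi> t u = u)" for t
  have u: "u t \<in> U" "norm (u t) \<le> r" "\<Psi> t (u t) = u t" if "\<bar>t\<bar> < d" for t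
    using theI'[OF ex[OF that]] unfolding u_def[symmetric] by auto
  have "u 0 = 0"
    unfolding u_def by (rule the1_equality[OF ex]) (use d U r zero in auto)
  moreover have "continuous_on {-d<..<d} u"
    unfolding continuous_on_def
  proof
    fix t assume t: "t \<in> {-d<..<d}"
    then have t': "\<bar>t\<bar> < d" by auto
    have "((\<lambda>s. \<Psi> s (u t)) \<longlongrightarrow> \<Psi> t (u t)) (at t within {-d<..<d})"
      using cont[OF u(1,2)[OF t']] t by (simp add: continuous_on_def)
    then have "((\<lambda>s. norm (\<Psi> s (u t) - \<Psi> t (u t)) / (1 - q)) \<longlongrightarrow> 0 / (1 - q)) (at t within {-d<..<d})"
      using q by (intro tendsto_divide tendsto_norm_zero) (auto simp: LIM_zero_iff)
    moreover have "norm (u s - u t) \<le> norm (\<Psi> s (u t) - \<Psi> t (u t)) / (1 - q)" if "s \<in> {-d<..<d}" for s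
    proof -
      have s: "\<bar>s\<bar> < d" using that by auto
      have "norm (u s - u t) = norm ((\<Psi> s (u s) - \<Psi> s (u t)) + (\<Psi> s (u t) - \<Psi> t (u t)))"
        using u(3)[OF s] u(3)[OF t'] by simp
      also have "\<dots> \<le> q * norm (u s - u t) + norm (\<Psi> s (u t) - \<Psi> t (u t))"
        by (rule norm_triangle_le, rule add_right_mono, rule lip[OF s]) (use u s t' in auto)
      finally show ?thesis using q by (simp add: pos_le_divide_eq algebra_simps)
    qed
    ultimately have "((\<lambda>s. u s - u t) \<longlongrightarrow> 0) (at t within {-d<..<d})"
      by (intro Lim_null_comparison[of "\<lambda>s. u s - u t"]) (auto simp: eventually_at_filter)
    then show "(u \<longlongrightarrow> u t) (at t within {-d<..<d})" by (simp add: LIM_zero_iff)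
  qed
  ultimately show ?thesis using u by (intro that[of u]) auto
qed

section \<open>Composition with bounded continuous functions\<close>

definition compose_bcontfun :: "(real \<Rightarrow> real) \<Rightarrow> (real \<Rightarrow>\<^sub>C real) \<Rightarrow> (real \<Rightarrow>\<^sub>C real)" where
  "compose_bcontfun f g = Bcontfun (\<lambda>s. f (apply_bcontfun g s))"

lemma apply_compose_bcontfun:
  assumes "continuous_on UNIV f"
  shows "apply_bcontfun (compose_bcontfun f g) s = f (apply_bcontfun g s)"
proof -
  have "bounded (f ` {- norm g..norm g})"
    by (rule compact_imp_bounded[OF compact_continuous_image])
       (use assms continuous_on_subset in blast)+
  then obtain B where B: "\<forall>x\<in>{- norm g..norm g}. \<bar>f x\<bar> \<le> B"
    unfolding bounded_iff by auto
  have "(\<lambda>s. f (apply_bcontfun g s)) \<in> bcontfun"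
  proof (rule bcontfun_normI)
    show "continuous_on UNIV (\<lambda>s. f (apply_bcontfun g s))"
      by (rule continuous_on_compose2[OF assms]) auto
    show "norm (f (apply_bcontfun g s)) \<le> B" for s
      using norm_bounded[of g s] B by (auto simp: abs_le_iff)
  qed
  then show ?thesis by (simp add: compose_bcontfun_def Bcontfun_inverse)
qed

lemma norm_compose_diff_le:
  assumes f: "continuous_on UNIV f" and f': "continuous_on UNIV f'"
    and le: "\<And>s. \<bar>f (apply_bcontfun g s) - f' (apply_bcontfun g' s)\<bar> \<le> B"
  shows "norm (compose_bcontfun f g - compose_bcontfun f' g') \<le> B"
  using le by (intro norm_bound) (simp add: apply_compose_bcontfun f f')

text \<open>
  The nonlinearity that is left when the equation for \<open>\<eta> = t (P\<^sub>k + z)\<close> is divided by \<open>t\<close>. Division by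
  zero gives \<open>0\<close>, which is the continuous extension to \<open>t = 0\<close>.
\<close>

definition exp_remainder :: "real \<Rightarrow> real \<Rightarrow> real" where
  "exp_remainder t s = (exp (t * s) - 1 - t * s) / t"

lemma exp_remainder_continuous: "continuous_on UNIV (exp_remainder t)"
  unfolding exp_remainder_def by (cases "t = 0") (auto intro!: continuous_intros)

text \<open>
  The derivative \<open>exp (t x) - 1\<close> with respect to \<open>x\<close> is of order \<open>t\<close>. The nonlinearity is thus a small
  perturbation for small \<open>t\<close>.
\<close>

lemma exp_remainder_lipschitz:
  assumes t: "\<bar>t\<bar> \<le> 1" and s: "\<bar>s\<bar> \<le> B" "\<bar>s'\<bar> \<le> B"
  shows "\<bar>exp_remainder t s - exp_remainder t s'\<bar> \<le> \<bar>t\<bar> * (exp B * B) * \<bar>s - s'\<bar>"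
proof (cases "t = 0")
  case True
  then show ?thesis by (simp add: exp_remainder_def)
next
  case False
  have "norm (exp_remainder t s - exp_remainder t s') \<le> (\<bar>t\<bar> * (exp B * B)) * norm (s - s')"
  proof (rule field_differentiable_bound[of "{-B..B}" _ "\<lambda>x. exp (t * x) - 1"])
    fix x assume x: "x \<in> {-B..B}"
    show "(exp_remainder t has_field_derivative exp (t * x) - 1) (at x within {-B..B})"
      unfolding exp_remainder_def
      using False by (auto intro!: derivative_eq_intros simp: field_simps)
    have tx: "\<bar>t * x\<bar> \<le> \<bar>t\<bar> * B" using x by (auto simp: abs_mult intro!: mult_left_mono)
    have "\<bar>exp (t * x) - 1\<bar> \<le> exp (\<bar>t\<bar> * B) * (\<bar>t\<bar> * B)"
      using exp_taylor_bound[OF tx, of 1] by simp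
    also have "\<dots> \<le> exp B * (\<bar>t\<bar> * B)"
      using t s by (intro mult_right_mono) (auto simp: mult_left_le_one_le)
    finally show "norm (exp (t * x) - 1) \<le> \<bar>t\<bar> * (exp B * B)" by (simp add: mult_ac)
  qed (use s in \<open>auto simp: abs_le_iff\<close>)
  then show ?thesis by simp
qed

lemma exp_remainder_bound:
  assumes t: "\<bar>t\<bar> \<le> 1" and s: "\<bar>s\<bar> \<le> B"
  shows "\<bar>exp_remainder t s\<bar> \<le> \<bar>t\<bar> * (exp B * B * B)"
proof -
  have B: "0 \<le> B" using s by simp
  have "exp_remainder t 0 = 0" by (simp add: exp_remainder_def)
  with exp_remainder_lipschitz[OF t s, of 0] B have "\<bar>exp_remainder t s\<bar> \<le> \<bar>t\<bar> * (exp B * B) * \<bar>s\<bar>" by simp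
  also have "\<dots> \<le> \<bar>t\<bar> * (exp B * B) * B" using s B by (intro mult_left_mono mult_nonneg_nonneg) auto
  finally show ?thesis by (simp add: mult_ac)
qed

lemma exp_remainder_continuous_param:
  "continuous_on UNIV (\<lambda>p. exp_remainder (fst p) (snd p))"
proof -
  have "isCont (\<lambda>p. exp_remainder (fst p) (snd p)) p" for p
  proof (cases "fst p = 0")
    case False
    then show ?thesis unfolding exp_remainder_def by (intro continuous_intros) auto
  next
    case True
    then obtain s where p: "p = (0, s)" by (cases p) auto
    have "((\<lambda>p. exp_remainder (fst p) (snd p)) \<longlongrightarrow> 0) (at p)"
    proof (rule Lim_null_comparison)
      define B where "B = \<bar>s\<bar> + 1"
      have "\<forall>\<^sub>F q in at p. dist q p < 1"
        unfolding eventually_at by (rule exI[of _ 1]) auto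
      then show "\<forall>\<^sub>F q in at p. norm (exp_remainder (fst q) (snd q)) \<le> \<bar>fst q\<bar> * (exp B * B * B)"
      proof eventually_elim
        fix q :: "real \<times> real" assume "dist q p < 1"
        then have "\<bar>fst q\<bar> \<le> 1" "\<bar>snd q - s\<bar> \<le> 1"
          using dist_fst_le[of q p] dist_snd_le[of q p] by (auto simp: p dist_real_def)
        then show "norm (exp_remainder (fst q) (snd q)) \<le> \<bar>fst q\<bar> * (exp B * B * B)"
          using exp_remainder_bound[of "fst q" "snd q" B] by (simp add: B_def)
      qed
      have "((\<lambda>q. \<bar>fst q\<bar> * (exp B * B * B)) \<longlongrightarrow> \<bar>fst p\<bar> * (exp B * B * B)) (at p)"
        by (intro tendsto_intros)
      then show "((\<lambda>q. \<bar>fst q\<bar> * (exp B * B * B)) \<longlongrightarrow> 0) (at p)" by (simp add: p)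
    qed
    then show ?thesis unfolding isCont_def by (simp add: p exp_remainder_def)
  qed
  then show ?thesis by (simp add: continuous_on_eq_continuous_at)
qed

lemma compose_exp_remainder_continuous:
  "continuous_on S (\<lambda>t. compose_bcontfun (exp_remainder t) b)"
proof -
  have "isCont (\<lambda>t. compose_bcontfun (exp_remainder t) b) t" for t
    unfolding continuous_at_eps_delta
  proof (intro allI impI)
    fix e :: real assume e: "e > 0"
    let ?K = "{t - 1..t + 1} \<times> {- norm b..norm b}"
    have "uniformly_continuous_on ?K (\<lambda>p. exp_remainder (fst p) (snd p))"
      by (intro compact_uniformly_continuous continuous_on_subset[OF exp_remainder_continuous_param]
          compact_Times) auto
    then obtain d where d: "d > 0" "\<And>p p'. p \<in> ?K \<Longrightarrow> p' \<in> ?K \<Longrightarrow> dist p' p < d \<Longrightarrow>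
        dist (exp_remainder (fst p') (snd p')) (exp_remainder (fst p) (snd p)) < e / 2"
      unfolding uniformly_continuous_on_def using e by (meson half_gt_zero)
    show "\<exists>d>0. \<forall>t'. dist t' t < d \<longrightarrow>
        dist (compose_bcontfun (exp_remainder t') b) (compose_bcontfun (exp_remainder t) b) < e"
    proof (intro exI[of _ "min d 1"] conjI allI impI)
      fix t' assume t': "dist t' t < min d 1"
      have "norm (compose_bcontfun (exp_remainder t') b - compose_bcontfun (exp_remainder t) b) \<le> e / 2"
      proof (rule norm_compose_diff_le[OF exp_remainder_continuous exp_remainder_continuous])
        fix s
        let ?b = "apply_bcontfun b s"
        have "\<bar>?b\<bar> \<le> norm b" using norm_bounded[of b s] by simp
        then have "dist (exp_remainder (fst (t', ?b)) (snd (t', ?b)))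
            (exp_remainder (fst (t, ?b)) (snd (t, ?b))) < e / 2"
          by (intro d(2)) (use t' in \<open>auto simp: dist_Pair_Pair dist_real_def abs_if split: if_splits\<close>)
        then show "\<bar>exp_remainder t' ?b - exp_remainder t ?b\<bar> \<le> e / 2" by (simp add: dist_real_def)
      qed
      then show "dist (compose_bcontfun (exp_remainder t') b) (compose_bcontfun (exp_remainder t) b) < e"
        using e by (simp add: dist_norm)
    qed (use d in auto)
  qed
  then show ?thesis using continuous_at_imp_continuous_on by blast
qed

section \<open>Bifurcation from a simple eigenvalue\<close>

text \<open>
  The spectral information about the interaction operator that the bifurcation argument needs. The
  functionals \<open>coef\<close> are the expansion coefficients in the system \<open>P\<close>, and \<open>coef 0\<close> is the mean. The
  assumption on the tail replaces a convergent expansion: beyond finitely many modes the operator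
  is as small as required.
\<close>

locale diagonal_operator =
  fixes A :: "(real \<Rightarrow>\<^sub>C real) \<Rightarrow> (real \<Rightarrow>\<^sub>C real)" and P :: "nat \<Rightarrow> (real \<Rightarrow>\<^sub>C real)"
    and coef :: "nat \<Rightarrow> (real \<Rightarrow>\<^sub>C real) \<Rightarrow> real" and \<alpha> :: "nat \<Rightarrow> real"
  assumes linear_A: "bounded_linear A" and linear_coef: "\<And>j. bounded_linear (coef j)"
    and dual: "\<And>i j. coef i (P j) = (if i = j then 1 else 0)"
    and eigen: "\<And>j. A (P j) = \<alpha> j *\<^sub>R P j"
    and adjoint: "\<And>j f. coef j (A f) = \<alpha> j * coef j f"
    and tail: "\<And>e. e > 0 \<Longrightarrow> \<exists>N. \<forall>h. (\<forall>j<N. coef j h = 0) \<longrightarrow> norm (A h) \<le> e * norm h"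
    and const: "P 0 = const_bcontfun 1"
begin

lemmas A_simps = linear_simps[OF linear_A] and coef_simps = linear_simps[OF linear_coef]

lemma coef_sum: "coef i (\<Sum>j\<in>J. f j) = (\<Sum>j\<in>J. coef i (f j))"
  using bounded_linear.linear[OF linear_coef] by (rule linear_sum)

lemma A_sum: "A (\<Sum>j\<in>J. f j) = (\<Sum>j\<in>J. A (f j))"
  using bounded_linear.linear[OF linear_A] by (rule linear_sum)

end

locale simple_mode = diagonal_operator +
  fixes k :: nat
  assumes k: "k \<ge> 1" and \<alpha>k: "\<alpha> k > 0" and simple: "\<And>j. j \<noteq> k \<Longrightarrow> \<alpha> j \<noteq> \<alpha> k"
begin

definition crit :: real where "crit = 1 / \<alpha> k"

text \<open>
  The unknown \<open>u = (h, p)\<close> keeps the high modes \<open>h\<close> apart from the low modes \<open>p\<close>: the norm of the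
  pair then sees \<open>h\<close> itself, where the operator is small, without the norm of a spectral projection.
  The perturbation \<open>pert u\<close> of \<open>P k\<close> is sought without a component along \<open>P k\<close>, so that this component
  of \<open>p\<close> can carry \<open>par u\<close>, the deviation of the parameter from its critical value.
\<close>

definition par :: "(real \<Rightarrow>\<^sub>C real) \<times> (real \<Rightarrow>\<^sub>C real) \<Rightarrow> real" where
  "par u = coef k (snd u)"

definition pert :: "(real \<Rightarrow>\<^sub>C real) \<times> (real \<Rightarrow>\<^sub>C real) \<Rightarrow> (real \<Rightarrow>\<^sub>C real)" where
  "pert u = fst u + snd u - par u *\<^sub>R P k"

definition potential :: "(real \<Rightarrow>\<^sub>C real) \<times> (real \<Rightarrow>\<^sub>C real) \<Rightarrow> (real \<Rightarrow>\<^sub>C real)" where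
  "potential u = (crit + par u) *\<^sub>R A (P k + pert u)"

definition nonlin :: "real \<Rightarrow> (real \<Rightarrow>\<^sub>C real) \<times> (real \<Rightarrow>\<^sub>C real) \<Rightarrow> (real \<Rightarrow>\<^sub>C real)" where
  "nonlin t u = compose_bcontfun (exp_remainder t) (potential u)"

text \<open>
  What remains of the Gibbs equation for \<open>\<eta> = t (P\<^sub>k + pert u)\<close>, divided by \<open>t\<close>, after the linear part
  \<open>z - crit A z - m \<alpha>\<^sub>k P\<^sub>k\<close> in \<open>z = pert u\<close> and \<open>m = par u\<close> has been taken to the left. The part with
  \<open>coef 0\<close> comes from the normalization of the Gibbs density.
\<close>

definition rhs :: "real \<Rightarrow> (real \<Rightarrow>\<^sub>C real) \<times> (real \<Rightarrow>\<^sub>C real) \<Rightarrow> (real \<Rightarrow>\<^sub>C real)" where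
  "rhs t u = par u *\<^sub>R A (pert u) +
     (nonlin t u - coef 0 (nonlin t u) *\<^sub>R (P 0 + t *\<^sub>R (P k + pert u)))"

lemma linear_par: "bounded_linear par"
  unfolding par_def by (rule bounded_linear_compose[OF linear_coef bounded_linear_snd])

lemma linear_pert: "bounded_linear pert"
  unfolding pert_def
  by (intro bounded_linear_sub bounded_linear_add bounded_linear_fst bounded_linear_snd
      bounded_linear_compose[OF bounded_linear_scaleR_left linear_par])

lemmas par_simps = linear_simps[OF linear_par] and pert_simps = linear_simps[OF linear_pert]

lemma common_bound:
  obtains C where "C \<ge> 1" "\<And>u. \<bar>par u\<bar> \<le> C * norm u" "\<And>u. norm (pert u) \<le> C * norm u"
    "\<And>f. norm (A f) \<le> C * norm f" "\<And>f. \<bar>coef 0 f\<bar> \<le> C * norm f" "norm (P k) \<le> C" "crit \<le> C"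
    "norm (P 0) \<le> C"
proof -
  obtain C1 where C1: "\<And>u. norm (par u) \<le> norm u * C1" using bounded_linear.bounded[OF linear_par] by blast
  obtain C2 where C2: "\<And>u. norm (pert u) \<le> norm u * C2" using bounded_linear.bounded[OF linear_pert] by blast
  obtain C3 where C3: "\<And>u. norm (A u) \<le> norm u * C3" using bounded_linear.bounded[OF linear_A] by blast
  obtain C4 where C4: "\<And>u. norm (coef 0 u) \<le> norm u * C4" using bounded_linear.bounded[OF linear_coef] by blast
  define C where "C = 1 + \<bar>C1\<bar> + \<bar>C2\<bar> + \<bar>C3\<bar> + \<bar>C4\<bar> + norm (P k) + norm (P 0) + \<bar>crit\<bar>"
  have C: "C1 \<le> C" "C2 \<le> C" "C3 \<le> C" "C4 \<le> C" "norm (P k) \<le> C" "crit \<le> C" "C \<ge> 1" "norm (P 0) \<le> C"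
    unfolding C_def using norm_ge_zero[of "P k"] norm_ge_zero[of "P 0"] by linarith+
  have *: "x \<le> C * y" if "x \<le> y * c" "c \<le> C" "0 \<le> y" for x y c
    using that mult_left_mono[OF that(2,3)] by (simp add: mult.commute)
  show ?thesis
  proof (rule that[of C])
    show "\<bar>par u\<bar> \<le> C * norm u" for u using *[OF C1 C(1)] by simp
    show "norm (pert u) \<le> C * norm u" for u using *[OF C2 C(2)] by simp
    show "norm (A f) \<le> C * norm f" for f using *[OF C3 C(3)] by simp
    show "\<bar>coef 0 f\<bar> \<le> C * norm f" for f using *[OF C4 C(4)] by simp
  qed (use C in auto)
qed

text \<open>
  The right-hand side is the sum of the product of \<open>par u\<close> with \<open>A (pert u)\<close>, quadratic in \<open>u\<close>, and of
  terms of order \<open>t\<close>. Hence its Lipschitz constant on the ball of radius \<open>r\<close> is of order \<open>\<bar>t\<bar> + r\<close>.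
\<close>

lemma rhs_estimates:
  obtains L where "L \<ge> 0"
    "\<And>t r u u'. \<bar>t\<bar> \<le> 1 \<Longrightarrow> norm u \<le> r \<Longrightarrow> norm u' \<le> r \<Longrightarrow> r \<le> 1 \<Longrightarrow>
       norm (rhs t u - rhs t u') \<le> L * (\<bar>t\<bar> + r) * norm (u - u')"
    "\<And>t. \<bar>t\<bar> \<le> 1 \<Longrightarrow> norm (rhs t 0) \<le> L * \<bar>t\<bar>"
proof -
  obtain C where C: "C \<ge> 1" "\<And>u. \<bar>par u\<bar> \<le> C * norm u" "\<And>u. norm (pert u) \<le> C * norm u"
    "\<And>f. norm (A f) \<le> C * norm f" "\<And>f. \<bar>coef 0 f\<bar> \<le> C * norm f" "norm (P k) \<le> C" "crit \<le> C"
    "norm (P 0) \<le> C"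
    by (rule common_bound) blast
  have C0: "0 \<le> C" using C(1) by simp
  have crit: "\<bar>crit\<bar> \<le> C" using C(7) \<alpha>k by (simp add: crit_def)
  define B where "B = 4 * C ^ 3"
  define K where "K = exp B * B"
  have B0: "B \<ge> 0" "K \<ge> 0" using C0 by (auto simp: B_def K_def)
  have pert1: "norm (pert u) \<le> C" if "norm u \<le> 1" for u
    using C(3)[of u] mult_left_mono[OF that C0] by simp
  have par1: "\<bar>par u\<bar> \<le> C" if "norm u \<le> 1" for u
    using C(2)[of u] mult_left_mono[OF that C0] by simp
  have mode: "norm (P k + pert u) \<le> 2 * C" if "norm u \<le> 1" for u
    using norm_triangle_ineq[of "P k" "pert u"] C(6) pert1[OF that] by simp
  have Amode: "norm (A (P k + pert u)) \<le> 2 * C\<^sup>2" if "norm u \<le> 1" for u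
    using C(4)[of "P k + pert u"] mult_left_mono[OF mode[OF that] C0] by (simp add: power2_eq_square)
  have potential_bound: "norm (potential u) \<le> B" if "norm u \<le> 1" for u
  proof -
    have "\<bar>crit + par u\<bar> \<le> 2 * C" using crit par1[OF that] by linarith
    then have "\<bar>crit + par u\<bar> * norm (A (P k + pert u)) \<le> 2 * C * (2 * C\<^sup>2)"
      using Amode[OF that] C0 by (intro mult_mono) auto
    then show ?thesis by (simp add: potential_def B_def power2_eq_square power3_eq_cube)
  qed
  have potential_diff: "norm (potential u - potential u') \<le> B * norm (u - u')" if "norm u \<le> 1" "norm u' \<le> 1" for u u'
  proof -
    have "potential u - potential u' = par (u - u') *\<^sub>R A (P k + pert u) + (crit + par u') *\<^sub>R A (pert (u - u'))"
      by (simp add: potential_def par_simps pert_simps A_simps algebra_simps)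
    also have "norm \<dots> \<le> \<bar>par (u - u')\<bar> * norm (A (P k + pert u)) + \<bar>crit + par u'\<bar> * norm (A (pert (u - u')))"
      by (rule norm_triangle_le) simp
    also have "\<dots> \<le> (C * norm (u - u')) * (2 * C\<^sup>2) + (2 * C) * (C * (C * norm (u - u')))"
    proof (intro add_mono mult_mono)
      show "\<bar>crit + par u'\<bar> \<le> 2 * C" using crit par1[OF that(2)] by linarith
      show "norm (A (pert (u - u'))) \<le> C * (C * norm (u - u'))"
        using C(4)[of "pert (u - u')"] mult_left_mono[OF C(3)[of "u - u'"] C0] by linarith
    qed (use C(2) Amode[OF that(1)] C0 in auto)
    also have "\<dots> = B * norm (u - u')" by (simp add: B_def power2_eq_square power3_eq_cube algebra_simps)
    finally show ?thesis .
  qed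
  have nonlin_bound: "norm (nonlin t u) \<le> \<bar>t\<bar> * (K * B)" if t: "\<bar>t\<bar> \<le> 1" and u: "norm u \<le> 1" for t u
    unfolding nonlin_def
  proof (rule norm_bound)
    fix s
    have "\<bar>apply_bcontfun (potential u) s\<bar> \<le> B" using norm_bounded[of "potential u" s] potential_bound[OF u] by simp
    from exp_remainder_bound[OF t this]
    show "norm (apply_bcontfun (compose_bcontfun (exp_remainder t) (potential u)) s) \<le> \<bar>t\<bar> * (K * B)"
      by (simp add: apply_compose_bcontfun exp_remainder_continuous K_def)
  qed
  have nonlin_diff: "norm (nonlin t u - nonlin t u') \<le> \<bar>t\<bar> * (K * B) * norm (u - u')"
    if t: "\<bar>t\<bar> \<le> 1" and u: "norm u \<le> 1" "norm u' \<le> 1" for t u u'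
    unfolding nonlin_def
  proof (rule norm_compose_diff_le[OF exp_remainder_continuous exp_remainder_continuous])
    fix s
    let ?a = "apply_bcontfun (potential u) s" and ?b = "apply_bcontfun (potential u') s"
    have "\<bar>?a\<bar> \<le> B"
      using norm_bounded[of "potential u" s] potential_bound[OF u(1)] by simp
    moreover have "\<bar>?b\<bar> \<le> B"
      using norm_bounded[of "potential u'" s] potential_bound[OF u(2)] by simp
    ultimately have "\<bar>exp_remainder t ?a - exp_remainder t ?b\<bar> \<le> \<bar>t\<bar> * K * \<bar>?a - ?b\<bar>"
      using exp_remainder_lipschitz[OF t] by (simp add: K_def)
    also have "\<bar>?a - ?b\<bar> \<le> B * norm (u - u')"
      using norm_bounded[of "potential u - potential u'" s] potential_diff[OF u] by simp
    then have "\<bar>t\<bar> * K * \<bar>?a - ?b\<bar> \<le> \<bar>t\<bar> * K * (B * norm (u - u'))"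
      using B0 by (intro mult_left_mono) auto
    finally show "\<bar>exp_remainder t ?a - exp_remainder t ?b\<bar> \<le> \<bar>t\<bar> * (K * B) * norm (u - u')"
      by (simp add: mult_ac)
  qed
  define M where "M = K * B"
  have M: "M \<ge> 0" using B0 by (simp add: M_def)
  define base where "base t u = P 0 + t *\<^sub>R (P k + pert u)" for t u
  have base: "norm (base t u) \<le> 3 * C" if "\<bar>t\<bar> \<le> 1" "norm u \<le> 1" for t u
  proof -
    have "norm (base t u) \<le> norm (P 0) + \<bar>t\<bar> * norm (P k + pert u)"
      unfolding base_def by (rule norm_triangle_le) simp
    also have "\<bar>t\<bar> * norm (P k + pert u) \<le> norm (P k + pert u)"
      using that by (simp add: mult_left_le_one_le)
    finally show ?thesis using C(8) mode[OF that(2)] by linarith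
  qed
  define L where "L = 2 * C ^ 3 + M + 3 * M * C\<^sup>2 + M * C\<^sup>2"
  have L0: "L \<ge> 0" using C0 M by (auto simp: L_def)
  show ?thesis
  proof (rule that[OF L0])
    fix t assume t: "\<bar>t\<bar> \<le> (1::real)"
    have n0: "norm (nonlin t 0) \<le> \<bar>t\<bar> * M" using nonlin_bound[OF t, of 0] by (simp add: M_def)
    have "rhs t 0 = nonlin t 0 - coef 0 (nonlin t 0) *\<^sub>R base t 0"
      by (simp add: rhs_def base_def par_simps)
    also have "norm \<dots> \<le> norm (nonlin t 0) + \<bar>coef 0 (nonlin t 0)\<bar> * norm (base t 0)"
      using norm_triangle_ineq4[of "nonlin t 0" "coef 0 (nonlin t 0) *\<^sub>R base t 0"] by simp
    also have "\<dots> \<le> \<bar>t\<bar> * M + (C * (\<bar>t\<bar> * M)) * (3 * C)"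
      using n0 C(5)[of "nonlin t 0"] mult_left_mono[OF n0 C0] base[OF t, of 0] C0 M
      by (intro add_mono mult_mono) auto
    also have "\<dots> = (M + 3 * M * C\<^sup>2) * \<bar>t\<bar>" by (simp add: power2_eq_square algebra_simps)
    also have "\<dots> \<le> L * \<bar>t\<bar>" using C0 M by (intro mult_right_mono) (auto simp: L_def)
    finally show "norm (rhs t 0) \<le> L * \<bar>t\<bar>" .
  next
    fix t r :: real and u u' :: "(real \<Rightarrow>\<^sub>C real) \<times> (real \<Rightarrow>\<^sub>C real)"
    assume t: "\<bar>t\<bar> \<le> 1" and ur: "norm u \<le> r" "norm u' \<le> r" and r: "r \<le> 1"
    have u: "norm u \<le> 1" "norm u' \<le> 1" using ur r by auto
    have r0: "0 \<le> r" using ur(1) norm_ge_zero order_trans by blast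
    define D where "D = norm (u - u')"
    have D: "D \<ge> 0" by (simp add: D_def)
    let ?N = "nonlin t u" and ?N' = "nonlin t u'"
    have eq: "rhs t u - rhs t u'
        = (par (u - u') *\<^sub>R A (pert u) + par u' *\<^sub>R A (pert (u - u')))
        + ((?N - ?N') - (coef 0 (?N - ?N') *\<^sub>R base t u + coef 0 ?N' *\<^sub>R (t *\<^sub>R pert (u - u'))))"
      by (simp add: rhs_def base_def par_simps pert_simps A_simps coef_simps algebra_simps)
    have "norm (rhs t u - rhs t u') \<le> (\<bar>par (u - u')\<bar> * norm (A (pert u)) + \<bar>par u'\<bar> * norm (A (pert (u - u'))))
        + (norm (?N - ?N') + (\<bar>coef 0 (?N - ?N')\<bar> * norm (base t u) + \<bar>coef 0 ?N'\<bar> * (\<bar>t\<bar> * norm (pert (u - u')))))"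
    proof -
      have "norm ((x1 + x2) + (x3 - (x4 + x5))) \<le> (norm x1 + norm x2) + (norm x3 + (norm x4 + norm x5))"
        for x1 x2 x3 x4 x5 :: "real \<Rightarrow>\<^sub>C real"
        using norm_triangle_ineq[of "x1 + x2" "x3 - (x4 + x5)"] norm_triangle_ineq[of x1 x2]
          norm_triangle_ineq4[of x3 "x4 + x5"] norm_triangle_ineq[of x4 x5] by linarith
      then show ?thesis unfolding eq by (rule order_trans) (simp only: norm_scaleR order_refl)
    qed
    also have "\<dots> \<le> ((C * D) * (C * (C * r)) + (C * r) * (C * (C * D)))
        + (\<bar>t\<bar> * M * D + ((C * (\<bar>t\<bar> * M * D)) * (3 * C) + (C * M) * (\<bar>t\<bar> * (C * D))))"
    proof (intro add_mono mult_mono)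
      show "\<bar>par (u - u')\<bar> \<le> C * D" using C(2) by (simp add: D_def)
      show "norm (A (pert u)) \<le> C * (C * r)"
        using C(4)[of "pert u"] mult_left_mono[OF C(3)[of u] C0] mult_left_mono[OF mult_left_mono[OF ur(1) C0] C0] by linarith
      show "\<bar>par u'\<bar> \<le> C * r" using C(2)[of u'] mult_left_mono[OF ur(2) C0] by linarith
      show "norm (A (pert (u - u'))) \<le> C * (C * D)"
        using C(4)[of "pert (u - u')"] mult_left_mono[OF C(3)[of "u - u'"] C0] by (simp add: D_def)
      show nd: "norm (?N - ?N') \<le> \<bar>t\<bar> * M * D" using nonlin_diff[OF t u] by (simp add: M_def D_def)
      show "\<bar>coef 0 (?N - ?N')\<bar> \<le> C * (\<bar>t\<bar> * M * D)"
        using C(5)[of "?N - ?N'"] mult_left_mono[OF nd C0] by linarith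
      show "norm (base t u) \<le> 3 * C" by (rule base[OF t u(1)])
      have "norm ?N' \<le> M"
        using nonlin_bound[OF t u(2)] mult_right_mono[OF t M] by (simp add: M_def)
      then show "\<bar>coef 0 ?N'\<bar> \<le> C * M"
        using C(5)[of ?N'] mult_left_mono[of "norm ?N'" M C] C0 by linarith
      show "norm (pert (u - u')) \<le> C * D" using C(3) by (simp add: D_def)
    qed (use C0 M D r0 in auto)
    also have "\<dots> = (2 * C ^ 3 * r + (M + 3 * M * C\<^sup>2 + M * C\<^sup>2) * \<bar>t\<bar>) * D"
      by (simp add: power2_eq_square power3_eq_cube algebra_simps)
    also have "\<dots> \<le> (L * (\<bar>t\<bar> + r)) * D"
    proof (rule mult_right_mono[OF _ D])
      have "2 * C ^ 3 * r \<le> L * r" using C0 M r0 by (intro mult_right_mono) (auto simp: L_def)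
      moreover have "(M + 3 * M * C\<^sup>2 + M * C\<^sup>2) * \<bar>t\<bar> \<le> L * \<bar>t\<bar>"
        using C0 M by (intro mult_right_mono) (auto simp: L_def)
      ultimately show "2 * C ^ 3 * r + (M + 3 * M * C\<^sup>2 + M * C\<^sup>2) * \<bar>t\<bar> \<le> L * (\<bar>t\<bar> + r)"
        by (simp add: distrib_left)
    qed
    finally show "norm (rhs t u - rhs t u') \<le> L * (\<bar>t\<bar> + r) * norm (u - u')" by (simp add: D_def)
  qed
qed

lemma rhs_continuous: "continuous_on S (\<lambda>t. rhs t u)"
proof -
  have "continuous_on S (\<lambda>t. nonlin t u)"
    unfolding nonlin_def by (rule compose_exp_remainder_continuous)
  then show ?thesis
    unfolding rhs_def by (intro continuous_intros bounded_linear.continuous_on[OF linear_coef])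
qed

text \<open>
  Both sides of the Gibbs equation are normalized to the same mass. The component along the
  constants, where the linear part is not inverted, is therefore absent.
\<close>

lemma rhs_mean:
  assumes "coef 0 (fst u) = 0" "coef 0 (snd u) = 0"
  shows "coef 0 (pert u) = 0" "coef 0 (rhs t u) = 0"
proof -
  show *: "coef 0 (pert u) = 0" using assms k by (simp add: pert_def coef_simps dual)
  show "coef 0 (rhs t u) = 0" using * k by (simp add: rhs_def coef_simps dual adjoint)
qed

text \<open>
  The inverse of \<open>z - crit A z - m \<alpha>\<^sub>k P\<^sub>k\<close> on the modes from \<open>1\<close> to \<open>N - 1\<close>. The first two terms cancel
  on \<open>P\<^sub>k\<close>, and the parameter \<open>m\<close> supplies the missing direction.
\<close>

definition low_coeff :: "nat \<Rightarrow> real" where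
  "low_coeff j = (if j = k then - 1 / \<alpha> k else 1 / (1 - crit * \<alpha> j))"

definition split_modes :: "nat \<Rightarrow> (real \<Rightarrow>\<^sub>C real) \<Rightarrow> (real \<Rightarrow>\<^sub>C real) \<times> (real \<Rightarrow>\<^sub>C real)" where
  "split_modes N f = (f - (\<Sum>j<N. coef j f *\<^sub>R P j), \<Sum>j=1..<N. (low_coeff j * coef j f) *\<^sub>R P j)"

text \<open>
  Low modes are inverted explicitly; on the high modes the equation \<open>h - crit A h = f\<close> is kept in the
  fixed point form \<open>h = crit A h + f\<close>, which is a contraction by the assumption on the tail.
\<close>

definition fixmap :: "nat \<Rightarrow> real \<Rightarrow> (real \<Rightarrow>\<^sub>C real) \<times> (real \<Rightarrow>\<^sub>C real) \<Rightarrow> (real \<Rightarrow>\<^sub>C real) \<times> (real \<Rightarrow>\<^sub>C real)" where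
  "fixmap N t u = (crit *\<^sub>R A (fst u), 0) + split_modes N (rhs t u)"

definition modes :: "nat \<Rightarrow> ((real \<Rightarrow>\<^sub>C real) \<times> (real \<Rightarrow>\<^sub>C real)) set" where
  "modes N = {u. (\<forall>j<N. coef j (fst u) = 0) \<and> coef 0 (snd u) = 0}"

lemma linear_split_modes: "bounded_linear (split_modes N)"
proof -
  have *: "bounded_linear (\<lambda>f. (c * coef j f) *\<^sub>R P j)" for c j
    by (intro bounded_linear_compose[OF bounded_linear_scaleR_left]
        bounded_linear_compose[OF bounded_linear_mult_right linear_coef])
  have "bounded_linear (\<lambda>f. coef j f *\<^sub>R P j)" for j using *[of 1 j] by simp
  then show ?thesis
    unfolding split_modes_def
    by (intro bounded_linear_Pair bounded_linear_sub bounded_linear_ident bounded_linear_sum *)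
qed

lemma closed_modes: "closed (modes N)"
proof -
  have "modes N = (\<Inter>j\<in>{..<N}. {u. coef j (fst u) = 0}) \<inter> {u. coef 0 (snd u) = 0}"
    by (auto simp: modes_def)
  moreover have "closed {u :: (real \<Rightarrow>\<^sub>C real) \<times> (real \<Rightarrow>\<^sub>C real). coef j (fst u) = 0}"
    and "closed {u :: (real \<Rightarrow>\<^sub>C real) \<times> (real \<Rightarrow>\<^sub>C real). coef j (snd u) = 0}" for j
    by (intro closed_Collect_eq bounded_linear.continuous_on[OF linear_coef] continuous_intros)+
  ultimately show ?thesis by (simp only:) (intro closed_Int closed_INT ballI)
qed

lemma coef_low_sum: "coef i (\<Sum>j\<in>J. c j *\<^sub>R P j) = (if i \<in> J then c i else 0)" if "finite J"
  using that by (simp add: coef_sum coef_simps dual if_distrib[of "\<lambda>x. _ * x"] cong: if_cong)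

lemma fixmap_modes:
  assumes "u \<in> modes N"
  shows "fixmap N t u \<in> modes N"
  using assms by (auto simp: modes_def fixmap_def split_modes_def coef_simps adjoint coef_low_sum)

lemma fixed_point_equation:
  assumes u: "u \<in> modes N" and N: "N > k" and fp: "fixmap N t u = u"
  shows "pert u - crit *\<^sub>R A (pert u) - (par u * \<alpha> k) *\<^sub>R P k = rhs t u"
proof -
  define f where "f = rhs t u"
  have "0 < N" using N by simp
  then have f0: "coef 0 f = 0" unfolding f_def using u by (intro rhs_mean) (auto simp: modes_def)
  have h: "fst u = crit *\<^sub>R A (fst u) + (f - (\<Sum>j<N. coef j f *\<^sub>R P j))"
    and p: "snd u = (\<Sum>j=1..<N. (low_coeff j * coef j f) *\<^sub>R P j)"
    using fp by (auto simp: fixmap_def split_modes_def f_def dest: arg_cong[of _ _ fst] arg_cong[of _ _ snd])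
  define q where "q = (\<Sum>j\<in>{1..<N} - {k}. (low_coeff j * coef j f) *\<^sub>R P j)"
  have kN: "k \<in> {1..<N}" using k N by simp
  have par: "par u = low_coeff k * coef k f"
    unfolding par_def p using kN by (simp add: coef_low_sum)
  have z: "pert u = fst u + q"
    unfolding pert_def par q_def by (subst p, subst sum.remove[OF _ kN]) auto
  have "q - crit *\<^sub>R A q = (\<Sum>j\<in>{1..<N} - {k}. coef j f *\<^sub>R P j)"
    unfolding q_def A_sum scaleR_sum_right sum_subtractf[symmetric]
  proof (rule sum.cong[OF refl])
    fix j assume "j \<in> {1..<N} - {k}"
    then have "crit * \<alpha> j \<noteq> 1" using simple[of j] \<alpha>k by (simp add: crit_def)
    then have "low_coeff j * (1 - crit * \<alpha> j) = 1"
      using \<open>j \<in> _\<close> by (simp add: low_coeff_def)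
    moreover have "low_coeff j * coef j f - crit * (low_coeff j * coef j f * \<alpha> j)
        = (low_coeff j * (1 - crit * \<alpha> j)) * coef j f"
      by (simp add: algebra_simps)
    ultimately have "low_coeff j * coef j f - crit * (low_coeff j * coef j f * \<alpha> j) = coef j f"
      by simp
    then show "(low_coeff j * coef j f) *\<^sub>R P j - crit *\<^sub>R A ((low_coeff j * coef j f) *\<^sub>R P j) = coef j f *\<^sub>R P j"
      by (simp add: A_simps eigen flip: scaleR_diff_left)
  qed
  moreover have "- (par u * \<alpha> k) = coef k f" unfolding par using \<alpha>k by (simp add: low_coeff_def)
  moreover have "(\<Sum>j<N. coef j f *\<^sub>R P j) = coef k f *\<^sub>R P k + (\<Sum>j\<in>{1..<N} - {k}. coef j f *\<^sub>R P j)"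
  proof -
    have "{..<N} = insert 0 {1..<N}" using N by auto
    then have "(\<Sum>j<N. coef j f *\<^sub>R P j) = (\<Sum>j=1..<N. coef j f *\<^sub>R P j)" by (simp add: f0)
    then show ?thesis using kN by (simp add: sum.remove)
  qed
  moreover have "fst u - crit *\<^sub>R A (fst u) = f - (\<Sum>j<N. coef j f *\<^sub>R P j)"
    using h by (simp add: algebra_simps)
  ultimately have "(fst u - crit *\<^sub>R A (fst u)) + (q - crit *\<^sub>R A q) + (- (par u * \<alpha> k)) *\<^sub>R P k = f"
    by simp
  moreover have "pert u - crit *\<^sub>R A (pert u) = (fst u - crit *\<^sub>R A (fst u)) + (q - crit *\<^sub>R A q)"
    by (simp add: z A_simps algebra_simps)
  ultimately show ?thesis by (simp only: f_def scaleR_minus_left diff_conv_add_uminus)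
qed

text \<open>
  With \<open>N = nonlin t u\<close> and \<open>\<kappa> A \<eta> = t (potential u)\<close> one has \<open>exp (\<kappa> A \<eta>) = 1 + \<kappa> A \<eta> + t N\<close>. As
  \<open>\<kappa> A \<eta>\<close> has mean zero, the normalizing mean is \<open>1 + t coef 0 N\<close>, and the equation for \<open>pert u\<close>
  multiplied by \<open>t\<close> is the assertion. The relation \<open>crit A P\<^sub>k = P\<^sub>k\<close> removes the term of order zero.
\<close>

lemma gibbs_equation:
  assumes m0: "coef 0 (pert u) = 0"
    and eq: "pert u - crit *\<^sub>R A (pert u) - (par u * \<alpha> k) *\<^sub>R P k = rhs t u"
  defines "\<eta> \<equiv> t *\<^sub>R (P k + pert u)" and "\<kappa> \<equiv> crit + par u"
  shows "compose_bcontfun exp (\<kappa> *\<^sub>R A \<eta>) = coef 0 (compose_bcontfun exp (\<kappa> *\<^sub>R A \<eta>)) *\<^sub>R (P 0 + \<eta>)"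
    and "coef 0 \<eta> = 0"
proof -
  let ?N = "nonlin t u"
  have "crit *\<^sub>R A (P k) = P k" using \<alpha>k by (simp add: eigen crit_def)
  then have "P k + pert u - \<kappa> *\<^sub>R A (P k + pert u)
      = (pert u - crit *\<^sub>R A (pert u) - (par u * \<alpha> k) *\<^sub>R P k) - par u *\<^sub>R A (pert u)"
    by (simp add: \<kappa>_def A_simps eigen algebra_simps)
  also have "\<dots> = ?N - coef 0 ?N *\<^sub>R (P 0 + \<eta>)"
    unfolding eq by (simp add: rhs_def \<eta>_def)
  finally have main: "P k + pert u - potential u = ?N - coef 0 ?N *\<^sub>R (P 0 + \<eta>)"
    by (simp add: potential_def \<kappa>_def)
  have tf: "\<kappa> *\<^sub>R A \<eta> = t *\<^sub>R potential u" by (simp add: \<eta>_def potential_def \<kappa>_def A_simps mult.commute)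
  have E: "compose_bcontfun exp (\<kappa> *\<^sub>R A \<eta>) = P 0 + t *\<^sub>R potential u + t *\<^sub>R ?N"
  proof (rule bcontfun_eqI)
    fix s
    have "exp (t * x) = 1 + t * x + t * exp_remainder t x" for x :: real
      by (cases "t = 0") (simp_all add: exp_remainder_def)
    then show "apply_bcontfun (compose_bcontfun exp (\<kappa> *\<^sub>R A \<eta>)) s
        = apply_bcontfun (P 0 + t *\<^sub>R potential u + t *\<^sub>R ?N) s"
      by (simp add: tf apply_compose_bcontfun exp_remainder_continuous continuous_intros const nonlin_def)
  qed
  show \<eta>0: "coef 0 \<eta> = 0" using m0 k by (simp add: \<eta>_def coef_simps dual)
  have "coef 0 (potential u) = 0" using m0 k by (simp add: potential_def coef_simps adjoint dual)
  then have E0: "coef 0 (compose_bcontfun exp (\<kappa> *\<^sub>R A \<eta>)) = 1 + t * coef 0 ?N"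
    unfolding E by (simp add: coef_simps dual)
  have "t *\<^sub>R potential u + t *\<^sub>R ?N = t *\<^sub>R (P k + pert u) + (t * coef 0 ?N) *\<^sub>R (P 0 + \<eta>)"
  proof -
    have "potential u + ?N = (P k + pert u) + coef 0 ?N *\<^sub>R (P 0 + \<eta>)"
      using main by (simp add: algebra_simps)
    then have "t *\<^sub>R (potential u + ?N) = t *\<^sub>R ((P k + pert u) + coef 0 ?N *\<^sub>R (P 0 + \<eta>))" by simp
    then show ?thesis by (simp add: scaleR_add_right)
  qed
  then have "compose_bcontfun exp (\<kappa> *\<^sub>R A \<eta>) = (1 + t * coef 0 ?N) *\<^sub>R (P 0 + \<eta>)"
    unfolding E \<eta>_def[symmetric] by (simp add: algebra_simps)
  then show "compose_bcontfun exp (\<kappa> *\<^sub>R A \<eta>) = coef 0 (compose_bcontfun exp (\<kappa> *\<^sub>R A \<eta>)) *\<^sub>R (P 0 + \<eta>)"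
    unfolding E0 .
qed

text \<open>
  Bifurcation from the simple eigenvalue: \<open>z\<close> and \<open>m\<close> are read off from the fixed points of
  \<open>fixmap\<close>. The linear part on the high modes contributes \<open>1/2\<close> to the contraction constant and the
  right-hand side contributes \<open>1/4\<close>.
\<close>

lemma branch:
  obtains d z m where "d > 0" "continuous_on {-d<..<d} z" "continuous_on {-d<..<d} m"
    "z 0 = 0" "m 0 = 0"
    "\<And>t. \<bar>t\<bar> < d \<Longrightarrow> crit + m t > 0 \<and> coef 0 (t *\<^sub>R (P k + z t)) = 0 \<and>
       compose_bcontfun exp ((crit + m t) *\<^sub>R A (t *\<^sub>R (P k + z t)))
       = coef 0 (compose_bcontfun exp ((crit + m t) *\<^sub>R A (t *\<^sub>R (P k + z t)))) *\<^sub>R (P 0 + t *\<^sub>R (P k + z t))"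
proof -
  have crit: "crit > 0" using \<alpha>k by (simp add: crit_def)
  then have "1 / (2 * crit) > 0" by simp
  from tail[OF this] obtain N0 where N0: "\<And>h. (\<forall>j<N0. coef j h = 0) \<Longrightarrow> norm (A h) \<le> 1 / (2 * crit) * norm h"
    by blast
  define N where "N = max N0 (k + 1)"
  have N: "N > k" "N0 \<le> N" by (auto simp: N_def)
  obtain L where L: "L \<ge> 0"
    "\<And>t r u u'. \<bar>t\<bar> \<le> 1 \<Longrightarrow> norm u \<le> r \<Longrightarrow> norm u' \<le> r \<Longrightarrow> r \<le> 1 \<Longrightarrow>
       norm (rhs t u - rhs t u') \<le> L * (\<bar>t\<bar> + r) * norm (u - u')"
    "\<And>t. \<bar>t\<bar> \<le> 1 \<Longrightarrow> norm (rhs t 0) \<le> L * \<bar>t\<bar>"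
    by (rule rhs_estimates) blast
  obtain R where R: "R > 0" "\<And>f. norm (split_modes N f) \<le> norm f * R"
    using bounded_linear.pos_bounded[OF linear_split_modes] by blast
  define K where "K = R * L"
  define r where "r = 1 / (8 * K + 1)"
  have K: "K \<ge> 0" using R L by (simp add: K_def)
  have RL: "R * L \<ge> 0" using K by (simp add: K_def)
  have r: "r > 0" "r \<le> 1" "K * r \<le> 1 / 8"
    using K by (auto simp: r_def divide_simps)
  obtain C where C: "C > 0" "\<And>u. \<bar>par u\<bar> \<le> norm u * C"
    using bounded_linear.pos_bounded[OF linear_par] by auto
  \<comment> \<open>The second bound on the radius keeps the parameter \<open>crit + par u\<close> positive.\<close>
  define r' where "r' = min r (crit / (2 * C))"
  define d' where "d' = r' / (4 * (R * L + 1))"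
  have r': "r' > 0" "r' \<le> r" "C * r' < crit"
  proof -
    show "r' > 0" "r' \<le> r" using r C crit by (auto simp: r'_def)
    have "C * r' \<le> C * (crit / (2 * C))" using C by (intro mult_left_mono) (auto simp: r'_def)
    also have "\<dots> < crit" using C crit by simp
    finally show "C * r' < crit" .
  qed
  have d': "d' > 0" "R * L * d' \<le> r' / 4" "d' \<le> r" "d' \<le> 1"
  proof -
    show d0: "d' > 0" using r' RL by (auto simp: d'_def intro!: divide_pos_pos)
    have "d' * (4 * (R * L + 1)) = r'" using RL by (simp add: d'_def)
    then have eq: "R * L * d' + d' = r' / 4" by (simp add: algebra_simps)
    moreover have "0 \<le> R * L * d'" using RL d0 by simp
    ultimately show "R * L * d' \<le> r' / 4" "d' \<le> r" "d' \<le> 1"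
      using r r' d0 by linarith+
  qed
  obtain u where u: "continuous_on {-d'<..<d'} u" "u 0 = 0"
    "\<And>t. \<bar>t\<bar> < d' \<Longrightarrow> u t \<in> modes N \<and> norm (u t) \<le> r' \<and> fixmap N t (u t) = u t"
  proof (rule uniform_contraction[of "modes N" r' d' "3 / 4" "fixmap N"])
    show "closed (modes N)" by (rule closed_modes)
    show "0 \<in> modes N" by (simp add: modes_def coef_simps)
    show "fixmap N t u \<in> modes N" if "u \<in> modes N" for t u using that by (rule fixmap_modes)
    show "norm (fixmap N t u - fixmap N t u') \<le> 3 / 4 * norm (u - u')"
      if t: "\<bar>t\<bar> < d'" and u: "u \<in> modes N" "norm u \<le> r'" "u' \<in> modes N" "norm u' \<le> r'" for t u u'
    proof -
      have "fixmap N t u - fixmap N t u'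
          = (crit *\<^sub>R A (fst (u - u')), 0) + split_modes N (rhs t u - rhs t u')"
        by (simp add: fixmap_def linear_simps[OF linear_split_modes] A_simps algebra_simps)
      also have "norm \<dots> \<le> norm (crit *\<^sub>R A (fst (u - u')), 0 :: real \<Rightarrow>\<^sub>C real) + norm (split_modes N (rhs t u - rhs t u'))"
        by (rule norm_triangle_ineq)
      also have "norm (crit *\<^sub>R A (fst (u - u')), 0 :: real \<Rightarrow>\<^sub>C real) \<le> 1 / 2 * norm (u - u')"
      proof -
        have "\<forall>j<N0. coef j (fst (u - u')) = 0"
          using u N by (auto simp: modes_def coef_simps)
        from N0[OF this] have "crit * norm (A (fst (u - u'))) \<le> crit * (1 / (2 * crit) * norm (fst (u - u')))"
          using crit by (intro mult_left_mono) auto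
        also have "\<dots> = 1 / 2 * norm (fst (u - u'))" using crit by simp
        also have "\<dots> \<le> 1 / 2 * norm (u - u')" using norm_fst_le[of "fst (u - u')" "snd (u - u')"] by (simp only: prod.collapse)
        finally show ?thesis using crit by (simp add: norm_Pair)
      qed
      also have "norm (split_modes N (rhs t u - rhs t u')) \<le> 1 / 4 * norm (u - u')"
      proof -
        have "norm (rhs t u - rhs t u') \<le> L * (\<bar>t\<bar> + r) * norm (u - u')"
          using t u d' r r' by (intro L(2)) auto
        also have "\<dots> \<le> L * (r + r) * norm (u - u')"
          using t d' L(1) by (intro mult_right_mono mult_left_mono) auto
        finally have "norm (rhs t u - rhs t u') * R \<le> L * (r + r) * norm (u - u') * R"
          using R by (intro mult_right_mono) auto
        also have "\<dots> = (2 * (K * r)) * norm (u - u')" by (simp add: K_def algebra_simps)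
        also have "\<dots> \<le> 1 / 4 * norm (u - u')" using r by (intro mult_right_mono) auto
        finally show ?thesis using R(2) order_trans by blast
      qed
      finally show ?thesis by simp
    qed
    show "norm (fixmap N t 0) \<le> (1 - 3 / 4) * r'" if t: "\<bar>t\<bar> < d'" for t
    proof -
      have "fixmap N t 0 = split_modes N (rhs t 0)" by (simp add: fixmap_def A_simps zero_prod_def[symmetric])
      then have "norm (fixmap N t 0) \<le> norm (rhs t 0) * R" using R(2) by simp
      also have "\<dots> \<le> (L * \<bar>t\<bar>) * R" using L(3)[of t] t d' R by (intro mult_right_mono) auto
      also have "\<dots> = (R * L) * \<bar>t\<bar>" by simp
      also have "\<dots> \<le> (R * L) * d'" using t RL by (intro mult_left_mono) auto
      finally have "norm (fixmap N t 0) \<le> R * L * d'" .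
      then show ?thesis using d'(2) by simp
    qed
    show "continuous_on {-d'<..<d'} (\<lambda>t. fixmap N t u)" for u
      unfolding fixmap_def
      by (intro continuous_intros bounded_linear.continuous_on[OF linear_split_modes] rhs_continuous)
    show "fixmap N 0 0 = 0"
      using L(3)[of 0] by (simp add: fixmap_def A_simps linear_simps[OF linear_split_modes] zero_prod_def[symmetric])
  qed (use r' d' in auto)
  show ?thesis
  proof (rule that[of d' "\<lambda>t. pert (u t)" "\<lambda>t. par (u t)"])
    show "d' > 0" by (rule d')
    show "continuous_on {-d'<..<d'} (\<lambda>t. pert (u t))" "continuous_on {-d'<..<d'} (\<lambda>t. par (u t))"
      by (rule bounded_linear.continuous_on[OF linear_pert u(1)] bounded_linear.continuous_on[OF linear_par u(1)])+
    show "pert (u 0) = 0" "par (u 0) = 0" by (simp_all add: u(2) pert_simps par_simps)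
    fix t assume t: "\<bar>t\<bar> < d'"
    have ut: "u t \<in> modes N" "norm (u t) \<le> r'" "fixmap N t (u t) = u t" using u(3)[OF t] by auto
    have "\<bar>par (u t)\<bar> \<le> r' * C" using C(2)[of "u t"] mult_right_mono[OF ut(2), of C] C(1) by linarith
    then have pos: "crit + par (u t) > 0" using r'(3) by (simp add: mult.commute)
    have m0: "coef 0 (pert (u t)) = 0" using ut(1) N by (intro rhs_mean) (auto simp: modes_def)
    note g = gibbs_equation[OF m0 fixed_point_equation[OF ut(1) N(1) ut(3)]]
    show "crit + par (u t) > 0 \<and> coef 0 (t *\<^sub>R (P k + pert (u t))) = 0 \<and>
       compose_bcontfun exp ((crit + par (u t)) *\<^sub>R A (t *\<^sub>R (P k + pert (u t))))
       = coef 0 (compose_bcontfun exp ((crit + par (u t)) *\<^sub>R A (t *\<^sub>R (P k + pert (u t))))) *\<^sub>R (P 0 + t *\<^sub>R (P k + pert (u t)))"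
      using pos g by blast
  qed
qed

end

section \<open>Zonal profiles as bounded continuous functions\<close>

text \<open>
  A zonal function is given by its profile on \<open>[-1, 1]\<close>. Extending profiles constantly beyond the
  endpoints places them in the complete space of bounded continuous functions on the line.
\<close>

definition clamp_unit :: "real \<Rightarrow> real" where
  "clamp_unit s = max (-1) (min 1 s)"

definition clamp_bcontfun :: "(real \<Rightarrow> real) \<Rightarrow> (real \<Rightarrow>\<^sub>C real)" where
  "clamp_bcontfun f = Bcontfun (\<lambda>s. f (clamp_unit s))"

lemma clamp_unit_abs: "\<bar>clamp_unit s\<bar> \<le> 1"
  by (auto simp: clamp_unit_def max_def min_def)

lemma clamp_unit_id: "\<bar>s\<bar> \<le> 1 \<Longrightarrow> clamp_unit s = s"
  by (auto simp: clamp_unit_def max_def min_def)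

lemma apply_clamp_bcontfun:
  assumes "continuous_on UNIV f"
  shows "apply_bcontfun (clamp_bcontfun f) s = f (clamp_unit s)"
proof -
  obtain B where B: "\<And>x. \<bar>x\<bar> \<le> 1 \<Longrightarrow> \<bar>f x\<bar> \<le> B"
    using bounded_on_interval[OF assms] by blast
  have "(\<lambda>s. f (clamp_unit s)) \<in> bcontfun"
  proof (rule bcontfun_normI)
    show "continuous_on UNIV (\<lambda>s. f (clamp_unit s))"
      unfolding clamp_unit_def by (rule continuous_on_compose2[OF assms]) (auto intro!: continuous_intros)
    show "norm (f (clamp_unit s)) \<le> B" for s using B[OF clamp_unit_abs] by simp
  qed
  then show ?thesis by (simp add: clamp_bcontfun_def Bcontfun_inverse)
qed

definition zonal_op :: "'n::finite \<Rightarrow> 'n \<Rightarrow> real \<Rightarrow> (real \<Rightarrow>\<^sub>C real) \<Rightarrow> (real \<Rightarrow>\<^sub>C real)" where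
  "zonal_op i j \<beta> g = clamp_bcontfun (zonal_conv i j (\<lambda>x. exp (\<beta> * x)) (apply_bcontfun g))"

definition gegenbauer_mode :: "real \<Rightarrow> nat \<Rightarrow> (real \<Rightarrow>\<^sub>C real)" where
  "gegenbauer_mode l m = clamp_bcontfun (gegenbauer m l)"

definition gegenbauer_coeff :: "'n::finite \<Rightarrow> real \<Rightarrow> nat \<Rightarrow> (real \<Rightarrow>\<^sub>C real) \<Rightarrow> real" where
  "gegenbauer_coeff i l m f =
     sphere_mean (\<lambda>x::real^'n. apply_bcontfun f (x $ i) * gegenbauer m l (x $ i))
       / sphere_mean (\<lambda>x::real^'n. (gegenbauer m l (x $ i))\<^sup>2)"

lemma apply_zonal_op:
  "apply_bcontfun (zonal_op i j \<beta> g) s = zonal_conv i j (\<lambda>x. exp (\<beta> * x)) (apply_bcontfun g) (clamp_unit s)"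
  unfolding zonal_op_def
  by (rule apply_clamp_bcontfun, rule zonal_conv_continuous) (auto intro!: continuous_intros)

lemma apply_gegenbauer_mode: "apply_bcontfun (gegenbauer_mode l m) s = gegenbauer m l (clamp_unit s)"
  unfolding gegenbauer_mode_def by (rule apply_clamp_bcontfun) (rule continuous_on_gegenbauer)

lemma continuous_on_profile:
  "continuous_on S (\<lambda>x::real^'n::finite. apply_bcontfun f (x $ i) :: real)"
  by (rule continuous_on_coord) simp

lemma continuous_on_gegenbauer_coord:
  "continuous_on S (\<lambda>x::real^'n::finite. gegenbauer m l (x $ i))"
  by (rule continuous_on_coord) (rule continuous_on_gegenbauer)

lemma zonal_op_sphere:
  fixes x :: "real^'n::finite"
  assumes "norm x = 1"
  shows "apply_bcontfun (zonal_op i j \<beta> g) (x $ i) = zonal_conv i j (\<lambda>x. exp (\<beta> * x)) (apply_bcontfun g) (x $ i)"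
  by (simp add: apply_zonal_op clamp_unit_id abs_coord_le_1 assms)

lemma gegenbauer_mode_sphere:
  fixes x :: "real^'n::finite"
  assumes "norm x = 1"
  shows "apply_bcontfun (gegenbauer_mode l m) (x $ i) = gegenbauer m l (x $ i)"
  by (simp add: apply_gegenbauer_mode clamp_unit_id abs_coord_le_1 assms)

lemma bounded_linear_zonal_op:
  fixes i j :: "'n::finite"
  assumes ij: "i \<noteq> j" and \<beta>: "\<beta> \<ge> 0"
  shows "bounded_linear (zonal_op i j \<beta>)"
proof -
  let ?k = "\<lambda>c y::real^'n. exp (\<beta> * (c * y $ i + sqrt (1 - c\<^sup>2) * y $ j))"
  have cont: "continuous_on S (\<lambda>y::real^'n. ?k c y * apply_bcontfun g (y $ i))" for S c g
    by (intro continuous_intros continuous_on_profile)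
  show ?thesis
  proof (rule bounded_linear_intro)
    show "zonal_op i j \<beta> (f + g) = zonal_op i j \<beta> f + zonal_op i j \<beta> g" for f g
      by (rule bcontfun_eqI)
         (simp add: apply_zonal_op zonal_conv_def distrib_left[of "exp _"] sphere_mean_add[OF cont cont])
    show "zonal_op i j \<beta> (r *\<^sub>R f) = r *\<^sub>R zonal_op i j \<beta> f" for r f
      by (rule bcontfun_eqI)
         (simp add: apply_zonal_op zonal_conv_def mult.left_commute[of _ r])
    show "norm (zonal_op i j \<beta> f) \<le> norm f * exp \<beta>" for f
    proof (rule norm_bound)
      fix s
      have "\<bar>zonal_conv i j (\<lambda>x. exp (\<beta> * x)) (apply_bcontfun f) (clamp_unit s)\<bar> \<le> norm f * exp \<beta>"
        unfolding zonal_conv_def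
      proof (rule sphere_mean_abs_le)
        fix y :: "real^'n" assume y: "norm y = 1"
        let ?\<theta> = "clamp_unit s * y $ i + sqrt (1 - (clamp_unit s)\<^sup>2) * y $ j"
        have "\<bar>?\<theta>\<bar> \<le> 1" by (rule abs_inner_parallel_le_1[OF ij clamp_unit_abs y])
        then have "\<beta> * ?\<theta> \<le> \<beta>" using \<beta> mult_left_mono[of ?\<theta> 1 \<beta>] by simp
        then have "exp (\<beta> * ?\<theta>) * \<bar>apply_bcontfun f (y $ i)\<bar> \<le> exp \<beta> * norm f"
          using norm_bounded[of f "y $ i"] by (intro mult_mono) auto
        then show "\<bar>exp (\<beta> * ?\<theta>) * apply_bcontfun f (y $ i)\<bar> \<le> norm f * exp \<beta>"
          by (simp add: abs_mult mult.commute)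
      qed (rule cont)
      then show "norm (apply_bcontfun (zonal_op i j \<beta> f) s) \<le> norm f * exp \<beta>"
        by (simp add: apply_zonal_op)
    qed
  qed
qed

lemma bounded_linear_gegenbauer_coeff:
  fixes i :: "'n::finite"
  shows "bounded_linear (gegenbauer_coeff i l m)"
proof -
  have cont: "continuous_on S (\<lambda>x::real^'n. apply_bcontfun f (x $ i) * gegenbauer m l (x $ i))" for S f
    by (intro continuous_intros continuous_on_profile continuous_on_gegenbauer_coord)
  obtain B where B: "B \<ge> 0" "\<And>x. \<bar>x\<bar> \<le> 1 \<Longrightarrow> \<bar>gegenbauer m l x\<bar> \<le> B"
    using bounded_on_interval[OF continuous_on_gegenbauer] by blast
  have "bounded_linear (\<lambda>f. sphere_mean (\<lambda>x::real^'n. apply_bcontfun f (x $ i) * gegenbauer m l (x $ i)))"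
  proof (rule bounded_linear_intro)
    fix f g :: "real \<Rightarrow>\<^sub>C real" and r :: real
    show "sphere_mean (\<lambda>x::real^'n. apply_bcontfun (f + g) (x $ i) * gegenbauer m l (x $ i)) =
      sphere_mean (\<lambda>x::real^'n. apply_bcontfun f (x $ i) * gegenbauer m l (x $ i))
      + sphere_mean (\<lambda>x::real^'n. apply_bcontfun g (x $ i) * gegenbauer m l (x $ i))"
      by (simp add: distrib_right sphere_mean_add[OF cont cont])
    show "sphere_mean (\<lambda>x::real^'n. apply_bcontfun (r *\<^sub>R f) (x $ i) * gegenbauer m l (x $ i)) =
      r *\<^sub>R sphere_mean (\<lambda>x::real^'n. apply_bcontfun f (x $ i) * gegenbauer m l (x $ i))"
      by (simp add: mult.assoc)
    have "\<bar>sphere_mean (\<lambda>x::real^'n. apply_bcontfun f (x $ i) * gegenbauer m l (x $ i))\<bar> \<le> norm f * B"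
    proof (rule sphere_mean_abs_le[OF cont])
      fix x :: "real^'n" assume "norm x = 1"
      then show "\<bar>apply_bcontfun f (x $ i) * gegenbauer m l (x $ i)\<bar> \<le> norm f * B"
        unfolding abs_mult using norm_bounded[of f "x $ i"] by (intro mult_mono B(2) abs_coord_le_1) auto
    qed
    then show "norm (sphere_mean (\<lambda>x::real^'n. apply_bcontfun f (x $ i) * gegenbauer m l (x $ i))) \<le> norm f * B"
      by simp
  qed
  then show ?thesis
    unfolding gegenbauer_coeff_def divide_inverse
    by (rule bounded_linear_compose[OF bounded_linear_mult_left])
qed

lemma diagonal_zonal_op:
  fixes i j :: "'n::finite"
  assumes ij: "i \<noteq> j" and n: "CARD('n) \<ge> 3" and \<beta>: "\<beta> > 0"
  defines "l \<equiv> (real CARD('n) - 2) / 2"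
  shows "diagonal_operator (zonal_op i j \<beta>) (gegenbauer_mode l) (gegenbauer_coeff i l) (funk_hecke CARD('n) \<beta>)"
proof (rule diagonal_operator.intro)
  have l: "l > 0" and n2: "CARD('n) \<ge> 2" using n by (auto simp: l_def)
  show "bounded_linear (zonal_op i j \<beta>)" using ij \<beta> by (intro bounded_linear_zonal_op) auto
  show "bounded_linear (gegenbauer_coeff i l m)" for m by (rule bounded_linear_gegenbauer_coeff)
  show "gegenbauer_coeff i l m (gegenbauer_mode l m') = (if m = m' then 1 else 0)" for m m'
  proof -
    have "sphere_mean (\<lambda>x::real^'n. apply_bcontfun (gegenbauer_mode l m') (x $ i) * gegenbauer m l (x $ i))
        = sphere_mean (\<lambda>x::real^'n. gegenbauer m' l (x $ i) * gegenbauer m l (x $ i))"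
      by (rule sphere_mean_cong) (simp add: gegenbauer_mode_sphere)
    then show ?thesis
      using gegenbauer_norm_pos[OF l, where i = i and m = m]
        gegenbauer_orthogonal[OF n2, where m = m' and m' = m and i = i]
      by (auto simp: gegenbauer_coeff_def l_def power2_eq_square)
  qed
  show "zonal_op i j \<beta> (gegenbauer_mode l m) = funk_hecke CARD('n) \<beta> m *\<^sub>R gegenbauer_mode l m" for m
  proof (rule bcontfun_eqI)
    fix s
    have "zonal_conv i j (\<lambda>x. exp (\<beta> * x)) (apply_bcontfun (gegenbauer_mode l m)) c
        = zonal_conv i j (\<lambda>x. exp (\<beta> * x)) (gegenbauer m l) c" for c
      unfolding zonal_conv_def by (rule sphere_mean_cong) (simp add: gegenbauer_mode_sphere)
    then show "apply_bcontfun (zonal_op i j \<beta> (gegenbauer_mode l m)) s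
        = apply_bcontfun (funk_hecke CARD('n) \<beta> m *\<^sub>R gegenbauer_mode l m) s"
      using zonal_conv_gegenbauer[OF ij n2 clamp_unit_abs, of \<beta> m s]
      by (simp add: apply_zonal_op apply_gegenbauer_mode l_def)
  qed
  show "gegenbauer_coeff i l m (zonal_op i j \<beta> f) = funk_hecke CARD('n) \<beta> m * gegenbauer_coeff i l m f" for m f
  proof -
    let ?\<phi> = "\<lambda>x. exp (\<beta> * x)"
    have "sphere_mean (\<lambda>x::real^'n. apply_bcontfun (zonal_op i j \<beta> f) (x $ i) * gegenbauer m l (x $ i))
        = sphere_mean (\<lambda>x::real^'n. zonal_conv i j ?\<phi> (apply_bcontfun f) (x $ i) * gegenbauer m l (x $ i))"
      by (rule sphere_mean_cong) (simp add: zonal_op_sphere)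
    also have "\<dots> = sphere_mean (\<lambda>x::real^'n. apply_bcontfun f (x $ i) * zonal_conv i j ?\<phi> (gegenbauer m l) (x $ i))"
      by (rule zonal_conv_selfadjoint[OF ij]) (auto intro!: continuous_intros)
    also have "\<dots> = sphere_mean (\<lambda>x::real^'n. funk_hecke CARD('n) \<beta> m * (apply_bcontfun f (x $ i) * gegenbauer m l (x $ i)))"
      by (rule sphere_mean_cong)
         (simp add: zonal_conv_gegenbauer[OF ij n2 abs_coord_le_1] l_def)
    finally show ?thesis by (simp add: gegenbauer_coeff_def)
  qed
  show "\<exists>N. \<forall>h. (\<forall>m<N. gegenbauer_coeff i l m h = 0) \<longrightarrow> norm (zonal_op i j \<beta> h) \<le> e * norm h" if e: "e > 0" for e
  proof -
    have "\<forall>\<^sub>F N in sequentially. exp \<beta> * \<beta> ^ N / fact N < e \<and> N > 0"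
      using order_tendstoD(2)[OF exp_taylor_bound_tendsto_0 e] eventually_gt_at_top
      by (rule eventually_conj)
    then obtain N where N: "exp \<beta> * \<beta> ^ N / fact N < e" "N > 0"
      by (auto simp: eventually_sequentially)
    show ?thesis
    proof (intro exI[of _ N] allI impI)
      fix h assume h: "\<forall>m<N. gegenbauer_coeff i l m h = 0"
      have orth: "sphere_mean (\<lambda>x::real^'n. apply_bcontfun h (x $ i) * gegenbauer m l (x $ i)) = 0" if "m < N" for m
        using h that gegenbauer_norm_pos[OF l, where i = i and m = m] by (auto simp: gegenbauer_coeff_def)
      show "norm (zonal_op i j \<beta> h) \<le> e * norm h"
      proof (rule norm_bound)
        fix s
        have hb: "\<bar>apply_bcontfun h c\<bar> \<le> norm h" for c using norm_bounded[of h c] by simp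
        have "\<bar>zonal_conv i j (\<lambda>x. exp (\<beta> * x)) (apply_bcontfun h) (clamp_unit s)\<bar>
            \<le> exp \<beta> * \<beta> ^ N / fact N * norm h"
          by (rule zonal_conv_small[OF ij l _ N(2) orth hb clamp_unit_abs]) (use \<beta> in auto)
        also have "\<dots> \<le> e * norm h" using N(1) by (intro mult_right_mono) auto
        finally show "norm (apply_bcontfun (zonal_op i j \<beta> h) s) \<le> e * norm h"
          by (simp add: apply_zonal_op)
      qed
    qed
  qed
  show "gegenbauer_mode l 0 = const_bcontfun 1"
    by (rule bcontfun_eqI) (simp add: apply_gegenbauer_mode)
qed

section \<open>The Gibbs map on zonal densities\<close>

lemma integral_eq_sphere_mean:
  "(\<integral>x. f x \<partial>surface_measure) = sphere_area TYPE('n::finite) * sphere_mean (f :: real^'n \<Rightarrow> real)"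
  using sphere_area_pos[where 'n='n] by (simp add: sphere_mean_def)

text \<open>
  The constant part of the density contributes the constant \<open>funk_hecke CARD('n) \<beta> 0\<close> to the
  potential, and the corresponding factor cancels between the Gibbs weight and the partition
  function.
\<close>

lemma gibbs_map_zonal_zero:
  fixes i j :: "'n::finite" and x :: "real^'n"
  assumes ij: "i \<noteq> j" and n: "CARD('n) \<ge> 2" and \<beta>: "\<beta> > 0" and x: "norm x = 1"
    and eq: "\<And>s. exp (\<kappa> * apply_bcontfun (zonal_op i j \<beta> \<eta>) s)
      = sphere_mean (\<lambda>x::real^'n. exp (\<kappa> * apply_bcontfun (zonal_op i j \<beta> \<eta>) (x $ i))) * (1 + apply_bcontfun \<eta> s)"
    and \<rho>: "\<And>y. norm y = 1 \<Longrightarrow> \<rho> y = (1 + apply_bcontfun \<eta> (y $ i)) / sphere_area TYPE('n)"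
  shows "gibbs_map (exp_kernel \<beta>) \<rho> (\<beta> * \<kappa>) x = 0"
proof -
  let ?w = "sphere_area TYPE('n)" and ?a = "funk_hecke CARD('n) \<beta> 0"
  let ?A = "apply_bcontfun (zonal_op i j \<beta> \<eta>)"
  let ?\<phi> = "\<lambda>x::real. exp (\<beta> * x)"
  have w: "?w > 0" by (rule sphere_area_pos)
  have cphi: "continuous_on UNIV ?\<phi>" by (intro continuous_intros)
  have inter: "interaction (exp_kernel \<beta>) \<rho> x = - (1 / \<beta>) * (?a + ?A (x $ i))" if x: "norm x = 1" for x
  proof -
    have one: "sphere_mean (\<lambda>y. exp (\<beta> * (x \<bullet> y))) = ?a"
    proof -
      have "sphere_mean (\<lambda>y. ?\<phi> (x \<bullet> y) * gegenbauer 0 ((real CARD('n) - 2) / 2) (y $ i))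
          = zonal_conv i j ?\<phi> (gegenbauer 0 ((real CARD('n) - 2) / 2)) (x $ i)"
        by (rule zonal_conv_eq[OF ij x cphi continuous_on_gegenbauer])
      then show ?thesis
        by (simp add: zonal_conv_gegenbauer[OF ij n abs_coord_le_1[OF x]] del: gegenbauer.simps)
           simp
    qed
    have eta: "sphere_mean (\<lambda>y. exp (\<beta> * (x \<bullet> y)) * apply_bcontfun \<eta> (y $ i)) = ?A (x $ i)"
      using zonal_conv_eq[OF ij x cphi, of "apply_bcontfun \<eta>"] by (simp add: zonal_op_sphere[OF x])
    have "exp_kernel \<beta> x y * \<rho> y
        = (- (1 / \<beta>) / ?w) * (exp (\<beta> * (x \<bullet> y)) + exp (\<beta> * (x \<bullet> y)) * apply_bcontfun \<eta> (y $ i))"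
      if "norm y = 1" for y
      by (simp add: exp_kernel_def \<rho>[OF that] add_divide_distrib distrib_left)
    then have "interaction (exp_kernel \<beta>) \<rho> x = ?w * ((- (1 / \<beta>) / ?w) *
        sphere_mean (\<lambda>y. exp (\<beta> * (x \<bullet> y)) + exp (\<beta> * (x \<bullet> y)) * apply_bcontfun \<eta> (y $ i)))"
      unfolding interaction_def integral_eq_sphere_mean sphere_mean_cmult[symmetric]
      by (intro arg_cong[where f = "(*) ?w"] sphere_mean_cong)
    also have "sphere_mean (\<lambda>y. exp (\<beta> * (x \<bullet> y)) + exp (\<beta> * (x \<bullet> y)) * apply_bcontfun \<eta> (y $ i)) = ?a + ?A (x $ i)"
      unfolding one[symmetric] eta[symmetric]
      by (rule sphere_mean_add) (intro continuous_intros continuous_on_profile)+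
    finally show ?thesis using w by simp
  qed
  have expo: "exp (- (\<beta> * \<kappa>) * interaction (exp_kernel \<beta>) \<rho> x) = exp (\<kappa> * ?a) * exp (\<kappa> * ?A (x $ i))"
    if "norm x = 1" for x
    using \<beta> by (simp add: inter[OF that] exp_add[symmetric] algebra_simps)
  define E where "E = sphere_mean (\<lambda>x::real^'n. exp (\<kappa> * ?A (x $ i)))"
  have "partition_function (exp_kernel \<beta>) (\<beta> * \<kappa>) \<rho>
      = ?w * sphere_mean (\<lambda>x. exp (\<kappa> * ?a) * exp (\<kappa> * ?A (x $ i)))"
    unfolding partition_function_def integral_eq_sphere_mean
    by (rule arg_cong[where f = "(*) ?w"], rule sphere_mean_cong) (rule expo)
  then have Z: "partition_function (exp_kernel \<beta>) (\<beta> * \<kappa>) \<rho> = ?w * (exp (\<kappa> * ?a) * E)"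
    by (simp add: E_def)
  have E: "exp (\<kappa> * ?A (x $ i)) = E * (1 + apply_bcontfun \<eta> (x $ i))"
    using eq[of "x $ i"] by (simp add: E_def)
  then have "E \<noteq> 0" by (metis exp_not_eq_zero mult_zero_left)
  then show ?thesis
    unfolding gibbs_map_def Z expo[OF x] E \<rho>[OF x] using w by simp
qed

text \<open>
  The normalizing constant is \<open>1 / sqrt E\<close> with \<open>E\<close> the mean square of the Gegenbauer polynomial.
\<close>

lemma zonal_const_pos:
  fixes i :: "'n::finite"
  assumes n: "CARD('n) \<ge> 3"
  shows "zonal_const i k > 0"
proof -
  let ?l = "(real CARD('n) - 2) / 2"
  define E where "E = sphere_mean (\<lambda>x::real^'n. (gegenbauer k ?l (x $ i))\<^sup>2)"
  have E: "E > 0" unfolding E_def by (rule gegenbauer_norm_pos) (use n in simp)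
  have norm: "1 / sphere_area TYPE('n) * (\<integral>x. (A * zonal_gegenbauer i k x)\<^sup>2 \<partial>(surface_measure :: (real^'n) measure)) = A\<^sup>2 * E" for A
    using sphere_area_pos[where 'n='n]
    by (simp add: integral_eq_sphere_mean zonal_gegenbauer_def power_mult_distrib E_def)
  have "zonal_const i k = 1 / sqrt E"
    unfolding zonal_const_def norm
  proof (rule the_equality)
    show "1 / sqrt E > 0 \<and> (1 / sqrt E)\<^sup>2 * E = 1" using E by (simp add: power_divide)
    fix A :: real assume A: "A > 0 \<and> A\<^sup>2 * E = 1"
    have "A * sqrt E = sqrt (A\<^sup>2 * E)" unfolding real_sqrt_mult using A by simp
    also have "\<dots> = 1" using A by simp
    finally show "A = 1 / sqrt E" using E by (simp add: eq_divide_eq)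
  qed
  then show ?thesis using E by simp
qed

text \<open>
  With \<open>l = (n - 2) / 2\<close> the factors \<open>2\<^sup>l (\<beta> / 2)\<^sup>l\<close> combine to \<open>\<beta>\<^sup>l\<close>, and \<open>sqrt (\<beta>\<^sup>n) = \<beta> \<beta>\<^sup>l\<close>.
\<close>

lemma critical_parameter:
  assumes \<beta>: "\<beta> > 0" and n: "n \<ge> 2"
  shows "sqrt (\<beta> ^ n) / (2 powr ((real n - 2) / 2) * Gamma (real n / 2) * bessel_I (real k + (real n - 2) / 2) \<beta>)
    = \<beta> / funk_hecke n \<beta> k"
proof -
  let ?l = "(real n - 2) / 2"
  define S where "S = bessel_series (real k + ?l) ((\<beta> / 2)\<^sup>2)"
  have l: "?l \<ge> 0" using n by simp
  have I: "bessel_I (real k + ?l) \<beta> = (\<beta> / 2) ^ k * (\<beta> / 2) powr ?l * S"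
    using bessel_I_eq[OF \<beta>, of "real k + ?l"] l \<beta>
    by (simp add: S_def powr_add powr_realpow power_divide)
  have two: "2 powr ?l * (\<beta> / 2) powr ?l = \<beta> powr ?l"
    using \<beta> by (simp add: powr_mult[symmetric])
  have "sqrt (\<beta> ^ n) = \<beta> powr (real n / 2)"
    using \<beta> by (simp add: powr_half_sqrt[symmetric] powr_realpow[symmetric] powr_powr)
  also have "real n / 2 = 1 + ?l" by (simp add: field_simps)
  also have "\<beta> powr (1 + ?l) = \<beta> * \<beta> powr ?l" using \<beta> by (simp add: powr_add)
  finally have num: "sqrt (\<beta> ^ n) = \<beta> * \<beta> powr ?l" .
  have den: "2 powr ?l * Gamma (real n / 2) * bessel_I (real k + ?l) \<beta>
      = \<beta> powr ?l * funk_hecke n \<beta> k"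
    unfolding I two[symmetric] funk_hecke_def S_def by (simp add: mult_ac)
  have "\<beta> powr ?l \<noteq> 0" using \<beta> by simp
  then show ?thesis unfolding num den by simp
qed

theorem proposition6p1:
  fixes \<beta> :: real and k :: nat and i :: "'n::finite"
  assumes "CARD('n) \<ge> 3" and "\<beta> > 0" and "k \<ge> 1"
  shows "\<exists>\<delta> z \<mu>. bifurcation_branch (exp_kernel \<beta>) i k
           (sqrt (\<beta> ^ CARD('n)) /
             (2 powr ((real CARD('n) - 2) / 2) * Gamma (real CARD('n) / 2)
               * bessel_I (real k + (real CARD('n) - 2) / 2) \<beta>))
           \<delta> z \<mu>"
proof -
  define l where "l = (real CARD('n) - 2) / 2"
  have n2: "CARD('n) \<ge> 2" using assms(1) by simp
  obtain j where ij: "i \<noteq> j"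
    using n2 by (metis UNIV_I card_2_iff' card_le_Suc0_iff_eq finite not_less_eq_eq numeral_2_eq_2)
  let ?P = "gegenbauer_mode l" and ?A = "zonal_op i j \<beta>" and ?\<alpha> = "funk_hecke CARD('n) \<beta>"
  let ?coef = "gegenbauer_coeff i l"
  interpret D: diagonal_operator ?A ?P ?coef ?\<alpha>
    unfolding l_def by (rule diagonal_zonal_op[OF ij assms(1,2)])
  interpret simple_mode ?A ?P ?coef ?\<alpha> k
  proof unfold_locales
    show "1 \<le> k" by (rule assms(3))
    show "0 < ?\<alpha> k" by (rule funk_hecke_pos[OF n2 assms(2)])
    show "?\<alpha> j \<noteq> ?\<alpha> k" if "j \<noteq> k" for j by (rule funk_hecke_inj[OF n2 assms(2) that])
  qed
  obtain d z m where d: "d > 0" and cz: "continuous_on {-d<..<d} z" and cm: "continuous_on {-d<..<d} m"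
    and z0: "z 0 = 0" and m0: "m 0 = 0"
    and br: "\<And>t. \<bar>t\<bar> < d \<Longrightarrow> crit + m t > 0 \<and> ?coef 0 (t *\<^sub>R (?P k + z t)) = 0 \<and>
       compose_bcontfun exp ((crit + m t) *\<^sub>R ?A (t *\<^sub>R (?P k + z t)))
       = ?coef 0 (compose_bcontfun exp ((crit + m t) *\<^sub>R ?A (t *\<^sub>R (?P k + z t)))) *\<^sub>R (?P 0 + t *\<^sub>R (?P k + z t))"
    by (rule branch) blast
  define w where "w = sphere_area TYPE('n)"
  have w: "w > 0" unfolding w_def by (rule sphere_area_pos)
  define a where "a = zonal_const i k"
  have a: "a > 0" unfolding a_def by (rule zonal_const_pos[OF assms(1)])
  \<comment> \<open>Since the density is \<open>(1 + \<eta>) / w\<close> and the zonal harmonic is \<open>a\<close> times the Gegenbauer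
    polynomial, the amplitude \<open>t\<close> of the branch is the amplitude \<open>a * w * t\<close> of the profile.\<close>
  define c where "c = a * w"
  have c: "c > 0" using a w by (simp add: c_def)
  define \<delta> where "\<delta> = d / c"
  have \<delta>: "\<delta> > 0" using d c by (simp add: \<delta>_def)
  have ct: "\<bar>c * t\<bar> < d" if "t \<in> {-\<delta><..<\<delta>}" for t
  proof -
    have "\<bar>t\<bar> < d / c" using that by (auto simp: \<delta>_def)
    then show ?thesis using c by (simp add: abs_mult pos_less_divide_eq mult.commute)
  qed
  define zz where "zz t = (\<lambda>x::real^'n. a * apply_bcontfun (z (c * t)) (x $ i))" for t
  define \<mu> where "\<mu> t = \<beta> * m (c * t)" for t
  have contz: "continuous_on {-\<delta><..<\<delta>} (\<lambda>t. z (c * t))" and contm: "continuous_on {-\<delta><..<\<delta>} (\<lambda>t. m (c * t))"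
    by (rule continuous_on_compose2[OF cz] continuous_on_compose2[OF cm];
        use ct in \<open>fastforce intro!: continuous_intros simp: abs_less_iff\<close>)+
  have gamma: "sqrt (\<beta> ^ CARD('n)) / (2 powr ((real CARD('n) - 2) / 2) * Gamma (real CARD('n) / 2)
      * bessel_I (real k + (real CARD('n) - 2) / 2) \<beta>) = \<beta> * crit"
    using critical_parameter[OF assms(2) n2, of k] by (simp add: crit_def)
  have "bifurcation_branch (exp_kernel \<beta>) i k (\<beta> * crit) \<delta> zz \<mu>"
    unfolding bifurcation_branch_def
  proof (intro conjI ballI)
    show "\<delta> > 0" by (rule \<delta>)
    show "continuous_on {-\<delta><..<\<delta>} \<mu>" unfolding \<mu>_def by (intro continuous_intros contm)
    show "AE x in surface_measure. zz 0 x = 0" by (simp add: zz_def z0)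
    show "\<mu> 0 = 0" by (simp add: \<mu>_def m0)
    show "L2_continuous_on {-\<delta><..<\<delta>} surface_measure zz"
      unfolding L2_continuous_on_def
    proof (intro conjI ballI)
      fix t assume t: "t \<in> {-\<delta><..<\<delta>}"
      have cont: "continuous_on (sphere 0 1) (zz t)" for t
        unfolding zz_def by (intro continuous_intros continuous_on_profile)
      show "square_integrable surface_measure (zz t)"
        unfolding square_integrable_def
        by (intro conjI borel_measurable_surface integrable_surface continuous_intros cont)
      have bound: "L2_dist surface_measure (zz s) (zz t) \<le> sqrt (w * (a * norm (z (c * s) - z (c * t)))\<^sup>2)" for s
        unfolding L2_dist_def
      proof (rule real_sqrt_le_mono)
        have "\<bar>sphere_mean (\<lambda>x. (zz s x - zz t x)\<^sup>2)\<bar> \<le> (a * norm (z (c * s) - z (c * t)))\<^sup>2"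
        proof (rule sphere_mean_abs_le)
          fix x :: "real^'n"
          have "\<bar>zz s x - zz t x\<bar> = a * \<bar>apply_bcontfun (z (c * s) - z (c * t)) (x $ i)\<bar>"
            using a by (simp add: zz_def right_diff_distrib[symmetric] abs_mult)
          also have "\<dots> \<le> a * norm (z (c * s) - z (c * t))"
            using a norm_bounded[of "z (c * s) - z (c * t)" "x $ i"] by (intro mult_left_mono) auto
          finally show "\<bar>(zz s x - zz t x)\<^sup>2\<bar> \<le> (a * norm (z (c * s) - z (c * t)))\<^sup>2"
            by (metis abs_ge_zero abs_power2 power2_abs power_mono)
        qed (intro continuous_intros cont)
        then show "(\<integral>x. (zz s x - zz t x)\<^sup>2 \<partial>surface_measure) \<le> w * (a * norm (z (c * s) - z (c * t)))\<^sup>2"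
          unfolding integral_eq_sphere_mean w_def[symmetric] using w by (intro mult_left_mono) auto
      qed
      have "((\<lambda>s. z (c * s)) \<longlongrightarrow> z (c * t)) (at t within {-\<delta><..<\<delta>})"
        using contz t by (simp add: continuous_on_def)
      then have "((\<lambda>s. sqrt (w * (a * norm (z (c * s) - z (c * t)))\<^sup>2)) \<longlongrightarrow> sqrt (w * (a * 0)\<^sup>2)) (at t within {-\<delta><..<\<delta>})"
        by (intro tendsto_intros) (simp add: LIM_zero tendsto_norm_zero)
      then show "((\<lambda>s. L2_dist surface_measure (zz s) (zz t)) \<longlongrightarrow> 0) (at t within {-\<delta><..<\<delta>})"
        by (intro Lim_null_comparison[of "\<lambda>s. L2_dist surface_measure (zz s) (zz t)"
              "\<lambda>s. sqrt (w * (a * norm (z (c * s) - z (c * t)))\<^sup>2)"] always_eventually allI)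
           (use bound in \<open>auto simp: L2_dist_def\<close>)
    qed
    fix t assume t: "t \<in> {-\<delta><..<\<delta>}"
    note b = br[OF ct[OF t]]
    define \<kappa> where "\<kappa> = crit + m (c * t)"
    define \<eta> where "\<eta> = (c * t) *\<^sub>R (?P k + z (c * t))"
    have \<kappa>: "\<beta> * crit + \<mu> t = \<beta> * \<kappa>" by (simp add: \<mu>_def \<kappa>_def distrib_left)
    show "0 < \<beta> * crit + \<mu> t" unfolding \<kappa> using b assms(2) by (simp add: \<kappa>_def)
    have mean0: "?coef 0 f = sphere_mean (\<lambda>x::real^'n. apply_bcontfun f (x $ i))" for f
      by (simp add: gegenbauer_coeff_def)
    have eq: "exp (\<kappa> * apply_bcontfun (?A \<eta>) s)
      = sphere_mean (\<lambda>x::real^'n. exp (\<kappa> * apply_bcontfun (?A \<eta>) (x $ i))) * (1 + apply_bcontfun \<eta> s)" for s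
    proof -
      have "apply_bcontfun (compose_bcontfun exp (\<kappa> *\<^sub>R ?A \<eta>)) s
          = apply_bcontfun (?coef 0 (compose_bcontfun exp (\<kappa> *\<^sub>R ?A \<eta>)) *\<^sub>R (?P 0 + \<eta>)) s"
        using b by (simp only: \<kappa>_def \<eta>_def)
      then show ?thesis
        by (simp add: apply_compose_bcontfun continuous_intros mean0 apply_gegenbauer_mode)
    qed
    have \<rho>: "uniform_density y + t * zonal_harmonic i k y + t * zz t y
        = (1 + apply_bcontfun \<eta> (y $ i)) / sphere_area TYPE('n)" if "norm y = 1" for y :: "real^'n"
      using w gegenbauer_mode_sphere[OF that, of l k i]
      by (simp add: uniform_density_def zonal_harmonic_def zonal_gegenbauer_def zz_def \<eta>_def c_def
          a_def[symmetric] w_def[symmetric] l_def[symmetric] field_simps)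
    show "AE x in surface_measure. gibbs_map (exp_kernel \<beta>)
        (\<lambda>y. uniform_density y + t * zonal_harmonic i k y + t * zz t y) (\<beta> * crit + \<mu> t) x = 0"
      unfolding \<kappa> by (rule AE_I2, rule gibbs_map_zonal_zero[OF ij n2 assms(2) _ eq \<rho>]) simp_all
  qed
  then show ?thesis unfolding gamma by blast
qed

end
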